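(* Let $\mathbf{G}=\mathrm{Aut}(\mathbf{M})$ and let $H$ be a subgroup of $\mathbf{G}$ with $[\mathbf{G}:H]<2^{\aleph_0}$. Then there exist a finite set $A\subseteq\mathbf{M}$ and $X=\mathrm{gcl}(A)$ such that $\mathbf{G}_X\leq H$, where $\mathbf{G}_X=\{g\in\mathbf{G}: g(x)=x \text{ for all } x\in X\}$.
   Context: Fix an integer $\mathfrak{m}\ge 2$. All structures are graphs, i.e. structures in a language with one binary relation $\mathcal{R}$ that is irreflexive and symmetric; $\mathcal{R}(A)$ denotes the set of edges of $A$. For a finite graph $A$ put $\delta(A)=\mathfrak{m}\cdot|A|-|\mathcal{R}(A)|$. For finite graphs $A\subseteq B$ write $A\leqslant B$ ($A$ is $\leqslant$-closed in $B$) iff $\delta(A')\ge\delta(A)$ for all $A\subseteq A'\subseteq B$; for an infinite graph $N$ and $A\subseteq N$, $A\leqslant N$ means $A\leqslant B$ for every finite $B\subseteq N$ containing $A$. Let $\mathsf{K_0}$ be the class of finite graphs $A$ with $\delta(A')\ge 0$ for all $A'\subseteq A$. $\mathbf{M}$ denotes the $(\mathsf{K_0},\leqslant)$-generic structure: the unique countable graph which is the union of a chain of finite $\leqslant$-closed subsets, in which every isomorphism between finite $\leqslant$-closed subsets extends to an automorphism of $\mathbf{M}$, and such that every element of $\mathsf{K_0}$ is isomorphic to a $\leqslant$-closed subset of $\mathbf{M}$. For finite $A\subseteq\mathbf{M}$, $\mathrm{cl}(A)$ is the smallest finite $\leqslant$-closed subset of $\mathbf{M}$ containing $A$, $\mathrm{d}(A)=\delta(\mathrm{cl}(A))$,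 and $\mathrm{d}(m/A)=\mathrm{d}(\{m\}\cup A)-\mathrm{d}(A)$. For $X\subseteq\mathbf{M}$, $\mathrm{gcl}(X)=\{m\in\mathbf{M}:\mathrm{d}(m/A)=0\text{ for some finite }A\subseteq X\}$. *)

theory Defs
  imports Complex_Main "HOL-Library.Countable_Set" "HOL-Library.Equipollence"
begin

text \<open>Graphs are given by an edge predicate E on a vertex type; the vertex set of the
ambient structure is UNIV. A finite graph is a finite vertex set together with E.\<close>

definition edges :: "('a \<Rightarrow> 'a \<Rightarrow> bool) \<Rightarrow> 'a set \<Rightarrow> 'a set set" where
  "edges E A = {{x, y} | x y. x \<in> A \<and> y \<in> A \<and> E x y}"

definition delta :: "nat \<Rightarrow> ('a \<Rightarrow> 'a \<Rightarrow> bool) \<Rightarrow> 'a set \<Rightarrow> int" where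
  "delta m E A = int m * int (card A) - int (card (edges E A))"

definition is_graph :: "('a \<Rightarrow> 'a \<Rightarrow> bool) \<Rightarrow> bool" where
  "is_graph E \<longleftrightarrow> (\<forall>x. \<not> E x x) \<and> (\<forall>x y. E x y \<longrightarrow> E y x)"

definition fin_closed :: "nat \<Rightarrow> ('a \<Rightarrow> 'a \<Rightarrow> bool) \<Rightarrow> 'a set \<Rightarrow> 'a set \<Rightarrow> bool" where
  "fin_closed m E A B \<longleftrightarrow> A \<subseteq> B \<and>
     (\<forall>A'. A \<subseteq> A' \<and> A' \<subseteq> B \<longrightarrow> delta m E A' \<ge> delta m E A)"

definition closed_in :: "nat \<Rightarrow> ('a \<Rightarrow> 'a \<Rightarrow> bool) \<Rightarrow> 'a set \<Rightarrow> 'a set \<Rightarrow> bool" where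
  "closed_in m E A N \<longleftrightarrow> A \<subseteq> N \<and>
     (\<forall>B. finite B \<and> A \<subseteq> B \<and> B \<subseteq> N \<longrightarrow> fin_closed m E A B)"

definition in_K0 :: "nat \<Rightarrow> ('a \<Rightarrow> 'a \<Rightarrow> bool) \<Rightarrow> 'a set \<Rightarrow> bool" where
  "in_K0 m E A \<longleftrightarrow> finite A \<and> (\<forall>A' \<subseteq> A. delta m E A' \<ge> 0)"

definition Aut :: "('a \<Rightarrow> 'a \<Rightarrow> bool) \<Rightarrow> ('a \<Rightarrow> 'a) set" where
  "Aut E = {g. bij g \<and> (\<forall>x y. E x y \<longleftrightarrow> E (g x) (g y))}"

definition is_generic :: "nat \<Rightarrow> ('a \<Rightarrow> 'a \<Rightarrow> bool) \<Rightarrow> bool" where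
  "is_generic m E \<longleftrightarrow>
     is_graph E \<and> countable (UNIV :: 'a set) \<and>
     (\<forall>A. finite A \<longrightarrow> in_K0 m E A) \<and>
     (\<exists>C :: nat \<Rightarrow> 'a set. (\<forall>n. finite (C n) \<and> closed_in m E (C n) UNIV \<and> C n \<subseteq> C (Suc n))
        \<and> (\<Union>n. C n) = UNIV) \<and>
     (\<forall>A B f. finite A \<and> finite B \<and> closed_in m E A UNIV \<and> closed_in m E B UNIV \<and>
        bij_betw f A B \<and> (\<forall>x\<in>A. \<forall>y\<in>A. E x y \<longleftrightarrow> E (f x) (f y)) \<longrightarrow>
        (\<exists>g\<in>Aut E. \<forall>x\<in>A. g x = f x)) \<and>
     (\<forall>(A :: nat set) (R :: nat \<Rightarrow> nat \<Rightarrow> bool). is_graph R \<and> in_K0 m R A \<longrightarrow>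
        (\<exists>f. inj_on f A \<and> (\<forall>x\<in>A. \<forall>y\<in>A. R x y \<longleftrightarrow> E (f x) (f y)) \<and>
             closed_in m E (f ` A) UNIV))"

definition cl :: "nat \<Rightarrow> ('a \<Rightarrow> 'a \<Rightarrow> bool) \<Rightarrow> 'a set \<Rightarrow> 'a set" where
  "cl m E A = \<Inter> {B. finite B \<and> A \<subseteq> B \<and> closed_in m E B UNIV}"

definition dd :: "nat \<Rightarrow> ('a \<Rightarrow> 'a \<Rightarrow> bool) \<Rightarrow> 'a set \<Rightarrow> int" where
  "dd m E A = delta m E (cl m E A)"

definition dd_rel :: "nat \<Rightarrow> ('a \<Rightarrow> 'a \<Rightarrow> bool) \<Rightarrow> 'a \<Rightarrow> 'a set \<Rightarrow> int" where
  "dd_rel m E x A = dd m E (insert x A) - dd m E A"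

definition gcl :: "nat \<Rightarrow> ('a \<Rightarrow> 'a \<Rightarrow> bool) \<Rightarrow> 'a set \<Rightarrow> 'a set" where
  "gcl m E X = {x. \<exists>A. finite A \<and> A \<subseteq> X \<and> dd_rel m E x A = 0}"

definition fix_stab :: "('a \<Rightarrow> 'a \<Rightarrow> bool) \<Rightarrow> 'a set \<Rightarrow> ('a \<Rightarrow> 'a) set" where
  "fix_stab E X = {g \<in> Aut E. \<forall>x\<in>X. g x = x}"

definition is_subgroup :: "('a \<Rightarrow> 'a \<Rightarrow> bool) \<Rightarrow> ('a \<Rightarrow> 'a) set \<Rightarrow> bool" where
  "is_subgroup E H \<longleftrightarrow> H \<subseteq> Aut E \<and> id \<in> H \<and>
     (\<forall>g\<in>H. \<forall>h\<in>H. g \<circ> h \<in> H) \<and> (\<forall>g\<in>H. inv g \<in> H)"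

definition left_cosets :: "('a \<Rightarrow> 'a \<Rightarrow> bool) \<Rightarrow> ('a \<Rightarrow> 'a) set \<Rightarrow> ('a \<Rightarrow> 'a) set set" where
  "left_cosets E H = {(\<lambda>h. g \<circ> h) ` H | g. g \<in> Aut E}"

end

theory Submission
  imports Defs
begin

text \<open>
Suppose \<open>H\<close> contains no pointwise stabiliser \<open>G\<^sub>X\<close> of a set \<open>X = gcl(A)\<close>, \<open>A\<close> finite, and pick \<open>c\<^sub>X \<in> G\<^sub>X - H\<close>
for each of these countably many \<open>X\<close>. The group \<open>G\<close>, topologised by the subgroups \<open>G\<^sub>X\<close>, is completely
metrisable but not separable; so one passes to the closure of a countable subgroup \<open>S\<close> that contains
all \<open>c\<^sub>X\<close> and is closed under witnesses for two properties of the family of the sets \<open>X\<close>. First, an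
automorphism defined on \<open>X\<close> and mapping it into \<open>Z \<supseteq> X\<close> can be changed outside \<open>X\<close> so that it preserves \<open>Z\<close>: as
long as \<open>X \<noteq> Z\<close>, the set \<open>Z\<close> contains a vertex \<open>e\<close> of dimension one over \<open>X\<close> with \<open>m - 1\<close> prescribed neighbours
in \<open>X\<close>, and all such \<open>e\<close> are conjugate over \<open>X\<close>; now induct on the dimension of \<open>Z\<close> over \<open>X\<close>. Second, two
extensions of \<open>X\<close> can be put in free position, and then automorphisms of them that agree on \<open>X\<close> have a
common extension.

These two properties give generic tuples in the closure of \<open>S\<close>: generic tuples that agree on an
invariant \<open>X\<close> are conjugate over \<open>X\<close>, and extending a generic tuple generically is a comeagre condition.
As \<open>H\<close> has small index it is not meagre (Mycielski), and as \<open>c\<^sub>X \<notin> H\<close> it is not comeagre in any \<open>G\<^sub>X\<close>. Hence one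
finds successively \<open>u\<^sub>n \<in> H\<close> and \<open>v\<^sub>n \<notin> H\<close> and \<open>k\<^sub>n\<close>, close to the identity and centralising all earlier
\<open>u\<^sub>i, v\<^sub>i\<close>, with \<open>v\<^sub>n = k\<^sub>n u\<^sub>n k\<^sub>n\<^sup>-\<^sup>1\<close>. The infinite products of the \<open>k\<^sub>n\<close> along subsets of the natural numbers
lie in pairwise distinct cosets of \<open>H\<close>: if \<open>n\<close> is the first index at which two subsets differ, conjugation
by the quotient of the two products moves \<open>u\<^sub>n\<close> to \<open>v\<^sub>n\<close>.
\<close>

section \<open>Permutation groups with a family of distinguished sets\<close>

abbreviation eqon :: "'a set \<Rightarrow> ('a \<Rightarrow> 'b) \<Rightarrow> ('a \<Rightarrow> 'b) \<Rightarrow> bool" where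
  "eqon X f g \<equiv> \<forall>x\<in>X. f x = g x"

lemma image_eqon: "eqon Z f g \<Longrightarrow> f ` Z = g ` Z"
  by (auto simp: image_def)

lemma chain_limit:
  assumes V: "\<And>n::nat. V n \<subseteq> V (Suc n)" and eq: "\<And>n. eqon (V n) (c (Suc n)) (c n)"
  shows "\<exists>g. \<forall>n. eqon (V n) g (c n)"
proof -
  have mono: "V n \<subseteq> V k" if "n \<le> k" for n k
    using V that by (rule lift_Suc_mono_le)
  have stable: "c k x = c n x" if "n \<le> k" "x \<in> V n" for n k x
    using that(1)
  proof (induction k rule: dec_induct)
    case (step k)
    then show ?case using eq[of k] mono[OF step(1)] that(2) by auto
  qed simp
  have "c (SOME n. x \<in> V n) x = c n x" if x: "x \<in> V n" for n x
  proof -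
    have "x \<in> V (SOME n. x \<in> V n)" using x by (rule someI)
    then show ?thesis using x stable by (metis nle_le)
  qed
  then show ?thesis by (intro exI[of _ "\<lambda>x. c (SOME n. x \<in> V n) x"]) blast
qed

text \<open>A real is determined by the rationals below it, and these are coded by natural numbers.
  This turns pairwise different cosets indexed by all sets of naturals into continuum many.\<close>

lemma real_lepoll_nat_sets: "(UNIV :: real set) \<lesssim> (UNIV :: nat set set)"
proof -
  define f where "f x = to_nat ` {q::rat. of_rat q < x}" for x :: real
  have "inj f"
  proof (rule injI, rule ccontr)
    fix x y :: real
    assume fxy: "f x = f y" and "x \<noteq> y"
    then have cut: "{q::rat. of_rat q < x} = {q. of_rat q < y}"
      unfolding f_def by (simp add: inj_image_eq_iff)
    show False
      using \<open>x \<noteq> y\<close> of_rat_dense[of x y] of_rat_dense[of y x] cut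
      by (metis (no_types, lifting) less_asym mem_Collect_eq linorder_neqE_linordered_idom)
  qed
  then show ?thesis
    unfolding lepoll_def by blast
qed

text \<open>The pointwise stabilisers of the members of \<open>XX\<close> serve as a basis of
  neighbourhoods of the identity. Members may be infinite, so this topology is in general finer than
  pointwise convergence, while \<open>closed_G\<close> asks for closedness under pointwise
  convergence among the bijections.\<close>

locale perm_family =
  fixes G :: "('a \<Rightarrow> 'a) set" and XX :: "'a set set"
  assumes bij_G: "g \<in> G \<Longrightarrow> bij g"
    and id_G: "id \<in> G"
    and comp_G: "g \<in> G \<Longrightarrow> h \<in> G \<Longrightarrow> g \<circ> h \<in> G"
    and inv_G: "g \<in> G \<Longrightarrow> inv g \<in> G"
    and closed_G: "bij g \<Longrightarrow> (\<And>F. finite F \<Longrightarrow> \<exists>h\<in>G. eqon F g h) \<Longrightarrow> g \<in> G"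
    and countable_XX: "countable XX"
    and cover_XX: "\<exists>X\<in>XX. x \<in> X"
    and directed_XX: "X \<in> XX \<Longrightarrow> Y \<in> XX \<Longrightarrow> \<exists>Z\<in>XX. X \<union> Y \<subseteq> Z"
    and image_XX: "g \<in> G \<Longrightarrow> X \<in> XX \<Longrightarrow> g ` X \<in> XX"
begin

lemma G_simps [simp]:
  assumes "g \<in> G"
  shows "inv g (g x) = x" "g (inv g x) = x" "g x = g y \<longleftrightarrow> x = y"
    "inv (inv g) = g"
  using bij_G[OF assms]
  by (auto simp: bij_is_inj bij_is_surj surj_f_inv_f inv_inv_eq inj_eq)

lemma inv_image_eq [simp]:
  assumes "g \<in> G"
  shows "inv g ` g ` X = X" "g ` inv g ` X = X"
  using assms by (auto simp: image_iff)

lemma inv_comp_G: "g \<in> G \<Longrightarrow> h \<in> G \<Longrightarrow> inv (g \<circ> h) = inv h \<circ> inv g"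
  by (simp add: bij_G o_inv_distrib)

lemma directed_finite:
  assumes "finite \<F>" "\<F> \<subseteq> XX"
  shows "\<exists>Z\<in>XX. \<Union>\<F> \<subseteq> Z"
  using assms
proof (induction rule: finite_induct)
  case empty
  then show ?case using cover_XX by auto
next
  case (insert X \<F>)
  then obtain Z where Z: "Z \<in> XX" "\<Union>\<F> \<subseteq> Z" by auto
  have "X \<in> XX" using insert.prems by simp
  then obtain Z' where "Z' \<in> XX" "X \<union> Z \<subseteq> Z'" using directed_XX[of X Z] Z(1) by blast
  then show ?case using Z(2) by (intro bexI[of _ Z']) auto
qed

text \<open>Bookkeeping for the later limits: a construction that treats \<open>w n\<close> at stage
  \<open>n\<close> treats every member of \<open>XX\<close>, because \<open>w n\<close> contains the
  first \<open>n + 1\<close> sets of an enumeration.\<close>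

lemma exhaustion:
  "\<exists>w :: nat \<Rightarrow> 'a set. (\<forall>n. w n \<in> XX) \<and> (\<forall>X\<in>XX. \<exists>n. \<forall>k\<ge>n. X \<subseteq> w k)"
proof -
  obtain X0 where "X0 \<in> XX" using cover_XX by blast
  then obtain e :: "nat \<Rightarrow> 'a set" where e: "range e = XX"
    using countable_XX uncountable_def by (metis countable_as_injective_image empty_iff range_from_nat_into)
  have "\<exists>Z\<in>XX. (\<Union>i\<le>n. e i) \<subseteq> Z" for n
    using directed_finite[of "e ` {..n}"] e by auto
  then obtain w where w: "\<And>n. w n \<in> XX" "\<And>n. (\<Union>i\<le>n. e i) \<subseteq> w n" by metis
  have "\<exists>n. \<forall>k\<ge>n. X \<subseteq> w k" if "X \<in> XX" for X
  proof -
    from \<open>X \<in> XX\<close> obtain n where "X = e n" unfolding e[symmetric] by blast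
    then show ?thesis using w(2) by (metis UN_subset_iff atMost_iff)
  qed
  with w(1) show ?thesis by blast
qed

text \<open>Injectivity and agreement with elements of \<open>G\<close> on finite sets pass to the
  limit by themselves; surjectivity does not, and \<open>cover'\<close> provides it.\<close>

lemma limit:
  assumes c: "\<And>n. c n \<in> G"
    and V: "\<And>n. V n \<subseteq> V (Suc n)"
    and eq: "\<And>n. eqon (V n) (c (Suc n)) (c n)"
    and cover: "\<And>x. \<exists>n. x \<in> V n"
    and cover': "\<And>x. \<exists>n. x \<in> c n ` V n"
  shows "\<exists>g\<in>G. \<forall>n. eqon (V n) g (c n)"
proof -
  have mono: "V n \<subseteq> V k" if "n \<le> k" for n k
    using V that by (rule lift_Suc_mono_le)
  obtain g where "\<forall>n. eqon (V n) g (c n)" using chain_limit[of V c, OF V eq] by (elim exE)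
  then have g: "g x = c n x" if "x \<in> V n" for n x using that by blast
  have fin: "\<exists>n. F \<subseteq> V n" if "finite F" for F
    using that
  proof (induction rule: finite_induct)
    case (insert x F)
    then obtain n k where "F \<subseteq> V n" "x \<in> V k" using cover by blast
    then have "insert x F \<subseteq> V (max n k)"
      using mono[of n "max n k"] mono[of k "max n k"] by auto
    then show ?case by blast
  qed auto
  have "inj g"
  proof (rule injI)
    fix x y assume "g x = g y"
    obtain n where "{x, y} \<subseteq> V n" using fin[of "{x, y}"] by auto
    then show "x = y" using \<open>g x = g y\<close> g[of x n] g[of y n] c by simp
  qed
  moreover have "surj g"
    unfolding surj_def using cover' g by (metis imageE)
  ultimately have "bij g" by (simp add: bij_def)
  moreover have "\<exists>h\<in>G. eqon F g h" if "finite F" for F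
    using fin[OF that] g c by blast
  ultimately have "g \<in> G" by (rule closed_G)
  then show ?thesis using g by blast
qed

end

section \<open>Countable subgroups with witnesses and their closures\<close>

definition preserves :: "('a \<Rightarrow> 'a) list \<Rightarrow> 'a set \<Rightarrow> bool" where
  "preserves fs Z \<longleftrightarrow> (\<forall>f\<in>set fs. f ` Z = Z)"

lemma preserves_append [simp]: "preserves (fs @ gs) Z \<longleftrightarrow> preserves fs Z \<and> preserves gs Z"
  by (auto simp: preserves_def)

lemma preserves_single [simp]: "preserves [f] Z \<longleftrightarrow> f ` Z = Z"
  by (simp add: preserves_def)

text \<open>Free position over \<open>X\<close> of \<open>Y2\<close> and the translate of
  \<open>Y1\<close>. The common extensions also preserve one common set \<open>Z\<close>, so that
  several of them form a system on \<open>Z\<close> again. The set \<open>F\<close> is a parameter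
  because the notion is used both for \<open>G\<close> and for the countable subgroup
  \<open>S\<close>.\<close>

definition amalgamates :: "('a \<Rightarrow> 'a) set \<Rightarrow> 'a set \<Rightarrow> 'a set \<Rightarrow> 'a set \<Rightarrow> ('a \<Rightarrow> 'a) \<Rightarrow> 'a set \<Rightarrow> bool" where
  "amalgamates F X Y1 Y2 g Z \<longleftrightarrow> eqon X g id \<and> g ` Y1 \<subseteq> Z \<and> Y2 \<subseteq> Z \<and>
    (\<forall>f1\<in>F. \<forall>f2\<in>F. eqon X f1 f2 \<longrightarrow> f1 ` g ` Y1 = g ` Y1 \<longrightarrow> f2 ` Y2 = Y2 \<longrightarrow>
      (\<exists>f\<in>F. eqon (g ` Y1) f f1 \<and> eqon Y2 f f2 \<and> f ` Z = Z))"

text \<open>\<open>S\<close> is a countable subgroup that contains its own witnesses for extension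
  and amalgamation; in \<open>amalgam_S\<close> the given maps and their common extension are all
  taken from \<open>S\<close>.\<close>

locale dense_family = perm_family +
  fixes S :: "('a \<Rightarrow> 'a) set"
  assumes S_G: "S \<subseteq> G"
    and countable_S: "countable S"
    and id_S: "id \<in> S"
    and comp_S: "g \<in> S \<Longrightarrow> h \<in> S \<Longrightarrow> g \<circ> h \<in> S"
    and inv_S: "g \<in> S \<Longrightarrow> inv g \<in> S"
    and extend_S: "g \<in> S \<Longrightarrow> X \<in> XX \<Longrightarrow> Z \<in> XX \<Longrightarrow> X \<subseteq> Z \<Longrightarrow> g ` X \<subseteq> Z \<Longrightarrow>
      \<exists>f\<in>S. eqon X f g \<and> f ` Z = Z"
    and amalgam_S: "X \<in> XX \<Longrightarrow> Y1 \<in> XX \<Longrightarrow> Y2 \<in> XX \<Longrightarrow> X \<subseteq> Y1 \<Longrightarrow> X \<subseteq> Y2 \<Longrightarrow>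
      \<exists>g\<in>S. \<exists>Z\<in>XX. amalgamates S X Y1 Y2 g Z"
begin

text \<open>The closure of \<open>S\<close> for the topology given by \<open>XX\<close>. It is a
  completely metrisable group in which the countable set \<open>S\<close> is dense, so Baire
  category arguments apply.\<close>

definition GS :: "('a \<Rightarrow> 'a) set" where
  "GS = {g \<in> G. \<forall>X\<in>XX. \<exists>s\<in>S. eqon X g s}"

lemma S_G' [simp]: "s \<in> S \<Longrightarrow> s \<in> G" using S_G by blast

lemma GS_G [simp]: "g \<in> GS \<Longrightarrow> g \<in> G" by (simp add: GS_def)

lemma S_GS: "s \<in> S \<Longrightarrow> s \<in> GS" unfolding GS_def using S_G by blast

lemma image_S: "s \<in> S \<Longrightarrow> X \<in> XX \<Longrightarrow> s ` X \<in> XX"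
  by (simp add: image_XX)

lemma GS_approx:
  assumes "g \<in> GS" "X \<in> XX"
  obtains s where "s \<in> S" "eqon X g s"
  using assms unfolding GS_def by blast

lemma comp_GS:
  assumes "g \<in> GS" "h \<in> GS" shows "g \<circ> h \<in> GS"
proof -
  have "\<exists>s\<in>S. eqon X (g \<circ> h) s" if X: "X \<in> XX" for X
  proof -
    obtain s where s: "s \<in> S" "eqon X h s" using assms(2) X by (rule GS_approx)
    obtain t where t: "t \<in> S" "eqon (s ` X) g t" using assms(1) image_S[OF s(1) X] by (rule GS_approx)
    have "eqon X (g \<circ> h) (t \<circ> s)" using s t by simp
    then show ?thesis using comp_S[OF t(1) s(1)] by blast
  qed
  then show ?thesis using assms comp_G unfolding GS_def by simp
qed

lemma inv_GS:
  assumes "g \<in> GS" shows "inv g \<in> GS"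
proof -
  have "\<exists>s\<in>S. eqon X (inv g) s" if X: "X \<in> XX" for X
  proof -
    have "inv g ` X \<in> XX" using X assms by (simp add: image_XX inv_G)
    with assms obtain s where s: "s \<in> S" "eqon (inv g ` X) g s" by (rule GS_approx)
    have "inv g x = inv s x" if "x \<in> X" for x
      using s that assms by (metis GS_G G_simps(1,2) S_G' imageI)
    then show ?thesis using inv_S[OF s(1)] by blast
  qed
  then show ?thesis using assms inv_G unfolding GS_def by simp
qed

text \<open>Completeness of \<open>GS\<close>. Since every member of \<open>XX\<close> is eventually
  contained in \<open>w n\<close>, the limit is total and onto, and on each member it agrees with
  some \<open>c n\<close>, hence with an element of \<open>S\<close>.\<close>

lemma limit_GS:
  assumes c: "\<And>n. c n \<in> GS"
    and V: "\<And>n. V n \<subseteq> V (Suc n)"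
    and eq: "\<And>n. eqon (V n) (c (Suc n)) (c n)"
    and w: "\<And>X. X \<in> XX \<Longrightarrow> \<exists>n. \<forall>k\<ge>n. X \<subseteq> w k"
    and dom: "\<And>n. w n \<subseteq> V n" and ran: "\<And>n. w n \<subseteq> c n ` V n"
  shows "\<exists>g\<in>GS. \<forall>n. eqon (V n) g (c n)"
proof -
  have "\<exists>n. x \<in> V n" for x using w dom cover_XX by (meson order_refl subsetD)
  moreover have "\<exists>n. x \<in> c n ` V n" for x using w ran cover_XX by (meson order_refl subsetD)
  ultimately obtain g where g: "g \<in> G" "\<And>n. eqon (V n) g (c n)"
    using limit[of c V] c V eq by auto
  have "\<exists>s\<in>S. eqon X g s" if "X \<in> XX" for X
  proof -
    obtain n where n: "X \<subseteq> w n" using w[OF \<open>X \<in> XX\<close>] by blast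
    obtain s where "s \<in> S" "eqon X (c n) s" using c \<open>X \<in> XX\<close> by (rule GS_approx)
    then show ?thesis using n dom[of n] g(2)[of n] by (metis subsetD)
  qed
  then have "g \<in> GS" using g(1) unfolding GS_def by blast
  then show ?thesis using g(2) by blast
qed

section \<open>Baire category and Mycielski's construction\<close>

definition nbhd :: "('a \<Rightarrow> 'a) \<Rightarrow> 'a set \<Rightarrow> ('a \<Rightarrow> 'a) set" where
  "nbhd s V = {g \<in> GS. eqon V g s}"

text \<open>\<open>D\<close> contains a dense, relatively open part of the pointwise stabiliser of
  \<open>X\<close> in \<open>GS\<close>. Neighbourhoods centred at elements of \<open>S\<close>
  suffice because \<open>S\<close> is dense in \<open>GS\<close>.\<close>

definition dense :: "'a set \<Rightarrow> ('a \<Rightarrow> 'a) set \<Rightarrow> bool" where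
  "dense X D \<longleftrightarrow> (\<forall>s\<in>S. \<forall>V\<in>XX. X \<subseteq> V \<longrightarrow> eqon X s id \<longrightarrow>
     (\<exists>t\<in>S. \<exists>U\<in>XX. V \<subseteq> U \<and> eqon V t s \<and> nbhd t U \<subseteq> D))"

lemma denseE:
  assumes "dense X D" "s \<in> S" "V \<in> XX" "X \<subseteq> V" "eqon X s id"
  obtains t U where "t \<in> S" "U \<in> XX" "V \<subseteq> U" "eqon V t s" "nbhd t U \<subseteq> D"
proof -
  have "\<exists>t\<in>S. \<exists>U\<in>XX. V \<subseteq> U \<and> eqon V t s \<and> nbhd t U \<subseteq> D"
    using assms(1)[unfolded dense_def, rule_format, OF assms(2-4)] assms(5) by simp
  then show ?thesis by (elim bexE conjE) (rule that)
qed

text \<open>Left translation by an element fixing \<open>X\<close> permutes the basic neighbourhoods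
  inside the stabiliser of \<open>X\<close>. It allows generic properties to be imposed on
  \<open>g\<close> and on \<open>c \<circ> g\<close> at once.\<close>

lemma dense_translate:
  assumes D: "dense X D" and c: "c \<in> S" "eqon X c id"
  shows "dense X {g. c \<circ> g \<in> D}"
  unfolding dense_def
proof (intro ballI impI)
  fix s V assume s: "s \<in> S" and V: "V \<in> XX" "X \<subseteq> V" and sX: "eqon X s id"
  have cs: "c \<circ> s \<in> S" "eqon X (c \<circ> s) id" using comp_S[OF c(1) s] c(2) sX by auto
  obtain t U where t: "t \<in> S" "U \<in> XX" "V \<subseteq> U" "eqon V t (c \<circ> s)" "nbhd t U \<subseteq> D"
    by (rule denseE[OF D cs(1) V cs(2)])
  have "c \<circ> g \<in> D" if "g \<in> nbhd (inv c \<circ> t) U" for g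
  proof -
    have "c \<circ> g \<in> nbhd t U"
      using that comp_GS[OF S_GS[OF c(1)]] c(1) unfolding nbhd_def by simp
    then show ?thesis using t(5) by blast
  qed
  moreover have "eqon V (inv c \<circ> t) s" using t(4) c(1) by simp
  ultimately show "\<exists>t\<in>S. \<exists>U\<in>XX. V \<subseteq> U \<and> eqon V t s \<and> nbhd t U \<subseteq> {g. c \<circ> g \<in> D}"
    using t(2,3) comp_S[OF inv_S[OF c(1)] t(1)]
    by (intro bexI[of _ "inv c \<circ> t"] bexI[of _ U] conjI) auto
qed

text \<open>The range condition of \<open>limit_GS\<close> is met by adding to \<open>U\<close> the
  preimages of \<open>W\<close> under the finitely many maps in \<open>Q\<close>.\<close>

lemma enlarge:
  assumes "finite Q" "Q \<subseteq> G" "V \<in> XX" "W \<in> XX"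
  shows "\<exists>U\<in>XX. V \<subseteq> U \<and> W \<subseteq> U \<and> (\<forall>q\<in>Q. W \<subseteq> q ` U)"
proof -
  have "\<exists>U\<in>XX. \<Union>({V, W} \<union> (\<lambda>q. inv q ` W) ` Q) \<subseteq> U"
    using assms by (intro directed_finite) (auto simp: image_XX inv_G)
  then obtain U where U: "U \<in> XX" "V \<subseteq> U" "W \<subseteq> U" "\<And>q. q \<in> Q \<Longrightarrow> inv q ` W \<subseteq> U" by (auto simp: UN_subset_iff)
  have "W \<subseteq> q ` U" if "q \<in> Q" for q
  proof
    fix x assume "x \<in> W"
    then have "q (inv q x) \<in> q ` U" using U(4)[OF that] by blast
    then show "x \<in> q ` U" using assms(2) that by auto
  qed
  with U(1-3) show ?thesis by (intro bexI[of _ U]) auto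
qed

text \<open>The Baire category theorem for the stabiliser of \<open>X\<close>: a decreasing sequence
  of basic neighbourhoods enters the sets \<open>D n\<close> one after the other.\<close>

lemma baire:
  assumes D: "\<And>i::nat. dense X (D i)" and X: "X \<in> XX"
  shows "\<exists>g\<in>GS. eqon X g id \<and> (\<forall>i. g \<in> D i)"
proof -
  obtain w :: "nat \<Rightarrow> 'a set" where w: "\<And>n. w n \<in> XX" "\<And>X. X \<in> XX \<Longrightarrow> \<exists>n. \<forall>k\<ge>n. X \<subseteq> w k"
    using exhaustion by blast
  define P where "P n x \<longleftrightarrow> fst x \<in> S \<and> snd x \<in> XX \<and> X \<subseteq> snd x \<and> eqon X (fst x) id \<and>
     w n \<subseteq> snd x \<and> w n \<subseteq> fst x ` snd x \<and> nbhd (fst x) (snd x) \<subseteq> D n"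
    for n and x :: "('a \<Rightarrow> 'a) \<times> 'a set"
  define R where "R x y \<longleftrightarrow> snd x \<subseteq> snd y \<and> eqon (snd x) (fst y) (fst x)"
    for x y :: "('a \<Rightarrow> 'a) \<times> 'a set"
  have step: "\<exists>y. P n y \<and> R (s, V) y"
    if sV: "s \<in> S" "V \<in> XX" "X \<subseteq> V" "eqon X s id" for s V n
  proof -
    obtain t U where t: "t \<in> S" "U \<in> XX" "V \<subseteq> U" "eqon V t s" "nbhd t U \<subseteq> D n"
      by (rule denseE[OF D sV])
    \<comment> \<open>Enlarging \<open>U\<close> to \<open>U'\<close> only shrinks the neighbourhood
      of \<open>t\<close>, which therefore stays inside \<open>D n\<close>.\<close>
    obtain U' where U': "U' \<in> XX" "U \<subseteq> U'" "w n \<subseteq> U'" "w n \<subseteq> t ` U'"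
      using enlarge[of "{t}" U "w n"] t w by auto
    have "P n (t, U')" unfolding P_def using t U' sV by (auto simp: nbhd_def subset_iff)
    moreover have "R (s, V) (t, U')" unfolding R_def using t U' by auto
    ultimately show ?thesis by blast
  qed
  have "\<exists>f. \<forall>n. P n (f n) \<and> R (f n) (f (Suc n))"
  proof (rule dependent_nat_choice)
    have "\<exists>y. P 0 y \<and> R (id, X) y" by (rule step[OF id_S X]) auto
    then show "\<exists>x. P 0 x" by blast
    show "\<exists>y. P (Suc n) y \<and> R x y" if "P n x" for x n
    proof -
      have "\<exists>y. P (Suc n) y \<and> R (fst x, snd x) y"
        by (rule step) (use that in \<open>simp_all add: P_def\<close>)
      then show ?thesis by simp
    qed
  qed
  then obtain f where f: "\<And>n. P n (f n)" "\<And>n. R (f n) (f (Suc n))" by blast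
  have "\<exists>g\<in>GS. \<forall>n. eqon (snd (f n)) g (fst (f n))"
    using f w(2) by (intro limit_GS[where w=w]) (auto simp: P_def R_def S_GS)
  then obtain g where g: "g \<in> GS" "\<And>n. eqon (snd (f n)) g (fst (f n))" by blast
  have "g \<in> D n" for n using f(1)[of n] g unfolding P_def nbhd_def by blast
  moreover have "eqon X g id" using f(1)[of 0] g(2)[of 0] unfolding P_def by (metis subsetD)
  ultimately show ?thesis using g(1) by blast
qed

text \<open>Only the second of the two approximations has to be moved, by a right factor.\<close>

lemma mycielski_step:
  assumes D: "\<And>i::nat. dense X (D i)"
    and T: "finite T" "\<And>i j k. (i, j, k) \<in> T \<Longrightarrow> i \<noteq> j"
    and c: "\<And>i::'i. c i \<in> S" "\<And>i. eqon X (c i) id"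
    and V: "V \<in> XX" "X \<subseteq> V"
  shows "\<exists>c' V'. V' \<in> XX \<and> V \<subseteq> V' \<and> (\<forall>i. c' i \<in> S \<and> eqon V (c' i) (c i)) \<and>
    (\<forall>(i, j, k)\<in>T. \<forall>x\<in>nbhd (c' i) V'. \<forall>y\<in>nbhd (c' j) V'. inv x \<circ> y \<in> D k)"
  using T
proof (induction rule: finite_induct)
  case empty
  show ?case using c V by (intro exI[of _ c] exI[of _ V]) auto
next
  case (insert p T)
  obtain i j k where p: "p = (i, j, k)" by (cases p)
  have ij: "i \<noteq> j" using insert.prems p by blast
  obtain c1 V1 where 1: "V1 \<in> XX" "V \<subseteq> V1" "\<And>i. c1 i \<in> S" "\<And>i. eqon V (c1 i) (c i)"
     "\<And>i j k x y. (i, j, k) \<in> T \<Longrightarrow> x \<in> nbhd (c1 i) V1 \<Longrightarrow> y \<in> nbhd (c1 j) V1 \<Longrightarrow> inv x \<circ> y \<in> D k"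
  proof -
    have "i \<noteq> j" if "(i, j, k) \<in> T" for i j k using insert.prems that by blast
    then have "\<exists>c' V'. V' \<in> XX \<and> V \<subseteq> V' \<and> (\<forall>i. c' i \<in> S \<and> eqon V (c' i) (c i)) \<and>
      (\<forall>(i, j, k)\<in>T. \<forall>x\<in>nbhd (c' i) V'. \<forall>y\<in>nbhd (c' j) V'. inv x \<circ> y \<in> D k)"
      by (rule insert.IH)
    then obtain c1 V1 where "V1 \<in> XX" "V \<subseteq> V1" "\<forall>i. c1 i \<in> S \<and> eqon V (c1 i) (c i)"
      "\<forall>(i, j, k)\<in>T. \<forall>x\<in>nbhd (c1 i) V1. \<forall>y\<in>nbhd (c1 j) V1. inv x \<circ> y \<in> D k"
      by (elim exE conjE)
    then show ?thesis by (intro that[of V1 c1]) fast+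
  qed
  have c1X: "c1 l x = x" if "x \<in> X" for l x
    using 1(4)[of l] c(2)[of l] V(2) that by auto
  have s: "inv (c1 i) \<circ> c1 j \<in> S" by (simp add: 1(3) comp_S inv_S)
  have sX: "eqon X (inv (c1 i) \<circ> c1 j) id"
  proof
    fix x assume x: "x \<in> X"
    show "(inv (c1 i) \<circ> c1 j) x = id x"
      using c1X[OF x] G_simps(1)[OF S_G'[OF 1(3)[of i]], of x] by simp
  qed
  obtain t U where t: "t \<in> S" "U \<in> XX" "V1 \<subseteq> U" "eqon V1 t (inv (c1 i) \<circ> c1 j)" "nbhd t U \<subseteq> D k"
    by (rule denseE[OF D s 1(1) _ sX, of k]) (use 1(2) V(2) in auto)
  \<comment> \<open>\<open>V2\<close> also contains the image of \<open>U\<close> under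
    \<open>t\<close>, because the computation of \<open>inv x (y u)\<close> below uses the value of
    \<open>x\<close> at \<open>t u\<close>.\<close>
  obtain V2 where V2: "V2 \<in> XX" "U \<union> t ` U \<subseteq> V2"
    using directed_XX[OF t(2) image_S[OF t(1,2)]] by blast
  define c2 where "c2 = c1(j := c1 i \<circ> t)"
  have c2: "c2 l \<in> S" "eqon V1 (c2 l) (c1 l)" for l
    using 1(3) t(1,4) by (auto simp: c2_def comp_S)
  have sub: "x \<in> nbhd (c1 l) V1" if "x \<in> nbhd (c2 l) V2" for x l
    using that c2(2)[of l] V2 t(3) unfolding nbhd_def by (simp add: subset_iff)
  have new: "inv x \<circ> y \<in> D k" if x: "x \<in> nbhd (c2 i) V2" and y: "y \<in> nbhd (c2 j) V2" for x y
  proof -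
    have xg: "x \<in> GS" and yg: "y \<in> GS" using x y by (auto simp: nbhd_def)
    have "(inv x \<circ> y) u = t u" if u: "u \<in> U" for u
    proof -
      have "y u = c1 i (t u)" using y u V2(2) by (auto simp: nbhd_def c2_def)
      also have "\<dots> = x (t u)" using x u V2(2) ij by (auto simp: nbhd_def c2_def)
      finally show ?thesis using xg by simp
    qed
    then have "inv x \<circ> y \<in> nbhd t U"
      using comp_GS[OF inv_GS[OF xg] yg] by (simp add: nbhd_def)
    then show ?thesis using t(5) by blast
  qed
  have "inv x \<circ> y \<in> D k'" if "(i', j', k') \<in> insert p T" "x \<in> nbhd (c2 i') V2" "y \<in> nbhd (c2 j') V2"
    for i' j' k' x y
    using that new sub 1(5) p by blast
  then have "\<forall>(i, j, k)\<in>insert p T. \<forall>x\<in>nbhd (c2 i) V2. \<forall>y\<in>nbhd (c2 j) V2. inv x \<circ> y \<in> D k"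
    by blast
  moreover have "V \<subseteq> V2" using 1(2) t(3) V2(2) by blast
  moreover have "eqon V (c2 l) (c l)" for l using c2(2)[of l] 1(2,4) by (simp add: subset_iff)
  ultimately show ?case using V2(1) c2(1)
    by (intro exI[of _ c2] exI[of _ V2] conjI allI)
qed

text \<open>A binary tree of approximations: branch \<open>r\<close> is represented at stage
  \<open>n\<close> by the entry whose index is the part of \<open>r\<close> below \<open>n\<close>,
  so each stage has to separate only finitely many pairs.\<close>

lemma mycielski:
  assumes D: "\<And>i::nat. dense X (D i)" and X: "X \<in> XX"
  shows "\<exists>y :: nat set \<Rightarrow> 'a \<Rightarrow> 'a. (\<forall>r. y r \<in> GS \<and> eqon X (y r) id) \<and>
    (\<forall>a b. a \<noteq> b \<longrightarrow> (\<forall>i. inv (y a) \<circ> y b \<in> D i))"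
proof -
  obtain w :: "nat \<Rightarrow> 'a set" where w: "\<And>n. w n \<in> XX" "\<And>X. X \<in> XX \<Longrightarrow> \<exists>n. \<forall>k\<ge>n. X \<subseteq> w k"
    using exhaustion by blast
  define Q where "Q n x \<longleftrightarrow> (\<forall>a\<subseteq>{..<n}. \<forall>b\<subseteq>{..<n}. \<forall>i\<le>n. a \<noteq> b \<longrightarrow>
       (\<forall>x'\<in>nbhd (fst x a) (snd x). \<forall>y\<in>nbhd (fst x b) (snd x). inv x' \<circ> y \<in> D i))"
    for n and x :: "(nat set \<Rightarrow> 'a \<Rightarrow> 'a) \<times> 'a set"
  define P where "P n x \<longleftrightarrow> (\<forall>r. fst x r \<in> S \<and> eqon X (fst x r) id) \<and> snd x \<in> XX \<and> X \<subseteq> snd x \<and>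
     w n \<subseteq> snd x \<and> (\<forall>r\<subseteq>{..<n}. w n \<subseteq> fst x r ` snd x) \<and> Q n x"
    for n and x :: "(nat set \<Rightarrow> 'a \<Rightarrow> 'a) \<times> 'a set"
  \<comment> \<open>At the next stage an index \<open>r\<close> starts from the map belonging to its
    part below \<open>n\<close>. Indices that differ only at \<open>n\<close> start from the same
    map and are separated there.\<close>
  define R where "R n x y \<longleftrightarrow> snd x \<subseteq> snd y \<and> (\<forall>r. eqon (snd x) (fst y r) (fst x (r \<inter> {..<n})))"
    for n and x y :: "(nat set \<Rightarrow> 'a \<Rightarrow> 'a) \<times> 'a set"
  have step: "\<exists>y. P n y \<and> V \<subseteq> snd y \<and> (\<forall>r. eqon V (fst y r) (c r))"
    if c: "\<And>r. c r \<in> S" "\<And>r. eqon X (c r) id" and V: "V \<in> XX" "X \<subseteq> V" for c :: "nat set \<Rightarrow> 'a \<Rightarrow> 'a" and V n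
  proof -
    let ?T = "{(a, b, i). a \<subseteq> {..<n} \<and> b \<subseteq> {..<n} \<and> i \<le> n \<and> a \<noteq> b}"
    have "?T \<subseteq> Pow {..<n} \<times> Pow {..<n} \<times> {..n}" by auto
    then have T: "finite ?T" by (rule finite_subset) auto
    obtain c' V' where c': "V' \<in> XX" "V \<subseteq> V'" "\<And>i. c' i \<in> S" "\<And>i. eqon V (c' i) (c i)"
      "\<forall>(i, j, k)\<in>?T. \<forall>x\<in>nbhd (c' i) V'. \<forall>y\<in>nbhd (c' j) V'. inv x \<circ> y \<in> D k"
    proof -
      have "\<exists>c' V'. V' \<in> XX \<and> V \<subseteq> V' \<and> (\<forall>i. c' i \<in> S \<and> eqon V (c' i) (c i)) \<and>
        (\<forall>(i, j, k)\<in>?T. \<forall>x\<in>nbhd (c' i) V'. \<forall>y\<in>nbhd (c' j) V'. inv x \<circ> y \<in> D k)"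
        by (rule mycielski_step[where c=c and D=D, OF D T _ c V]) auto
      then show ?thesis by (elim exE conjE) (rule that, simp_all)
    qed
    obtain U where U: "U \<in> XX" "V' \<subseteq> U" "w n \<subseteq> U" "\<And>r. r \<subseteq> {..<n} \<Longrightarrow> w n \<subseteq> c' r ` U"
    proof -
      have "c' ` Pow {..<n} \<subseteq> G" using c'(3) by auto
      then show ?thesis using enlarge[of "c' ` Pow {..<n}" V' "w n"] c'(1) w(1) that by auto
    qed
    have sub: "nbhd (c' a) U \<subseteq> nbhd (c' a) V'" for a using U(2) by (auto simp: nbhd_def)
    have "P n (c', U)" unfolding P_def Q_def
    proof (intro conjI allI impI ballI)
      show "fst (c', U) r \<in> S" for r using c' by simp
      show "fst (c', U) r x = id x" if "x \<in> X" for r x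
        using c'(4)[of r] c(2)[of r] V(2) that by auto
      show "inv x' \<circ> y \<in> D i" if "a \<subseteq> {..<n}" "b \<subseteq> {..<n}" "i \<le> n" "a \<noteq> b"
         "x' \<in> nbhd (fst (c', U) a) (snd (c', U))" "y \<in> nbhd (fst (c', U) b) (snd (c', U))" for a b i x' y
      proof -
        have "(a, b, i) \<in> ?T" using that by simp
        from bspec[OF c'(5) this]
        have "\<forall>x\<in>nbhd (c' a) V'. \<forall>y\<in>nbhd (c' b) V'. inv x \<circ> y \<in> D i" by simp
        then show ?thesis using subsetD[OF sub, of x' a] subsetD[OF sub, of y b] that(5,6) by simp
      qed
    qed (use U V c'(1,2) in auto)
    then show ?thesis using c'(2,4) U(2) by (intro exI[of _ "(c', U)"]) auto
  qed
  have "\<exists>f. \<forall>n. P n (f n) \<and> R n (f n) (f (Suc n))"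
  proof (rule dependent_nat_choice)
    have "\<exists>y. P 0 y \<and> X \<subseteq> snd y \<and> (\<forall>r. eqon X (fst y r) ((\<lambda>_. id) r))"
      by (rule step[of "\<lambda>_. id"]) (simp_all only: id_S X order_refl ball_triv simp_thms)
    then show "\<exists>x. P 0 x" by blast
    show "\<exists>y. P (Suc n) y \<and> R n x y" if "P n x" for x n
      unfolding R_def by (rule step) (use that in \<open>simp_all add: P_def\<close>)
  qed
  then obtain f where f: "\<And>n. P n (f n)" "\<And>n. R n (f n) (f (Suc n))" by blast
  define c where "c r n = fst (f n) (r \<inter> {..<n})" for r n
  have "\<exists>g\<in>GS. \<forall>n. eqon (snd (f n)) g (c r n)" for r
  proof (rule limit_GS[where w=w])
    show "c r n \<in> GS" for n using f(1)[of n] by (auto simp: P_def c_def S_GS)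
    show "snd (f n) \<subseteq> snd (f (Suc n))" for n using f(2)[of n] by (simp add: R_def)
    show "eqon (snd (f n)) (c r (Suc n)) (c r n)" for n
    proof -
      have "r \<inter> {..<Suc n} \<inter> {..<n} = r \<inter> {..<n}" by auto
      then show ?thesis using f(2)[of n] unfolding R_def c_def by metis
    qed
    show "\<exists>n. \<forall>k\<ge>n. X \<subseteq> w k" if "X \<in> XX" for X using w(2) that by blast
    show "w n \<subseteq> snd (f n)" for n using f(1)[of n] by (simp add: P_def)
    show "w n \<subseteq> c r n ` snd (f n)" for n using f(1)[of n] by (simp add: P_def c_def)
  qed
  then obtain y where y: "\<And>r. y r \<in> GS" "\<And>r n. eqon (snd (f n)) (y r) (c r n)" by metis
  have "inv (y a) \<circ> y b \<in> D i" if ab: "a \<noteq> b" for a b i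
  proof -
    obtain j where j: "j \<in> a \<longleftrightarrow> j \<notin> b" using ab by blast
    \<comment> \<open>The bound \<open>Suc j\<close> makes the two truncations differ, and the bound
      \<open>i\<close> makes stage \<open>n\<close> take \<open>D i\<close> into account.\<close>
    define n where "n = max i (Suc j)"
    have ne: "a \<inter> {..<n} \<noteq> b \<inter> {..<n}" and "i \<le> n" using j unfolding n_def
      by (auto simp: set_eq_iff less_max_iff_disj)
    have nb: "y r \<in> nbhd (fst (f n) (r \<inter> {..<n})) (snd (f n))" for r
      using y(1)[of r] y(2)[of n r] by (simp add: nbhd_def c_def)
    have "Q n (f n)" using f(1)[of n] by (simp add: P_def)
    from this[unfolded Q_def, rule_format, OF Int_lower2 Int_lower2 \<open>i \<le> n\<close> ne nb nb]
    show ?thesis .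
  qed
  moreover have "eqon X (y r) id" for r
    using f(1)[of 0] y(2)[of 0 r] unfolding P_def c_def by (simp add: subset_iff)
  ultimately show ?thesis using y(1) by (intro exI[of _ y]) simp
qed

end

section \<open>Generic tuples\<close>

context dense_family
begin

text \<open>The maps \<open>gs\<close> on \<open>Y\<close> enlarge the system formed by
  \<open>fs\<close> on its invariant set \<open>Z\<close>. The enlargement consists of elements of
  \<open>S\<close>, so that only countably many such problems arise.\<close>

definition extension :: "('a \<Rightarrow> 'a) list \<Rightarrow> ('a \<Rightarrow> 'a) list \<Rightarrow> 'a set \<Rightarrow> 'a set \<Rightarrow> bool" where
  "extension fs gs Z Y \<longleftrightarrow> Z \<subseteq> Y \<and> length gs = length fs \<and> set gs \<subseteq> S \<and>
     preserves fs Z \<and> preserves gs Y \<and> (\<forall>i<length fs. eqon Z (gs ! i) (fs ! i))"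

definition realises :: "('a \<Rightarrow> 'a) list \<Rightarrow> ('a \<Rightarrow> 'a) list \<Rightarrow> ('a \<Rightarrow> 'a) \<Rightarrow> 'a set \<Rightarrow> 'a set \<Rightarrow> bool" where
  "realises fs gs s Z Y \<longleftrightarrow> eqon Z s id \<and> (\<forall>i<length fs. eqon Y (fs ! i \<circ> s) (s \<circ> gs ! i))"

text \<open>The extension property of a Fraisse limit, for members of \<open>XX\<close> that carry a
  tuple of maps: invariant members are cofinal, and every extension of an invariant part has a copy
  over that part inside the tuple itself.\<close>

definition generic :: "('a \<Rightarrow> 'a) list \<Rightarrow> bool" where
  "generic fs \<longleftrightarrow> set fs \<subseteq> GS \<and> (\<forall>W\<in>XX. \<exists>Z\<in>XX. W \<subseteq> Z \<and> preserves fs Z) \<and>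
     (\<forall>Z\<in>XX. \<forall>Y\<in>XX. \<forall>gs. extension fs gs Z Y \<longrightarrow> (\<exists>s\<in>S. realises fs gs s Z Y))"

definition intertwines :: "('a \<Rightarrow> 'a) list \<Rightarrow> ('a \<Rightarrow> 'a) list \<Rightarrow> ('a \<Rightarrow> 'a) \<Rightarrow> 'a set \<Rightarrow> bool" where
  "intertwines fs fs' s Z \<longleftrightarrow> s \<in> S \<and> Z \<in> XX \<and> preserves fs Z \<and>
     (\<forall>i<length fs. eqon Z (fs' ! i \<circ> s) (s \<circ> fs ! i))"

lemma preserves_nth: "preserves fs Z \<longleftrightarrow> (\<forall>i<length fs. (fs ! i) ` Z = Z)"
  by (simp add: preserves_def all_set_conv_all_nth)

lemma generic_GS: "generic fs \<Longrightarrow> i < length fs \<Longrightarrow> fs ! i \<in> GS"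
  by (auto simp: generic_def)

lemma conj_image:
  assumes "s \<in> G" "g ` Z = Z"
  shows "(s \<circ> g \<circ> inv s) ` s ` Z = s ` Z"
  using assms(2) inv_image_eq(1)[OF assms(1), of Z] by (metis image_comp)

lemma generic_Nil: "generic []"
proof -
  have "realises [] gs id Z Y" for gs Z Y by (simp add: realises_def)
  then show ?thesis unfolding generic_def using id_S by (auto simp: preserves_def)
qed

lemma generic_preserved:
  assumes "generic fs" "V \<in> XX" "W \<in> XX"
  obtains Z where "Z \<in> XX" "V \<subseteq> Z" "W \<subseteq> Z" "preserves fs Z"
proof -
  obtain U where "U \<in> XX" "V \<union> W \<subseteq> U" using directed_XX assms(2,3) by blast
  moreover then obtain Z where "Z \<in> XX" "U \<subseteq> Z" "preserves fs Z"
    using assms(1) unfolding generic_def by blast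
  ultimately show ?thesis by (intro that[of Z]) auto
qed

lemma generic_realise:
  assumes "generic fs" "Z \<in> XX" "Y \<in> XX" "extension fs gs Z Y"
  obtains s where "s \<in> S" "realises fs gs s Z Y"
  using assms unfolding generic_def by blast

lemma generic_approx:
  assumes "generic fs" "Z \<in> XX"
  obtains gs where "length gs = length fs" "set gs \<subseteq> S" "\<And>i. i < length fs \<Longrightarrow> eqon Z (gs ! i) (fs ! i)"
proof -
  have "\<forall>i<length fs. \<exists>g. g \<in> S \<and> eqon Z g (fs ! i)"
  proof (intro allI impI)
    fix i assume "i < length fs"
    then obtain g where "g \<in> S" "eqon Z (fs ! i) g"
      using GS_approx[OF generic_GS[OF assms(1)] assms(2)] by blast
    then show "\<exists>g. g \<in> S \<and> eqon Z g (fs ! i)" by (intro exI[of _ g]) simp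
  qed
  then obtain gs where "length gs = length fs" "\<forall>i<length fs. gs ! i \<in> S \<and> eqon Z (gs ! i) (fs ! i)"
    unfolding Skolem_list_nth by blast
  then show ?thesis by (intro that[of gs]) (auto simp: set_conv_nth)
qed

lemma intertwines_inv:
  assumes s: "intertwines fs fs' s Z" and len: "length fs' = length fs"
  shows "intertwines fs' fs (inv s) (s ` Z)"
proof -
  have sS: "s \<in> S" and Z: "Z \<in> XX" using s by (auto simp: intertwines_def)
  have eq: "(fs' ! i) (s z) = s ((fs ! i) z)" if "i < length fs" "z \<in> Z" for i z
    using s that by (simp add: intertwines_def)
  have "fs' ! i ` s ` Z = s ` Z" if "i < length fs" for i
  proof -
    have "fs' ! i ` s ` Z = s ` (fs ! i) ` Z"
      using eq[OF that] by (force simp: image_iff)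
    then show ?thesis using s that by (simp add: intertwines_def preserves_nth)
  qed
  then show ?thesis
    using eq sS Z len by (simp add: intertwines_def inv_S image_S preserves_nth)
qed

text \<open>The action of \<open>fs\<close> on \<open>Z'\<close>, carried over by \<open>s\<close>,
  is an extension problem for \<open>fs'\<close> over the image of \<open>Z\<close>. A solution
  \<open>t\<close> gives the longer partial conjugacy \<open>t \<circ> s\<close>.\<close>

lemma intertwines_forth:
  assumes fs: "generic fs" "generic fs'" "length fs' = length fs"
    and s: "intertwines fs fs' s Z" and W: "W \<in> XX"
  obtains s' Z' where "intertwines fs fs' s' Z'" "Z \<subseteq> Z'" "W \<subseteq> Z'" "eqon Z s' s"
proof -
  have sS: "s \<in> S" and Z: "Z \<in> XX" using s by (auto simp: intertwines_def)
  obtain Z' where Z': "Z' \<in> XX" "Z \<subseteq> Z'" "W \<subseteq> Z'" "preserves fs Z'"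
    using fs(1) Z W by (rule generic_preserved)
  obtain gs where gs: "length gs = length fs" "set gs \<subseteq> S"
    "\<And>i. i < length fs \<Longrightarrow> eqon Z' (gs ! i) (fs ! i)"
    using fs(1) Z'(1) by (rule generic_approx) auto
  \<comment> \<open>An extension problem consists of elements of \<open>S\<close>, so the maps
    \<open>fs ! i\<close> are replaced by approximations on \<open>Z'\<close> before being
    conjugated.\<close>
  let ?hs = "map (\<lambda>g. s \<circ> g \<circ> inv s) gs"
  have gsZ': "gs ! i ` Z' = Z'" if "i < length fs" for i
    using image_eqon[OF gs(3)[OF that]] Z'(4) that by (simp add: preserves_nth)
  have "extension fs' ?hs (s ` Z) (s ` Z')"
    unfolding extension_def
  proof (intro conjI allI impI)
    show "s ` Z \<subseteq> s ` Z'" using Z'(2) by blast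
    show "length ?hs = length fs'" using gs(1) fs(3) by simp
    show "set ?hs \<subseteq> S" using gs(2) sS by (auto intro!: comp_S inv_S)
    show "preserves fs' (s ` Z)" using intertwines_inv[OF s fs(3)] by (simp add: intertwines_def)
    show "preserves ?hs (s ` Z')"
      unfolding preserves_nth
    proof (intro allI impI)
      fix i assume "i < length ?hs"
      then show "?hs ! i ` s ` Z' = s ` Z'" using conj_image[OF S_G'[OF sS] gsZ'] gs(1) by simp
    qed
    show "eqon (s ` Z) (?hs ! i) (fs' ! i)" if i: "i < length fs'" for i
    proof
      fix x assume "x \<in> s ` Z"
      then obtain z where z: "z \<in> Z" "x = s z" by blast
      have "(?hs ! i) x = s ((gs ! i) z)" using i gs(1) fs(3) z sS by simp
      also have "\<dots> = s ((fs ! i) z)" using gs(3)[of i] i fs(3) z Z'(2) by auto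
      also have "\<dots> = (fs' ! i) x" using s i fs(3) z by (simp add: intertwines_def)
      finally show "(?hs ! i) x = (fs' ! i) x" .
    qed
  qed
  then obtain t where t: "t \<in> S" "realises fs' ?hs t (s ` Z) (s ` Z')"
    by (rule generic_realise[OF fs(2) image_S[OF sS Z] image_S[OF sS Z'(1)]])
  have "intertwines fs fs' (t \<circ> s) Z'"
    unfolding intertwines_def
  proof (intro conjI allI impI ballI)
    show "t \<circ> s \<in> S" using t sS comp_S by blast
    fix i z assume i: "i < length fs" and z: "z \<in> Z'"
    have "(fs' ! i \<circ> t) (s z) = (t \<circ> ?hs ! i) (s z)"
      using t(2) i fs(3) z by (simp add: realises_def)
    also have "\<dots> = t (s ((gs ! i) z))" using i gs(1) sS by simp
    also have "\<dots> = t (s ((fs ! i) z))" using gs(3)[OF i] z by simp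
    finally show "(fs' ! i \<circ> (t \<circ> s)) z = ((t \<circ> s) \<circ> fs ! i) z" by simp
  qed (use Z' in auto)
  moreover have "eqon Z (t \<circ> s) s" using t(2) by (simp add: realises_def)
  ultimately show ?thesis using Z'(2,3) by (intro that)
qed

text \<open>Back and forth starting from the identity on \<open>X\<close>; genericity of
  \<open>fs'\<close> drives the forward steps and genericity of \<open>fs\<close> the backward
  ones.\<close>

lemma generic_conjugate:
  assumes fs: "generic fs" "generic fs'" "length fs' = length fs"
    and X: "X \<in> XX" "preserves fs X" "\<And>i. i < length fs \<Longrightarrow> eqon X (fs ! i) (fs' ! i)"
  shows "\<exists>k\<in>GS. eqon X k id \<and> (\<forall>i<length fs. k \<circ> fs ! i = fs' ! i \<circ> k)"
proof -
  obtain w :: "nat \<Rightarrow> 'a set" where w: "\<And>n. w n \<in> XX" "\<And>X. X \<in> XX \<Longrightarrow> \<exists>n. \<forall>k\<ge>n. X \<subseteq> w k"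
    using exhaustion by blast
  define P where "P n x \<longleftrightarrow> intertwines fs fs' (fst x) (snd x) \<and> w n \<subseteq> snd x \<and>
    w n \<subseteq> fst x ` snd x \<and> X \<subseteq> snd x \<and> eqon X (fst x) id" for n and x :: "('a \<Rightarrow> 'a) \<times> 'a set"
  define R where "R x y \<longleftrightarrow> snd x \<subseteq> snd y \<and> eqon (snd x) (fst y) (fst x)"
    for x y :: "('a \<Rightarrow> 'a) \<times> 'a set"
  have step: "\<exists>y. P n y \<and> R (s, Z) y"
    if s: "intertwines fs fs' s Z" and XZ: "X \<subseteq> Z" "eqon X s id" for s Z n
  proof -
    obtain s1 Z1 where 1: "intertwines fs fs' s1 Z1" "Z \<subseteq> Z1" "w n \<subseteq> Z1" "eqon Z s1 s"
      using fs s w(1) by (rule intertwines_forth)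
    \<comment> \<open>The backward half is a forward step for the inverse partial conjugacy; its
      result is inverted again below.\<close>
    obtain t Y where t: "intertwines fs' fs t Y" "s1 ` Z1 \<subseteq> Y" "w n \<subseteq> Y" "eqon (s1 ` Z1) t (inv s1)"
      using fs(2,1) fs(3)[symmetric] intertwines_inv[OF 1(1) fs(3)] w(1) by (rule intertwines_forth)
    have s1S: "s1 \<in> S" and tS: "t \<in> S" using 1(1) t(1) by (auto simp: intertwines_def)
    have inv_t: "inv t z = s1 z" and z_tY: "z \<in> t ` Y" if "z \<in> Z1" for z
    proof -
      have "t (s1 z) = z" using t(4) that s1S by simp
      then show "inv t z = s1 z" using G_simps(1)[OF S_G'[OF tS], of "s1 z"] by simp
      have "s1 z \<in> Y" using t(2) that by blast
      then show "z \<in> t ` Y" using \<open>t (s1 z) = z\<close> by (metis imageI)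
    qed
    have "intertwines fs fs' (inv t) (t ` Y)" using intertwines_inv[OF t(1) fs(3)[symmetric]] .
    then have "P n (inv t, t ` Y)"
      using z_tY 1(2,3) t(3) tS XZ inv_t 1(4) by (auto simp: P_def subset_iff)
    moreover have "R (s, Z) (inv t, t ` Y)" using z_tY inv_t 1(2,4) by (auto simp: R_def)
    ultimately show ?thesis by blast
  qed
  have "\<exists>f. \<forall>n. P n (f n) \<and> R (f n) (f (Suc n))"
  proof (rule dependent_nat_choice)
    have "intertwines fs fs' id X" using X id_S by (simp add: intertwines_def)
    then have "\<exists>y. P 0 y \<and> R (id, X) y" by (rule step) auto
    then show "\<exists>x. P 0 x" by blast
    show "\<exists>y. P (Suc n) y \<and> R x y" if "P n x" for x n
    proof -
      have "\<exists>y. P (Suc n) y \<and> R (fst x, snd x) y"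
        by (rule step) (use that in \<open>simp_all add: P_def\<close>)
      then show ?thesis by simp
    qed
  qed
  then obtain f where f: "\<And>n. P n (f n)" "\<And>n. R (f n) (f (Suc n))" by blast
  have "\<exists>g\<in>GS. \<forall>n. eqon (snd (f n)) g (fst (f n))"
    using f w(2) by (intro limit_GS[where w=w]) (auto simp: P_def R_def intertwines_def S_GS)
  then obtain k where k: "k \<in> GS" "\<And>n. eqon (snd (f n)) k (fst (f n))" by blast
  have "k ((fs ! i) x) = (fs' ! i) (k x)" if i: "i < length fs" for i x
  proof -
    obtain X' where X': "X' \<in> XX" "x \<in> X'" using cover_XX by blast
    obtain n where "X' \<subseteq> w n" using w(2)[OF X'(1)] by blast
    then have n: "x \<in> snd (f n)" using X'(2) f(1)[of n] by (auto simp: P_def)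
    have "(fs ! i) x \<in> snd (f n)"
      using f(1)[of n] n i by (auto simp: P_def intertwines_def preserves_nth)
    then show ?thesis using k(2)[of n] n f(1)[of n] i by (simp add: P_def intertwines_def)
  qed
  moreover have "eqon X k id" using f(1)[of 0] k(2)[of 0] by (auto simp: P_def)
  ultimately show ?thesis using k(1) by (intro bexI[of _ k]) (auto simp: fun_eq_iff)
qed

section \<open>Generic extension of a tuple as a comeagre condition\<close>

definition has_invariant :: "('a \<Rightarrow> 'a) list \<Rightarrow> 'a set \<Rightarrow> ('a \<Rightarrow> 'a) set" where
  "has_invariant fs W = {g. \<exists>Z\<in>XX. W \<subseteq> Z \<and> preserves fs Z \<and> g ` Z = Z}"

text \<open>The requirements on \<open>g\<close> stand as premises, so an unsuitable
  \<open>g\<close> belongs to the set trivially; this is what makes the set dense in every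
  stabiliser.\<close>

definition has_realisation :: "('a \<Rightarrow> 'a) list \<Rightarrow> 'a set \<Rightarrow> 'a set \<Rightarrow> ('a \<Rightarrow> 'a) list \<Rightarrow> ('a \<Rightarrow> 'a) \<Rightarrow> ('a \<Rightarrow> 'a) set" where
  "has_realisation fs Z Y gs h = {g. extension fs gs Z Y \<longrightarrow> g ` Z = Z \<longrightarrow> h ` Y = Y \<longrightarrow> eqon Z h g \<longrightarrow>
     (\<exists>s\<in>S. realises fs gs s Z Y \<and> eqon Y (g \<circ> s) (s \<circ> h))}"

text \<open>The extension property of \<open>S\<close> enters here: once \<open>Z\<close> is
  invariant under \<open>fs\<close> and contains \<open>V\<close> together with its image under
  \<open>s\<close>, the map \<open>s\<close> can be changed outside \<open>V\<close> so as to
  preserve \<open>Z\<close>.\<close>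

lemma extend_preserved:
  assumes "generic fs" "s \<in> S" "V \<in> XX" "W \<in> XX"
  obtains f Z where "f \<in> S" "Z \<in> XX" "V \<subseteq> Z" "W \<subseteq> Z" "preserves fs Z" "f ` Z = Z" "eqon V f s"
proof -
  obtain U where U: "U \<in> XX" "V \<union> s ` V \<subseteq> U"
    using directed_XX[OF assms(3) image_S[OF assms(2,3)]] by blast
  obtain Z where Z: "Z \<in> XX" "U \<subseteq> Z" "W \<subseteq> Z" "preserves fs Z"
    using assms(1) U(1) assms(4) by (rule generic_preserved)
  have "\<exists>f\<in>S. eqon V f s \<and> f ` Z = Z"
    by (rule extend_S) (use assms U Z in auto)
  then show ?thesis using U Z by (elim bexE) (rule that, auto)
qed

lemma dense_has_invariant:
  assumes "generic fs" "W \<in> XX"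
  shows "dense X (has_invariant fs W)"
  unfolding dense_def
proof (intro ballI impI)
  fix s V assume "s \<in> S" "V \<in> XX"
  then obtain f Z where f: "f \<in> S" "Z \<in> XX" "V \<subseteq> Z" "W \<subseteq> Z" "preserves fs Z" "f ` Z = Z" "eqon V f s"
    by (rule extend_preserved[OF assms(1) _ _ assms(2)])
  have "nbhd f Z \<subseteq> has_invariant fs W"
  proof
    fix g assume "g \<in> nbhd f Z"
    then have "g ` Z = Z" using f(6) image_eqon[of Z g f] by (simp add: nbhd_def)
    then show "g \<in> has_invariant fs W" using f(2,4,5) by (auto simp: has_invariant_def)
  qed
  then show "\<exists>t\<in>S. \<exists>U\<in>XX. V \<subseteq> U \<and> eqon V t s \<and> nbhd t U \<subseteq> has_invariant fs W"
    using f by (intro bexI[of _ f] bexI[of _ Z] conjI)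
qed

text \<open>Let \<open>f\<close> preserve a large set \<open>W\<close> that is invariant under
  \<open>fs\<close>. The systems \<open>fs\<close>, \<open>f\<close> on \<open>W\<close> and
  \<open>gs\<close>, \<open>h\<close> on \<open>Y\<close> are amalgamated over \<open>Z\<close>.
  Genericity of \<open>fs\<close> realises the amalgamated tuple \<open>es\<close> over
  \<open>W\<close> by some \<open>q\<close>, and the amalgam \<open>e\<close> of \<open>h\<close>
  and \<open>f\<close>, conjugated by \<open>q\<close>, is the wanted approximation.\<close>

lemma dense_has_realisation:
  assumes fs: "generic fs" and Z: "Z \<in> XX" and Y: "Y \<in> XX" and h: "h \<in> S"
  shows "dense X (has_realisation fs Z Y gs h)"
  unfolding dense_def
proof (intro ballI impI)
  fix s V assume s: "s \<in> S" and V: "V \<in> XX"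
  obtain f W where f: "f \<in> S" "W \<in> XX" "V \<subseteq> W" "Z \<subseteq> W" "preserves fs W" "f ` W = W" "eqon V f s"
    using fs s V Z by (rule extend_preserved)
  show "\<exists>t\<in>S. \<exists>U\<in>XX. V \<subseteq> U \<and> eqon V t s \<and> nbhd t U \<subseteq> has_realisation fs Z Y gs h"
  proof (cases "extension fs gs Z Y \<and> f ` Z = Z \<and> h ` Y = Y \<and> eqon Z h f")
    \<comment> \<open>The failing premise depends on \<open>g\<close> only through its values on
      \<open>Z\<close>, hence fails on the whole neighbourhood.\<close>
    case False
    have "nbhd f W \<subseteq> has_realisation fs Z Y gs h"
    proof
      fix g assume g: "g \<in> nbhd f W"
      have gf: "eqon Z g f" using g f(4) by (auto simp: nbhd_def)
      then have "g ` Z = f ` Z" by (rule image_eqon)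
      then show "g \<in> has_realisation fs Z Y gs h" using False gf by (auto simp: has_realisation_def)
    qed
    then show ?thesis using f by (intro bexI[of _ f] bexI[of _ W] conjI)
  next
    case True
    then have ZY: "Z \<subseteq> Y" and len: "length gs = length fs" and gsS: "set gs \<subseteq> S"
      and fsZ: "preserves fs Z" and gsY: "preserves gs Y"
      and gf: "\<And>i. i < length fs \<Longrightarrow> eqon Z (gs ! i) (fs ! i)"
      and fZ: "f ` Z = Z" and hY: "h ` Y = Y" and hf: "eqon Z h f"
      by (auto simp: extension_def)
    obtain p U where p: "p \<in> S" "U \<in> XX" "eqon Z p id" "p ` Y \<subseteq> U" "W \<subseteq> U"
      and glue: "\<And>f1 f2. f1 \<in> S \<Longrightarrow> f2 \<in> S \<Longrightarrow> eqon Z f1 f2 \<Longrightarrow> f1 ` p ` Y = p ` Y \<Longrightarrow> f2 ` W = W \<Longrightarrow>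
          \<exists>f\<in>S. eqon (p ` Y) f f1 \<and> eqon W f f2 \<and> f ` U = U"
    proof -
      from amalgam_S[OF Z Y f(2) ZY f(4)] show ?thesis
        unfolding amalgamates_def by (elim bexE conjE) (rule that, auto)
    qed
    \<comment> \<open>\<open>glue\<close> speaks about maps of the translate of \<open>Y\<close>;
      conjugation by \<open>p\<close> turns it into a statement about maps of \<open>Y\<close>
      itself.\<close>
    have glue': "\<exists>e\<in>S. eqon Y (e \<circ> p) (p \<circ> f1) \<and> eqon W e f2 \<and> e ` U = U"
      if f1: "f1 \<in> S" "f1 ` Y = Y" and f2: "f2 \<in> S" "f2 ` W = W"
        and eq: "eqon Z f1 f2" "f1 ` Z = Z" for f1 f2
    proof -
      have 1: "p \<circ> f1 \<circ> inv p \<in> S" using p(1) f1(1) by (intro comp_S inv_S)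
      have 2: "eqon Z (p \<circ> f1 \<circ> inv p) f2"
      proof
        fix z assume z: "z \<in> Z"
        then have "inv p z = z" using G_simps(1)[OF S_G'[OF p(1)], of z] p(3) by simp
        moreover have "f1 z \<in> Z" using z eq(2) by blast
        ultimately show "(p \<circ> f1 \<circ> inv p) z = f2 z" using p(3) eq(1) z by simp
      qed
      have 3: "(p \<circ> f1 \<circ> inv p) ` p ` Y = p ` Y"
        using conj_image[OF S_G'[OF p(1)] f1(2)] .
      obtain e where "e \<in> S" "eqon (p ` Y) e (p \<circ> f1 \<circ> inv p)" "eqon W e f2" "e ` U = U"
        using glue[OF 1 f2(1) 2 3 f2(2)] by blast
      then show ?thesis using p(1) by (intro bexI[of _ e]) auto
    qed
    obtain as where as: "length as = length fs" "set as \<subseteq> S"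
      "\<And>i. i < length fs \<Longrightarrow> eqon W (as ! i) (fs ! i)"
      using fs f(2) by (rule generic_approx) auto
    have asW: "as ! i ` W = W" if "i < length fs" for i
      using image_eqon[OF as(3)[OF that]] f(5) that by (simp add: preserves_nth)
    have "\<forall>i<length fs. \<exists>e. e \<in> S \<and> eqon Y (e \<circ> p) (p \<circ> gs ! i) \<and> eqon W e (as ! i) \<and> e ` U = U"
    proof (intro allI impI)
      fix i assume i: "i < length fs"
      have "\<exists>e\<in>S. eqon Y (e \<circ> p) (p \<circ> gs ! i) \<and> eqon W e (as ! i) \<and> e ` U = U"
      proof (rule glue')
        show "gs ! i \<in> S" "as ! i \<in> S" using i len gsS as by auto
        show "gs ! i ` Y = Y" using i len gsY by (simp add: preserves_nth)
        show "as ! i ` W = W" using asW i .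
        show "eqon Z (gs ! i) (as ! i)" using gf[OF i] as(3)[OF i] f(4) by auto
        show "gs ! i ` Z = Z" using image_eqon[OF gf[OF i]] fsZ i by (simp add: preserves_nth)
      qed
      then show "\<exists>e. e \<in> S \<and> eqon Y (e \<circ> p) (p \<circ> gs ! i) \<and> eqon W e (as ! i) \<and> e ` U = U" by blast
    qed
    then obtain es where es: "length es = length fs"
      "\<And>i. i < length fs \<Longrightarrow> es ! i \<in> S \<and> eqon Y (es ! i \<circ> p) (p \<circ> gs ! i) \<and> eqon W (es ! i) (as ! i) \<and> es ! i ` U = U"
      unfolding Skolem_list_nth by blast
    have "\<exists>e\<in>S. eqon Y (e \<circ> p) (p \<circ> h) \<and> eqon W e f \<and> e ` U = U"
    proof (rule glue')
      show "h ` Z = Z" using image_eqon[OF hf] fZ by simp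
    qed (use h hY f hf in auto)
    then obtain e where e: "e \<in> S" "eqon Y (e \<circ> p) (p \<circ> h)" "eqon W e f" "e ` U = U" by blast
    have "extension fs es W U"
      unfolding extension_def
    proof (intro conjI allI impI)
      show "set es \<subseteq> S" using es by (auto simp: set_conv_nth)
      show "preserves es U" using es by (simp add: preserves_nth)
      show "eqon W (es ! i) (fs ! i)" if "i < length fs" for i
        using es(2)[OF that] as(3)[OF that] by simp
    qed (use p f es in auto)
    then obtain q where q: "q \<in> S" "realises fs es q W U"
      by (rule generic_realise[OF fs f(2) p(2)])
    have qW: "eqon W q id" using q(2) by (simp add: realises_def)
    have qW': "inv q x = x" if "x \<in> W" for x 
      using G_simps(1)[OF S_G'[OF q(1)], of x] qW that by simp
    \<comment> \<open>As \<open>q\<close> fixes \<open>W\<close> pointwise and \<open>f\<close>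
      preserves \<open>W\<close>, this conjugate still agrees with \<open>f\<close> on
      \<open>W\<close>.\<close>
    let ?t = "q \<circ> e \<circ> inv q"
    have t: "?t \<in> S" using q(1) e(1) by (intro comp_S inv_S)
    have tW: "eqon W ?t f"
    proof
      fix x assume x: "x \<in> W"
      have "f x \<in> W" using f(6) x by blast
      then show "?t x = f x" using qW' x e(3) qW by simp
    qed
    have "nbhd ?t (q ` U) \<subseteq> has_realisation fs Z Y gs h"
    proof
      fix g assume g: "g \<in> nbhd ?t (q ` U)"
      have "realises fs gs (q \<circ> p) Z Y"
        unfolding realises_def
      proof (intro conjI allI impI ballI)
        show "(q \<circ> p) z = id z" if "z \<in> Z" for z using that p(3) qW f(4) by auto
        fix i y assume i: "i < length fs" and y: "y \<in> Y"
        have "(fs ! i) (q (p y)) = q ((es ! i) (p y))"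
          using q(2) i y p(4) by (auto simp: realises_def)
        also have "\<dots> = q (p ((gs ! i) y))" using es(2)[OF i] y by simp
        finally show "(fs ! i \<circ> (q \<circ> p)) y = ((q \<circ> p) \<circ> gs ! i) y" by simp
      qed
      moreover have "eqon Y (g \<circ> (q \<circ> p)) (q \<circ> p \<circ> h)"
      proof
        fix y assume y: "y \<in> Y"
        have "g (q (p y)) = ?t (q (p y))" using g y p(4) by (auto simp: nbhd_def)
        also have "\<dots> = q (p (h y))" using q(1) e(2) y by simp
        finally show "(g \<circ> (q \<circ> p)) y = (q \<circ> p \<circ> h) y" by simp
      qed
      ultimately have "\<exists>s\<in>S. realises fs gs s Z Y \<and> eqon Y (g \<circ> s) (s \<circ> h)"
        using comp_S[OF q(1) p(1)] by (intro bexI[of _ "q \<circ> p"] conjI)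
      then show "g \<in> has_realisation fs Z Y gs h" by (simp add: has_realisation_def)
    qed
    moreover have "V \<subseteq> q ` U"
    proof
      fix x assume "x \<in> V"
      then have "x \<in> W" using f(3) by blast
      then show "x \<in> q ` U" using qW p(5) by (intro image_eqI[of _ _ x]) auto
    qed
    moreover have "eqon V ?t s" using tW f(3,7) by (simp add: subset_iff)
    ultimately show ?thesis using t image_S[OF q(1) p(2)]
      by (intro bexI[of _ ?t] bexI[of _ "q ` U"] conjI)
  qed
qed

text \<open>Since \<open>gs\<close> and \<open>h\<close> range over \<open>S\<close>, these are
  countably many conditions; an element of \<open>GS\<close> meeting all of them extends the generic
  tuple \<open>fs\<close> to a generic tuple.\<close>

definition dense_sets :: "('a \<Rightarrow> 'a) list \<Rightarrow> ('a \<Rightarrow> 'a) set set" where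
  "dense_sets fs = has_invariant fs ` XX \<union> (\<lambda>(Z, Y, gs, h). has_realisation fs Z Y gs h) ` (XX \<times> XX \<times> lists S \<times> S)"

lemma countable_dense_sets: "countable (dense_sets fs)"
  unfolding dense_sets_def using countable_XX countable_S by (intro countable_Un countable_image countable_SIGMA) auto

lemma dense_dense_sets: "generic fs \<Longrightarrow> D \<in> dense_sets fs \<Longrightarrow> dense X D"
  unfolding dense_sets_def using dense_has_invariant dense_has_realisation by auto

lemma generic_append:
  assumes fs: "generic fs" and g: "g \<in> GS" "\<And>D. D \<in> dense_sets fs \<Longrightarrow> g \<in> D"
  shows "generic (fs @ [g])"
  unfolding generic_def
proof (intro conjI ballI allI impI)
  show "set (fs @ [g]) \<subseteq> GS" using fs g(1) by (simp add: generic_def)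
  show "\<exists>Z\<in>XX. W \<subseteq> Z \<and> preserves (fs @ [g]) Z" if "W \<in> XX" for W
  proof -
    have "has_invariant fs W \<in> dense_sets fs" using that by (simp add: dense_sets_def)
    from g(2)[OF this] show ?thesis by (auto simp: has_invariant_def)
  qed
  fix Z Y gs assume Z: "Z \<in> XX" and Y: "Y \<in> XX" and ext: "extension (fs @ [g]) gs Z Y"
  then have len: "length gs = Suc (length fs)" by (simp add: extension_def)
  then obtain gs' h where gs: "gs = gs' @ [h]" "length gs' = length fs"
    by (metis length_append_singleton length_0_conv nat.distinct(1) nat.inject rev_exhaust)
  have nth: "eqon Z (gs ! i) ((fs @ [g]) ! i)" if "i \<le> length fs" for i
    using ext that by (simp add: extension_def)
  have 1: "eqon Z (gs' ! i) (fs ! i)" if "i < length fs" for i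
    using nth[of i] that gs by (simp add: nth_append)
  have 2: "eqon Z h g" using nth[of "length fs"] gs by (simp add: nth_append)
  have ext': "extension fs gs' Z Y" "h \<in> S" "h ` Y = Y" "g ` Z = Z" "set gs' \<subseteq> S"
    using ext 1 unfolding extension_def gs(1) by (auto simp: gs(2))
  have "has_realisation fs Z Y gs' h \<in> dense_sets fs"
    unfolding dense_sets_def using Z Y ext'(2,5) by (intro UnI2 image_eqI[of _ _ "(Z, Y, gs', h)"]) auto
  from g(2)[OF this] obtain s where s: "s \<in> S" "realises fs gs' s Z Y" "eqon Y (g \<circ> s) (s \<circ> h)"
    using ext' 2 by (auto simp: has_realisation_def)
  have "realises (fs @ [g]) gs s Z Y"
    using s(2,3) gs(2) unfolding realises_def gs(1) by (auto simp: nth_append less_Suc_eq)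
  then show "\<exists>s\<in>S. realises (fs @ [g]) gs s Z Y" using s(1) by blast
qed


lemma dense_UNIV: "dense X UNIV"
  unfolding dense_def by auto

lemma countable_dense_enum:
  assumes "countable \<D>" "\<And>D. D \<in> \<D> \<Longrightarrow> dense X D"
  shows "\<exists>D :: nat \<Rightarrow> ('a \<Rightarrow> 'a) set. (\<forall>i. dense X (D i)) \<and> \<D> \<subseteq> range D"
proof -
  \<comment> \<open>Inserting \<open>UNIV\<close> provides an enumeration even if the given family
    is empty.\<close>
  define D where "D = from_nat_into (insert UNIV \<D>)"
  have range: "range D = insert UNIV \<D>" unfolding D_def using assms(1) by (simp add: range_from_nat_into)
  have "dense X (D i)" for i
  proof -
    have "D i \<in> insert UNIV \<D>" using range by blast
    then show ?thesis using assms(2) dense_UNIV by (cases "D i = UNIV") auto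
  qed
  then show ?thesis using range by blast
qed

end

section \<open>The contradiction for a subgroup of small index\<close>

locale small_index_family = dense_family +
  fixes H :: "('a \<Rightarrow> 'a) set"
  assumes H_comp: "g \<in> H \<Longrightarrow> h \<in> H \<Longrightarrow> g \<circ> h \<in> H" and H_inv: "g \<in> H \<Longrightarrow> inv g \<in> H"
    and H_G: "H \<subseteq> G"
    and few: "\<And>y :: nat set \<Rightarrow> 'a \<Rightarrow> 'a. (\<And>r. y r \<in> G) \<Longrightarrow> \<exists>a b. a \<noteq> b \<and> inv (y a) \<circ> y b \<in> H"
    and proper: "X \<in> XX \<Longrightarrow> \<exists>c\<in>S. c \<notin> H \<and> eqon X c id"
begin

text \<open>\<open>few\<close>, applied to a Mycielski set, yields \<open>u\<close> in
  \<open>H\<close>; a Baire generic element, multiplied by \<open>c\<close> if necessary, yields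
  \<open>v\<close> outside \<open>H\<close>. Both extend \<open>fs\<close> generically and fix
  \<open>X\<close> pointwise, so \<open>fs @ [u]\<close> and \<open>fs @ [v]\<close> are conjugate
  over \<open>X\<close>, and the conjugating \<open>k\<close> centralises \<open>fs\<close>.\<close>

lemma generic_pair:
  assumes fs: "generic fs" and W: "W \<in> XX"
  shows "\<exists>u v k. u \<in> H \<and> v \<notin> H \<and> v \<in> GS \<and> k \<in> GS \<and> eqon W k id \<and>
    (\<forall>f\<in>set fs. k \<circ> f = f \<circ> k) \<and> k \<circ> u = v \<circ> k \<and> generic (fs @ [u, v])"
proof -
  obtain X where X: "X \<in> XX" "W \<subseteq> X" "preserves fs X"
    using generic_preserved[OF fs W W] by metis
  obtain c where c: "c \<in> S" "c \<notin> H" "eqon X c id" using proper[OF X(1)] by blast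
  have "\<exists>D. (\<forall>i::nat. dense X (D i)) \<and> dense_sets fs \<subseteq> range D"
    by (rule countable_dense_enum[OF countable_dense_sets dense_dense_sets[OF fs]])
  then obtain D where D: "\<And>i::nat. dense X (D i)" "dense_sets fs \<subseteq> range D" by blast
  have "\<exists>y :: nat set \<Rightarrow> 'a \<Rightarrow> 'a. (\<forall>r. y r \<in> GS \<and> eqon X (y r) id) \<and>
      (\<forall>a b. a \<noteq> b \<longrightarrow> (\<forall>i. inv (y a) \<circ> y b \<in> D i))"
    by (rule mycielski[where D=D, OF D(1) X(1)])
  then obtain y :: "nat set \<Rightarrow> 'a \<Rightarrow> 'a" where y0: "\<forall>r. y r \<in> GS \<and> eqon X (y r) id"
      "\<forall>a b. a \<noteq> b \<longrightarrow> (\<forall>i. inv (y a) \<circ> y b \<in> D i)"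
    by (elim exE conjE)
  have y: "y r \<in> GS" "eqon X (y r) id" "a \<noteq> b \<Longrightarrow> inv (y a) \<circ> y b \<in> D i" for r a b i
    using y0 by simp_all
  obtain a b where ab: "a \<noteq> b" "inv (y a) \<circ> y b \<in> H" using few[of y] y(1) by auto
  define u where "u = inv (y a) \<circ> y b"
  have uGS: "u \<in> GS" unfolding u_def using y(1) comp_GS inv_GS by blast
  have uX: "eqon X u id"
  proof
    fix x assume x: "x \<in> X"
    show "u x = id x"
      using y(2)[of a] y(2)[of b] x G_simps(1)[OF GS_G[OF y(1)[of a]], of x] by (simp add: u_def)
  qed
  have "u \<in> E" if "E \<in> dense_sets fs" for E
    using subsetD[OF D(2) that] y(3)[OF ab(1)] unfolding u_def by auto
  then have fsu: "generic (fs @ [u])" using generic_append[OF fs uGS] by blast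
  \<comment> \<open>Genericity of \<open>fs @ [v]\<close> serves the conjugation, genericity of
    \<open>fs @ [u, v]\<close> the next stage of the construction. The translates in the following
    line make both \<open>g\<close> and \<open>c \<circ> g\<close> suitable, and these cannot both
    lie in \<open>H\<close>.\<close>
  let ?\<D> = "dense_sets fs \<union> dense_sets (fs @ [u])"
  let ?\<D>' = "?\<D> \<union> (\<lambda>D. {g. c \<circ> g \<in> D}) ` ?\<D>"
  have "countable ?\<D>'" using countable_dense_sets by auto
  moreover have "dense X E" if "E \<in> ?\<D>'" for E
    using that dense_dense_sets[OF fs] dense_dense_sets[OF fsu] dense_translate[OF _ c(1,3)] by auto
  ultimately have "\<exists>D. (\<forall>i::nat. dense X (D i)) \<and> ?\<D>' \<subseteq> range D" by (rule countable_dense_enum)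
  then obtain D' where D': "\<And>i::nat. dense X (D' i)" "?\<D>' \<subseteq> range D'" by blast
  have "\<exists>g\<in>GS. eqon X g id \<and> (\<forall>i. g \<in> D' i)" by (rule baire[where D=D', OF D'(1) X(1)])
  then obtain g where g: "g \<in> GS" "eqon X g id" "\<forall>i. g \<in> D' i" by (elim bexE conjE)
  have gE: "g \<in> E" if "E \<in> ?\<D>'" for E using subsetD[OF D'(2) that] g(3) by auto
  have "\<exists>v. v \<in> GS \<and> v \<notin> H \<and> eqon X v id \<and> (\<forall>E\<in>?\<D>. v \<in> E)"
  proof (cases "g \<in> H")
    case False
    then show ?thesis using g(1,2) gE by (intro exI[of _ g]) auto
  next
    case True
    have "c \<circ> g \<notin> H"
    proof
      assume "c \<circ> g \<in> H"
      then have "(c \<circ> g) \<circ> inv g \<in> H" using True H_comp H_inv by blast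
      moreover have "(c \<circ> g) \<circ> inv g = c" using g(1) by (simp add: fun_eq_iff)
      ultimately show False using c(2) by simp
    qed
    moreover have "c \<circ> g \<in> GS" using comp_GS[OF S_GS[OF c(1)] g(1)] .
    moreover have "c \<circ> g \<in> E" if "E \<in> ?\<D>" for E
      using gE[of "{g. c \<circ> g \<in> E}"] that by blast
    moreover have "eqon X (c \<circ> g) id" using g(2) c(3) by simp
    ultimately show ?thesis by (intro exI[of _ "c \<circ> g"]) auto
  qed
  then obtain v where v: "v \<in> GS" "v \<notin> H" "eqon X v id" "\<And>E. E \<in> ?\<D> \<Longrightarrow> v \<in> E" by blast
  have fsv: "generic (fs @ [v])" using generic_append[OF fs v(1)] v(4) by blast
  have fsuv: "generic ((fs @ [u]) @ [v])" using generic_append[OF fsu v(1)] v(4) by blast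
  have "\<exists>k\<in>GS. eqon X k id \<and> (\<forall>i<length (fs @ [u]). k \<circ> (fs @ [u]) ! i = (fs @ [v]) ! i \<circ> k)"
  proof (rule generic_conjugate[OF fsu fsv _ X(1)])
    have "u ` X = X" using image_eqon[OF uX] by simp
    then show "preserves (fs @ [u]) X" using X(3) by simp
    show "eqon X ((fs @ [u]) ! i) ((fs @ [v]) ! i)" if "i < length (fs @ [u])" for i
      using that uX v(3) by (cases "i < length fs") (auto simp: nth_append less_Suc_eq)
  qed simp
  then obtain k where k: "k \<in> GS" "eqon X k id"
      "\<And>i. i < Suc (length fs) \<Longrightarrow> k \<circ> (fs @ [u]) ! i = (fs @ [v]) ! i \<circ> k" by auto
  have "k \<circ> f = f \<circ> k" if "f \<in> set fs" for f
  proof -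
    obtain i where "i < length fs" "f = fs ! i" using \<open>f \<in> set fs\<close> by (auto simp: in_set_conv_nth)
    then show ?thesis using k(3)[of i] by (simp add: nth_append)
  qed
  moreover have "k \<circ> u = v \<circ> k" using k(3)[of "length fs"] by (simp add: nth_append)
  moreover have "eqon W k id" using k(2) X(2) by auto
  ultimately show ?thesis using ab(2) v(1,2) k(1) fsuv 
    by (intro exI[of _ u] exI[of _ v] exI[of _ k] conjI ballI) (simp_all add: u_def)
qed

lemma inconsistent: False
proof -
  obtain w :: "nat \<Rightarrow> 'a set" where w: "\<And>n. w n \<in> XX" "\<And>X. X \<in> XX \<Longrightarrow> \<exists>n. \<forall>k\<ge>n. X \<subseteq> w k"
    using exhaustion by blast
  \<comment> \<open>\<open>fs\<close> lists all earlier \<open>u\<close> and \<open>v\<close>, and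
    \<open>Q\<close> collects the at most \<open>2 ^ n\<close> partial products formed before stage
    \<open>n\<close>. The set \<open>W\<close> is so large that all of them cover
    \<open>w n\<close>, which makes every limit surjective.\<close>
  define P where "P n x = (case x of (fs, Q, W, u, v, k) \<Rightarrow> generic fs \<and> finite Q \<and> Q \<subseteq> GS \<and> id \<in> Q \<and> W \<in> XX \<and>
     w n \<subseteq> W \<and> (\<forall>q\<in>Q. w n \<subseteq> q ` W) \<and> u \<in> H \<and> v \<notin> H \<and> v \<in> GS \<and> k \<in> GS \<and> eqon W k id \<and>
     (\<forall>f\<in>set fs. k \<circ> f = f \<circ> k) \<and> k \<circ> u = v \<circ> k \<and> generic (fs @ [u, v]))"
    for n and x :: "('a \<Rightarrow> 'a) list \<times> ('a \<Rightarrow> 'a) set \<times> 'a set \<times> ('a \<Rightarrow> 'a) \<times> ('a \<Rightarrow> 'a) \<times> ('a \<Rightarrow> 'a)"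
  define R where "R x y = (case x of (fs, Q, W, u, v, k) \<Rightarrow> case y of (fs', Q', W', u', v', k') \<Rightarrow>
     fs' = fs @ [u, v] \<and> Q' = Q \<union> (\<lambda>q. q \<circ> k) ` Q \<and> W \<subseteq> W')"
    for x y :: "('a \<Rightarrow> 'a) list \<times> ('a \<Rightarrow> 'a) set \<times> 'a set \<times> ('a \<Rightarrow> 'a) \<times> ('a \<Rightarrow> 'a) \<times> ('a \<Rightarrow> 'a)"
  have step: "\<exists>W' u v k. W \<subseteq> W' \<and> P n (fs, Q, W', u, v, k)"
    if fs: "generic fs" and Q: "finite Q" "Q \<subseteq> GS" "id \<in> Q" and W: "W \<in> XX" for fs Q W n
  proof -
    have "Q \<subseteq> G" using Q(2) GS_G by blast
    from enlarge[OF Q(1) this W w(1)[of n]]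
    obtain W' where W': "W' \<in> XX" "W \<subseteq> W'" "w n \<subseteq> W'" "\<forall>q\<in>Q. w n \<subseteq> q ` W'"
      by (elim bexE conjE)
    from generic_pair[OF fs W'(1)]
    obtain u v k where uvk: "u \<in> H" "v \<notin> H" "v \<in> GS" "k \<in> GS" "eqon W' k id"
      "\<forall>f\<in>set fs. k \<circ> f = f \<circ> k" "k \<circ> u = v \<circ> k" "generic (fs @ [u, v])"
      by (elim exE conjE)
    have "P n (fs, Q, W', u, v, k)" unfolding P_def split
      by (intro conjI ballI) (rule fs Q W'(1,3) bspec[OF W'(4)] uvk bspec[OF uvk(5)] bspec[OF uvk(6)] | assumption)+
    then show ?thesis using W'(2) by blast
  qed
  have "\<exists>f. \<forall>n. P n (f n) \<and> R (f n) (f (Suc n))"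
  proof (rule dependent_nat_choice)
    have "\<exists>W' u v k. w 0 \<subseteq> W' \<and> P 0 ([], {id}, W', u, v, k)"
      by (rule step[OF generic_Nil]) (use S_GS[OF id_S] w(1) in auto)
    then show "\<exists>x. P 0 x" by blast
    show "\<exists>y. P (Suc n) y \<and> R x y" if Px: "P n x" for x n
    proof -
      obtain fs Q W u v k where x: "x = (fs, Q, W, u, v, k)" by (cases x)
      have "\<exists>W' u' v' k'. W \<subseteq> W' \<and> P (Suc n) (fs @ [u, v], Q \<union> (\<lambda>q. q \<circ> k) ` Q, W', u', v', k')"
        by (rule step) (use Px x comp_GS in \<open>auto simp: P_def\<close>)
      then obtain W' u' v' k' where "W \<subseteq> W'"
        "P (Suc n) (fs @ [u, v], Q \<union> (\<lambda>q. q \<circ> k) ` Q, W', u', v', k')" by (elim exE conjE)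
      then show ?thesis unfolding x R_def
        by (intro exI[of _ "(fs @ [u, v], Q \<union> (\<lambda>q. q \<circ> k) ` Q, W', u', v', k')"]) simp
    qed
  qed
  then obtain f where f: "\<And>n. P n (f n)" "\<And>n. R (f n) (f (Suc n))" by blast
  define fs where "fs n = fst (f n)" for n
  define Q where "Q n = fst (snd (f n))" for n
  define W where "W n = fst (snd (snd (f n)))" for n
  define u where "u n = fst (snd (snd (snd (f n))))" for n
  define v where "v n = fst (snd (snd (snd (snd (f n)))))" for n
  define k where "k n = snd (snd (snd (snd (snd (f n)))))" for n
  have fn: "f n = (fs n, Q n, W n, u n, v n, k n)" for n
    by (simp add: fs_def Q_def W_def u_def v_def k_def)
  have Pn: "P n (fs n, Q n, W n, u n, v n, k n)" for n using f(1)[of n] fn by simp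
  have Rn: "fs (Suc n) = fs n @ [u n, v n]" "Q (Suc n) = Q n \<union> (\<lambda>q. q \<circ> k n) ` Q n" "W n \<subseteq> W (Suc n)" for n
    using f(2)[of n] unfolding fn R_def by auto
  have Wn: "W n \<in> XX" "w n \<subseteq> W n" and Hn: "u n \<in> H" "v n \<notin> H" "v n \<in> GS"
    and kn: "k n \<in> GS" "eqon (W n) (k n) id" "k n \<circ> u n = v n \<circ> k n"
    and Q: "Q n \<subseteq> GS" "id \<in> Q n" and QW: "\<And>q. q \<in> Q n \<Longrightarrow> w n \<subseteq> q ` W n"
    and comm: "\<And>g. g \<in> set (fs n) \<Longrightarrow> k n \<circ> g = g \<circ> k n" for n
    using Pn[of n] unfolding P_def split by (elim conjE; blast)+
  have mem: "u n \<in> set (fs N)" "v n \<in> set (fs N)" if "n < N" for n N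
    using that by (induction N) (auto simp: Rn less_Suc_eq)
  \<comment> \<open>The product of the \<open>k i\<close> with \<open>i < n\<close> and
    \<open>i \<in> s\<close>. A new factor is put on the right; since \<open>k n\<close> fixes
    \<open>W n\<close>, it does not change the values on \<open>W n\<close>.\<close>
  define p where "p s = rec_nat id (\<lambda>n q. if n \<in> s then q \<circ> k n else q)" for s
  have p0: "p s 0 = id" and pSuc: "p s (Suc n) = (if n \<in> s then p s n \<circ> k n else p s n)" for s n
    by (simp_all add: p_def)
  have pQ: "p s n \<in> Q n" for s n
  proof (induction n)
    case 0
    show ?case unfolding p0 by (rule Q(2))
  next
    case (Suc n)
    then show ?case using Rn(2)[of n] by (cases "n \<in> s") (simp_all only: pSuc if_True if_False, blast+)
  qed
  have pGS: "p s n \<in> GS" for s n using pQ Q(1) by blast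
  have "\<exists>g\<in>GS. \<forall>n. eqon (W n) g (p s n)" for s
  proof (rule limit_GS[where w=w])
    show "eqon (W n) (p s (Suc n)) (p s n)" for n using kn(2)[of n] by (auto simp: pSuc)
    show "\<exists>n. \<forall>k\<ge>n. X \<subseteq> w k" if "X \<in> XX" for X using w(2) that by blast
  qed (use pGS Rn(3) Wn(2) QW pQ in auto)
  then have "\<exists>h. \<forall>s. h s \<in> GS \<and> (\<forall>n. eqon (W n) (h s) (p s n))"
    by (intro choice allI) (simp only: Bex_def)
  then obtain h where h0: "\<forall>s. h s \<in> GS \<and> (\<forall>n. eqon (W n) (h s) (p s n))" by (elim exE)
  have h: "h s \<in> GS" "eqon (W n) (h s) (p s n)" for s n using h0 by simp_all
  have Wmono: "W n \<subseteq> W N" if "n \<le> N" for n N using Rn(3) that by (rule lift_Suc_mono_le)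
  have Wcover: "\<exists>N\<ge>n. x \<in> W N" for x n
  proof -
    obtain X where X: "X \<in> XX" "x \<in> X" using cover_XX by blast
    obtain N where N: "\<And>l. l \<ge> N \<Longrightarrow> X \<subseteq> w l" using w(2)[OF X(1)] by blast
    have "x \<in> W (max n N)" using N[of "max n N"] X(2) Wn(2)[of "max n N"] by auto
    then show ?thesis by (intro exI[of _ "max n N"]) auto
  qed
  \<comment> \<open>A relation established at stage \<open>Suc n\<close> survives in the limit: the
    later factors \<open>k N\<close> commute with \<open>u n\<close> and \<open>v n\<close>, which
    are entries of \<open>fs N\<close>.\<close>
  have tail: "h s \<circ> g = y \<circ> h s"
    if g: "g \<in> {u n, v n}" and y: "p s (Suc n) \<circ> g = y \<circ> p s (Suc n)" for s g y n
  proof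
    fix x
    have eq: "p s N \<circ> g = y \<circ> p s N" if "Suc n \<le> N" for N
      using that
    proof (induction N rule: dec_induct)
      case base
      show ?case by (rule y)
    next
      case (step N)
      have "k N \<circ> g = g \<circ> k N" using g mem[of n N] comm[of _ N] step(1) by auto
      then have "(p s N \<circ> k N) \<circ> g = y \<circ> (p s N \<circ> k N)"
        using step(3) by (metis comp_assoc)
      then show ?case using step(3) by (cases "N \<in> s") (simp_all only: pSuc if_True if_False)
    qed
    obtain N1 where N1: "N1 \<ge> Suc n" "x \<in> W N1" using Wcover by blast
    obtain N where N: "N \<ge> N1" "g x \<in> W N" using Wcover by blast
    have "x \<in> W N" using N1(2) Wmono[OF N(1)] by blast
    then show "(h s \<circ> g) x = (y \<circ> h s) x"
      using h(2)[of N s] N(2) fun_cong[OF eq, of N x] N(1) N1(1) by simp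
  qed
  have distinct: "inv (h s) \<circ> h t \<notin> H"
    if st: "n \<notin> s" "n \<in> t" "s \<inter> {..<n} = t \<inter> {..<n}" for s t n
  proof
    assume gH: "inv (h s) \<circ> h t \<in> H"
    define g where "g = inv (h s) \<circ> h t"
    have pst: "p s N = p t N" if "N \<le> n" for N
      using that
    proof (induction N)
      case (Suc N)
      have "N \<in> s \<longleftrightarrow> N \<in> t" using arg_cong[OF st(3), of "\<lambda>A. N \<in> A"] Suc.prems by simp
      then show ?case using Suc by (simp only: pSuc Suc_le_eq less_imp_le)
    qed (simp only: p0)
    \<comment> \<open>This \<open>y\<close> is at once the conjugate of \<open>v n\<close> by
      \<open>h s\<close> and of \<open>u n\<close> by \<open>h t\<close>: the two products agree
      below \<open>n\<close>, and only the second one contains \<open>k n\<close>, which takes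
      \<open>u n\<close> to \<open>v n\<close>.\<close>
    define y where "y = p s n \<circ> v n \<circ> inv (p s n)"
    have yp: "y \<circ> p s n = p s n \<circ> v n"
      using GS_G[OF pGS[of s n]] by (simp add: y_def fun_eq_iff)
    have "h s \<circ> v n = y \<circ> h s" using st(1) yp by (intro tail[of _ n]) (simp_all only: pSuc if_False insert_iff simp_thms)
    moreover have "h t \<circ> u n = y \<circ> h t"
    proof (rule tail[of _ n])
      have "p t n \<circ> k n \<circ> u n = p t n \<circ> v n \<circ> k n" using kn(3)[of n] by (metis comp_assoc)
      also have "\<dots> = y \<circ> (p t n \<circ> k n)" using yp pst[of n] by (metis comp_assoc order_refl)
      finally show "p t (Suc n) \<circ> u n = y \<circ> p t (Suc n)" using st(2) by (simp only: pSuc if_True)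
    qed simp
    ultimately have eq: "h s (v n x) = y (h s x)" "h t (u n x) = y (h t x)" for x
      by (simp_all add: fun_eq_iff)
    have hs: "h s \<in> G" by (rule GS_G[OF h(1)])
    have gG: "g \<in> G" using gH H_G by (auto simp: g_def)
    have "g (u n x) = v n (g x)" for x
    proof -
      have "h s (v n (g x)) = y (h t x)" using eq(1)[of "g x"] hs by (simp add: g_def)
      then have "h s (v n (g x)) = h s (g (u n x))" using eq(2)[of x] hs by (simp add: g_def)
      then show ?thesis using hs by simp
    qed
    then have "v n = g \<circ> u n \<circ> inv g" using gG by (simp add: fun_eq_iff)
    moreover have "g \<circ> u n \<circ> inv g \<in> H" using gH Hn(1) H_comp H_inv unfolding g_def by blast
    ultimately show False using Hn(2)[of n] by simp
  qed
  obtain a b where ab: "a \<noteq> b" "inv (h a) \<circ> h b \<in> H"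
    using few[of h, OF GS_G[OF h(1)]] by (elim exE conjE)
  \<comment> \<open>\<open>distinct\<close> is about a first difference lying in the second set. It
    is open which of \<open>a\<close> and \<open>b\<close> contains it, so both quotients are
    brought into \<open>H\<close>.\<close>
  have ba: "inv (h b) \<circ> h a \<in> H"
  proof -
    have "inv (inv (h a) \<circ> h b) = inv (h b) \<circ> h a"
      using inv_comp_G[OF inv_G[OF GS_G[OF h(1)]] GS_G[OF h(1)], of a b] GS_G[OF h(1)] by simp
    then show ?thesis using H_inv[OF ab(2)] by simp
  qed
  define n where "n = (LEAST n. (n \<in> a) \<noteq> (n \<in> b))"
  have "\<exists>n. (n \<in> a) \<noteq> (n \<in> b)" using ab(1) by blast
  then have n: "(n \<in> a) \<noteq> (n \<in> b)" unfolding n_def by (rule LeastI_ex)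
  have "N \<in> a \<longleftrightarrow> N \<in> b" if "N < n" for N
    using not_less_Least[of N "\<lambda>n. (n \<in> a) \<noteq> (n \<in> b)"] that unfolding n_def by simp
  then have "a \<inter> {..<n} = b \<inter> {..<n}" by auto
  then show False using distinct[of n a b] distinct[of n b a] n ab(2) ba by auto
qed

end

section \<open>Countable hulls and the abstract small index theorem\<close>

locale amalgamation_family = perm_family +
  assumes extend: "g \<in> G \<Longrightarrow> X \<in> XX \<Longrightarrow> Z \<in> XX \<Longrightarrow> X \<subseteq> Z \<Longrightarrow> g ` X \<subseteq> Z \<Longrightarrow>
      \<exists>f\<in>G. eqon X f g \<and> f ` Z = Z"
    and amalgam: "X \<in> XX \<Longrightarrow> Y1 \<in> XX \<Longrightarrow> Y2 \<in> XX \<Longrightarrow> X \<subseteq> Y1 \<Longrightarrow> X \<subseteq> Y2 \<Longrightarrow>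
      \<exists>g\<in>G. \<exists>Z\<in>XX. amalgamates G X Y1 Y2 g Z"
begin

text \<open>A downward Loewenheim-Skolem argument: \<open>C\<close> is closed under the group
  operations and under chosen witnesses, of which each stage adds only countably many because
  \<open>XX\<close> is countable.\<close>

lemma skolem_hull:
  assumes C: "countable C" "C \<subseteq> G"
  shows "\<exists>S. C \<subseteq> S \<and> dense_family G XX S"
proof -
  \<comment> \<open>The default \<open>id\<close> keeps the values in \<open>G\<close> also for
    conditions without a witness.\<close>
  define pick where "pick P = (if \<exists>f\<in>G. P f then SOME f. f \<in> G \<and> P f else id)" for P
  have pick: "pick P \<in> G \<and> (f \<in> G \<longrightarrow> P f \<longrightarrow> P (pick P))" for P f
  proof (cases "\<exists>f\<in>G. P f")
    case True
    then have "\<exists>f. f \<in> G \<and> P f" by blast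
    then have "(SOME f. f \<in> G \<and> P f) \<in> G \<and> P (SOME f. f \<in> G \<and> P f)" by (rule someI_ex)
    then show ?thesis using True by (simp add: pick_def)
  qed (use id_G in \<open>auto simp: pick_def\<close>)
  have pick_ex: "P (pick P)" if "\<exists>f\<in>G. P f" for P using pick that by blast
  define ext where "ext g X Z = pick (\<lambda>f. eqon X f g \<and> f ` Z = Z)" for g X Z
  define glue where "glue P Y Z f1 f2 = pick (\<lambda>f. eqon P f f1 \<and> eqon Y f f2 \<and> f ` Z = Z)" for P Y Z f1 f2
  define trans where "trans X Y1 Y2 = pick (\<lambda>g. \<exists>Z\<in>XX. amalgamates G X Y1 Y2 g Z)" for X Y1 Y2
  define step where "step T = T \<union> (\<lambda>(g, h). g \<circ> h) ` (T \<times> T) \<union> inv ` T \<union>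
     (\<lambda>(g, X, Z). ext g X Z) ` (T \<times> XX \<times> XX) \<union>
     (\<lambda>(P, Y, Z, f1, f2). glue P Y Z f1 f2) ` (XX \<times> XX \<times> XX \<times> T \<times> T)" for T
  \<comment> \<open>The translating maps \<open>trans\<close> depend on members of \<open>XX\<close>
    only and enter at stage 0; the witnesses \<open>ext\<close> and \<open>glue\<close> depend on
    group elements and are added at every later stage.\<close>
  define T where "T = rec_nat (insert id (C \<union> (\<lambda>(X, Y1, Y2). trans X Y1 Y2) ` (XX \<times> XX \<times> XX))) (\<lambda>_. step)"
  have T0: "T 0 = insert id (C \<union> (\<lambda>(X, Y1, Y2). trans X Y1 Y2) ` (XX \<times> XX \<times> XX))"
    and TSuc: "T (Suc n) = step (T n)" for n by (simp_all add: T_def)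
  have countable_step: "countable (step A)" if "countable A" for A
    unfolding step_def using that countable_XX by (intro countable_Un countable_image countable_SIGMA)
  have step_G: "step A \<subseteq> G" if "A \<subseteq> G" for A
    unfolding step_def using that comp_G inv_G pick by (auto simp: ext_def glue_def subset_iff)
  have TG: "T n \<subseteq> G" for n
  proof (induction n)
    case 0
    show ?case unfolding T0 using id_G C(2) pick by (auto simp: trans_def)
  qed (simp add: TSuc step_G)
  have Tc: "countable (T n)" for n
  proof (induction n)
    case 0
    show ?case unfolding T0 using C(1) countable_XX
      by (intro countable_insert countable_Un countable_image countable_SIGMA)
  qed (simp add: TSuc countable_step)
  have Tmono: "T n \<subseteq> T k" if "n \<le> k" for n k
  proof (rule lift_Suc_mono_le[OF _ that])
    show "T n \<subseteq> T (Suc n)" for n unfolding TSuc step_def by blast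
  qed
  define S where "S = (\<Union>n. T n)"
  have TS: "T n \<subseteq> S" for n by (auto simp: S_def)
  have SG: "S \<subseteq> G" using TG by (auto simp: S_def)
  have common: "\<exists>n. g \<in> T n \<and> h \<in> T n" if gh: "g \<in> S" "h \<in> S" for g h
  proof -
    obtain n k where "g \<in> T n" "h \<in> T k" using gh by (auto simp: S_def)
    then have "g \<in> T (max n k)" "h \<in> T (max n k)"
      using Tmono[of n "max n k"] Tmono[of k "max n k"] by auto
    then show ?thesis by blast
  qed
  have stepS: "x \<in> S" if "x \<in> step (T n)" for x n using that TS[of "Suc n"] TSuc[of n] by blast
  have "dense_family G XX S"
  proof unfold_locales
    show "S \<subseteq> G" by (rule SG)
    show "countable S" unfolding S_def using Tc by (intro countable_UN) auto
    have "id \<in> T 0" unfolding T0 by blast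
    then show "id \<in> S" using TS by blast
    show "g \<circ> h \<in> S" if gh: "g \<in> S" "h \<in> S" for g h
    proof -
      obtain n where "g \<in> T n" "h \<in> T n" using common[OF gh] by blast
      then have "g \<circ> h \<in> step (T n)" unfolding step_def by blast
      then show ?thesis by (rule stepS)
    qed
    show "inv g \<in> S" if g: "g \<in> S" for g
    proof -
      obtain n where "g \<in> T n" using common[OF g g] by blast
      then have "inv g \<in> step (T n)" unfolding step_def by blast
      then show ?thesis by (rule stepS)
    qed
    show "\<exists>f\<in>S. eqon X f g \<and> f ` Z = Z"
      if g: "g \<in> S" "X \<in> XX" "Z \<in> XX" "X \<subseteq> Z" "g ` X \<subseteq> Z" for g X Z
    proof -
      obtain n where "g \<in> T n" using common[OF g(1) g(1)] by blast
      then have "ext g X Z \<in> step (T n)" unfolding step_def using g(2,3)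
        by (intro UnI1[OF UnI2] image_eqI[of _ _ "(g, X, Z)"]) auto
      moreover have "g \<in> G" using g(1) SG by blast
      from pick_ex[OF extend[OF this g(2-5)]]
      have "eqon X (ext g X Z) g \<and> ext g X Z ` Z = Z" unfolding ext_def .
      ultimately show ?thesis using stepS by (intro bexI)
    qed
    show "\<exists>g\<in>S. \<exists>Z\<in>XX. amalgamates S X Y1 Y2 g Z"
      if X: "X \<in> XX" "Y1 \<in> XX" "Y2 \<in> XX" "X \<subseteq> Y1" "X \<subseteq> Y2" for X Y1 Y2
    proof -
      let ?g = "trans X Y1 Y2"
      have "?g \<in> T 0" unfolding T0 using X by (intro insertI2 UnI2 image_eqI[of _ _ "(X, Y1, Y2)"]) auto
      then have gS: "?g \<in> S" using TS by blast
      then have gY: "?g ` Y1 \<in> XX" using SG X(2) by (intro image_XX) auto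
      have "\<exists>Z\<in>XX. amalgamates G X Y1 Y2 ?g Z" unfolding trans_def by (rule pick_ex[OF amalgam[OF X]])
      then obtain Z where Z: "Z \<in> XX" "amalgamates G X Y1 Y2 ?g Z" by (elim bexE)
      \<comment> \<open>In passing from \<open>G\<close> to \<open>S\<close> the given maps
        \<open>f1\<close> and \<open>f2\<close> become fewer, but their common extension has to lie
        in \<open>S\<close>; closure under \<open>glue\<close> ensures this.\<close>
      have "amalgamates S X Y1 Y2 ?g Z"
        unfolding amalgamates_def
      proof (intro conjI ballI impI)
        fix f1 f2 assume f: "f1 \<in> S" "f2 \<in> S" "eqon X f1 f2" "f1 ` ?g ` Y1 = ?g ` Y1" "f2 ` Y2 = Y2"
        let ?f = "glue (?g ` Y1) Y2 Z f1 f2"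
        obtain n where "f1 \<in> T n" "f2 \<in> T n" using common[OF f(1,2)] by blast
        then have "?f \<in> step (T n)" unfolding step_def using gY X(3) Z(1)
          by (intro UnI2[of _ "(\<lambda>(P, Y, Z, f1, f2). glue P Y Z f1 f2) ` _"]
              image_eqI[of _ _ "(?g ` Y1, Y2, Z, f1, f2)"]) auto
        moreover have "\<exists>f\<in>G. eqon (?g ` Y1) f f1 \<and> eqon Y2 f f2 \<and> f ` Z = Z"
        proof -
          have "f1 \<in> G" "f2 \<in> G" using f(1,2) SG by auto
          then show ?thesis using Z(2) f(3-5) unfolding amalgamates_def by simp
        qed
        from pick_ex[OF this] have "eqon (?g ` Y1) ?f f1 \<and> eqon Y2 ?f f2 \<and> ?f ` Z = Z"
          unfolding glue_def .
        ultimately show "\<exists>f\<in>S. eqon (?g ` Y1) f f1 \<and> eqon Y2 f f2 \<and> f ` Z = Z"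
          using stepS by (intro bexI)
      qed (use Z(2) in \<open>simp_all add: amalgamates_def\<close>)
      then show ?thesis using gS Z(1) by (intro bexI)
    qed
  qed
  moreover have "C \<subseteq> S" using TS[of 0] unfolding T0 by blast
  ultimately show ?thesis by blast
qed

text \<open>One element outside \<open>H\<close> for each of the countably many stabilisers is put
  into the hull \<open>S\<close>. This provides the assumption \<open>proper\<close> of
  \<open>small_index_family\<close>, which is inconsistent.\<close>

theorem small_index_stabiliser:
  assumes H_comp: "\<And>g h. g \<in> H \<Longrightarrow> h \<in> H \<Longrightarrow> g \<circ> h \<in> H" and H_inv: "\<And>g. g \<in> H \<Longrightarrow> inv g \<in> H"
    and H_G: "H \<subseteq> G"
    and few: "\<And>y :: nat set \<Rightarrow> 'a \<Rightarrow> 'a. (\<And>r. y r \<in> G) \<Longrightarrow> \<exists>a b. a \<noteq> b \<and> inv (y a) \<circ> y b \<in> H"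
  shows "\<exists>X\<in>XX. \<forall>g\<in>G. eqon X g id \<longrightarrow> g \<in> H"
proof (rule ccontr)
  assume neg: "\<not> ?thesis"
  have "\<forall>X\<in>XX. \<exists>c. c \<in> G \<and> eqon X c id \<and> c \<notin> H" using neg by (simp add: Bex_def Ball_def)
  then obtain c where c: "\<forall>X\<in>XX. c X \<in> G \<and> eqon X (c X) id \<and> c X \<notin> H"
    unfolding bchoice_iff by (elim exE)
  have "countable (c ` XX)" "c ` XX \<subseteq> G" using countable_XX c by auto
  from skolem_hull[OF this] obtain S where S: "c ` XX \<subseteq> S" "dense_family G XX S"
    by (elim exE conjE)
  interpret dense_family G XX S by (rule S(2))
  have "small_index_family G XX S H"
  proof unfold_locales
    show "\<exists>a b. a \<noteq> b \<and> inv (y a) \<circ> y b \<in> H" if "\<And>r. y r \<in> G" for y :: "nat set \<Rightarrow> 'a \<Rightarrow> 'a"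
      by (rule few[OF that])
    show "\<exists>d\<in>S. d \<notin> H \<and> eqon X d id" if X: "X \<in> XX" for X
      using bspec[OF c X] S(1) X by (intro bexI[of _ "c X"] conjI) auto
  qed (rule H_comp H_inv H_G | assumption)+
  then show False by (rule small_index_family.inconsistent)
qed

end

section \<open>Predimension and closure\<close>

lemma finite_edges: "finite A \<Longrightarrow> finite (edges R A)"
  by (rule finite_subset[of _ "Pow A"]) (auto simp: edges_def)

lemma edges_mono: "A \<subseteq> B \<Longrightarrow> edges R A \<subseteq> edges R B"
  by (auto simp: edges_def)

lemma edges_subset: "e \<in> edges R A \<Longrightarrow> e \<subseteq> A"
  by (auto simp: edges_def)

lemma edges_Int: "edges R (A \<inter> B) = edges R A \<inter> edges R B"
proof
  show "edges R A \<inter> edges R B \<subseteq> edges R (A \<inter> B)"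
  proof
    fix e assume e: "e \<in> edges R A \<inter> edges R B"
    then obtain x y where xy: "e = {x, y}" "R x y" by (auto simp: edges_def)
    have "e \<subseteq> A" "e \<subseteq> B" using e edges_subset by auto
    then show "e \<in> edges R (A \<inter> B)" using xy unfolding edges_def by blast
  qed
qed (simp add: edges_mono)

lemma card_edges_Un:
  assumes "finite A" "finite B"
  shows "int (card (edges R A)) + int (card (edges R B)) =
    int (card (edges R A \<union> edges R B)) + int (card (edges R (A \<inter> B)))"
  using card_Un_Int[of "edges R A" "edges R B"] assms
  by (simp add: finite_edges edges_Int flip: of_nat_add)

lemma weighted_card_Un:
  assumes "finite A" "finite B"
  shows "int m * int (card A) + int m * int (card B) = int m * int (card (A \<union> B)) + int m * int (card (A \<inter> B))"
  using card_Un_Int[OF assms] by (simp flip: distrib_left of_nat_add)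

text \<open>The vertex count is modular, and the union spans at least the edges of \<open>A\<close>
  and those of \<open>B\<close>.\<close>

lemma delta_submodular:
  assumes "finite A" "finite B"
  shows "delta m R (A \<union> B) + delta m R (A \<inter> B) \<le> delta m R A + delta m R B"
proof -
  have "card (edges R A \<union> edges R B) \<le> card (edges R (A \<union> B))"
    using assms by (intro card_mono finite_edges) (auto simp: edges_mono)
  then show ?thesis unfolding delta_def
    using card_edges_Un[OF assms, of R] weighted_card_Un[OF assms, of m] by linarith
qed

text \<open>An edge between the two differences would be counted in the union only and make the
  inequality of \<open>delta_submodular\<close> strict.\<close>

lemma delta_modular_no_edge:
  assumes fin: "finite A" "finite B"
    and eq: "delta m R A + delta m R B \<le> delta m R (A \<union> B) + delta m R (A \<inter> B)"
    and x: "x \<in> A - B" and y: "y \<in> B - A"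
  shows "\<not> R x y"
proof
  assume "R x y"
  then have e: "{x, y} \<in> edges R (A \<union> B)" using x y unfolding edges_def by blast
  have ne: "{x, y} \<notin> edges R A \<union> edges R B"
    using x y by (auto simp: edges_def doubleton_eq_iff)
  have "edges R A \<union> edges R B \<subseteq> edges R (A \<union> B)" by (simp add: edges_mono)
  then have "card (edges R A \<union> edges R B) < card (edges R (A \<union> B))"
    using e ne fin by (intro psubset_card_mono) (auto simp: finite_edges)
  then show False using eq unfolding delta_def
    using card_edges_Un[OF fin, of R] weighted_card_Un[OF fin, of m] by linarith
qed

lemma delta_modular:
  assumes fin: "finite A" "finite B"
    and no: "\<And>x y. x \<in> A - B \<Longrightarrow> y \<in> B - A \<Longrightarrow> \<not> R x y \<and> \<not> R y x"
  shows "delta m R (A \<union> B) + delta m R (A \<inter> B) = delta m R A + delta m R B"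
proof -
  have "edges R (A \<union> B) = edges R A \<union> edges R B"
  proof
    show "edges R (A \<union> B) \<subseteq> edges R A \<union> edges R B"
    proof
      fix e assume "e \<in> edges R (A \<union> B)"
      then obtain x y where e: "e = {x, y}" "x \<in> A \<union> B" "y \<in> A \<union> B" "R x y" by (auto simp: edges_def)
      then have "(x \<in> A \<and> y \<in> A) \<or> (x \<in> B \<and> y \<in> B)" using no by blast
      then show "e \<in> edges R A \<union> edges R B" using e unfolding edges_def by blast
    qed
  qed (simp add: edges_mono)
  then show ?thesis unfolding delta_def
    using card_edges_Un[OF fin, of R] weighted_card_Un[OF fin, of m] by simp
qed

lemma delta_iso:
  assumes "inj_on f A" and iso: "\<And>x y. x \<in> A \<Longrightarrow> y \<in> A \<Longrightarrow> R x y \<longleftrightarrow> R' (f x) (f y)"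
  shows "delta m R' (f ` A) = delta m R A"
proof -
  have "edges R' (f ` A) = (`) f ` edges R A"
  proof
    show "edges R' (f ` A) \<subseteq> (`) f ` edges R A"
    proof
      fix e assume "e \<in> edges R' (f ` A)"
      then obtain x y where "e = {f x, f y}" "x \<in> A" "y \<in> A" "R' (f x) (f y)"
        by (auto simp: edges_def)
      then have "e = f ` {x, y}" "{x, y} \<in> edges R A" using iso by (auto simp: edges_def)
      then show "e \<in> (`) f ` edges R A" by blast
    qed
    show "(`) f ` edges R A \<subseteq> edges R' (f ` A)" using iso by (fastforce simp: edges_def)
  qed
  moreover have "inj_on ((`) f) (edges R A)"
    by (rule inj_on_subset[OF inj_on_image_Pow[OF assms(1)]]) (auto simp: edges_def)
  ultimately show ?thesis using assms(1) by (simp add: delta_def card_image)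
qed

lemma delta_insert:
  assumes "is_graph R" "finite A" "x \<notin> A"
  shows "delta m R (insert x A) = delta m R A + int m - int (card {a \<in> A. R x a})"
proof -
  have "edges R (insert x A) = edges R A \<union> (\<lambda>a. {x, a}) ` {a \<in> A. R x a}"
    using assms(1) unfolding edges_def is_graph_def by blast
  moreover have "edges R A \<inter> (\<lambda>a. {x, a}) ` {a \<in> A. R x a} = {}"
    using assms(3) by (auto simp: edges_def doubleton_eq_iff)
  moreover have "inj_on (\<lambda>a. {x, a}) {a \<in> A. R x a}"
    by (auto simp: inj_on_def doubleton_eq_iff)
  ultimately have "card (edges R (insert x A)) = card (edges R A) + card {a \<in> A. R x a}"
    using assms(2) by (simp add: card_Un_disjoint finite_edges card_image)
  then show ?thesis using assms(2,3) by (simp add: delta_def algebra_simps)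
qed

locale generic_graph =
  fixes m :: nat and E :: "'a \<Rightarrow> 'a \<Rightarrow> bool"
  assumes generic: "is_generic m E"
begin

abbreviation \<delta> :: "'a set \<Rightarrow> int" where "\<delta> \<equiv> delta m E"
abbreviation d :: "'a set \<Rightarrow> int" where "d \<equiv> dd m E"
abbreviation clo :: "'a set \<Rightarrow> 'a set" where "clo \<equiv> cl m E"
abbreviation gc :: "'a set \<Rightarrow> 'a set" where "gc \<equiv> gcl m E"

text \<open>For infinite sets this replaces \<open>closed_in\<close>, which is vacuous there.\<close>

definition sclosed :: "'a set \<Rightarrow> bool" where
  "sclosed Y \<longleftrightarrow> (\<forall>B. finite B \<longrightarrow> \<delta> (B \<inter> Y) \<le> \<delta> B)"

lemma graph: "is_graph E"
  using generic by (simp add: is_generic_def)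

lemma E_sym: "E x y \<longleftrightarrow> E y x"
  using graph unfolding is_graph_def by blast

lemma delta_nonneg: "finite A \<Longrightarrow> 0 \<le> \<delta> A"
  using generic by (simp add: is_generic_def in_K0_def)

lemma sclosed_subset: "sclosed A \<Longrightarrow> finite B \<Longrightarrow> A \<subseteq> B \<Longrightarrow> \<delta> A \<le> \<delta> B"
  by (metis inf.absorb_iff2 sclosed_def)

text \<open>By submodularity an arbitrary test set \<open>B\<close> may be replaced by
  \<open>A \<union> B\<close>.\<close>

lemma sclosedI:
  assumes "finite A" "\<And>B. finite B \<Longrightarrow> A \<subseteq> B \<Longrightarrow> \<delta> A \<le> \<delta> B"
  shows "sclosed A"
  unfolding sclosed_def
proof (intro allI impI)
  fix B :: "'a set" assume B: "finite B"
  have "\<delta> (A \<union> B) + \<delta> (A \<inter> B) \<le> \<delta> A + \<delta> B" using assms(1) B by (rule delta_submodular)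
  moreover have "\<delta> A \<le> \<delta> (A \<union> B)" using assms B by simp
  ultimately show "\<delta> (B \<inter> A) \<le> \<delta> B" by (simp add: Int_commute)
qed

lemma closed_in_iff_sclosed: "finite A \<Longrightarrow> closed_in m E A UNIV \<longleftrightarrow> sclosed A"
proof
  assume A: "finite A" and "closed_in m E A UNIV"
  then show "sclosed A" by (intro sclosedI) (auto simp: closed_in_def fin_closed_def)
next
  assume A: "finite A" and "sclosed A"
  then show "closed_in m E A UNIV"
    using sclosed_subset by (auto simp: closed_in_def fin_closed_def dest: finite_subset)
qed

lemma sclosed_Int: "sclosed A \<Longrightarrow> sclosed B \<Longrightarrow> sclosed (A \<inter> B)"
  unfolding sclosed_def
proof (intro allI impI)
  fix C :: "'a set"
  assume A: "\<forall>B. finite B \<longrightarrow> \<delta> (B \<inter> A) \<le> \<delta> B" and B: "\<forall>C. finite C \<longrightarrow> \<delta> (C \<inter> B) \<le> \<delta> C"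
    and C: "finite C"
  have "\<delta> (C \<inter> A \<inter> B) \<le> \<delta> (C \<inter> A)" "\<delta> (C \<inter> A) \<le> \<delta> C" using A B C by auto
  then show "\<delta> (C \<inter> (A \<inter> B)) \<le> \<delta> C" by (simp add: Int_assoc)
qed

text \<open>Every finite superset of \<open>B\<close> is one of \<open>A\<close>, so its
  predimension is at least that of \<open>A\<close> and hence at least that of
  \<open>B\<close>.\<close>

lemma sclosed_Un:
  assumes "sclosed A" "finite A" "A \<subseteq> B" "finite B" "\<delta> B \<le> \<delta> A"
  shows "sclosed B"
proof (rule sclosedI[OF assms(4)])
  fix C assume "finite C" "B \<subseteq> C"
  then have "\<delta> A \<le> \<delta> C" using assms by (intro sclosed_subset) auto
  then show "\<delta> B \<le> \<delta> C" using assms(5) by simp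
qed

lemma ex_sclosed: "finite A \<Longrightarrow> \<exists>B. finite B \<and> A \<subseteq> B \<and> sclosed B"
proof -
  assume A: "finite A"
  from generic have "\<exists>C :: nat \<Rightarrow> 'a set. (\<forall>n. finite (C n) \<and> closed_in m E (C n) UNIV \<and> C n \<subseteq> C (Suc n))
      \<and> (\<Union>n. C n) = UNIV" unfolding is_generic_def by (elim conjE)
  then obtain C :: "nat \<Rightarrow> 'a set" where C: "\<And>n. finite (C n)" "\<And>n. closed_in m E (C n) UNIV"
      "\<And>n. C n \<subseteq> C (Suc n)" "(\<Union>n. C n) = UNIV"
    by blast
  have mono: "C n \<subseteq> C k" if "n \<le> k" for n k using C(3) that by (rule lift_Suc_mono_le)
  have "\<exists>n. A \<subseteq> C n" using A
  proof (induction rule: finite_induct)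
    case (insert x A)
    then obtain n where n: "A \<subseteq> C n" by blast
    obtain k where k: "x \<in> C k" using C(4) by blast
    have "insert x A \<subseteq> C (max n k)" using n k mono[of n "max n k"] mono[of k "max n k"] by auto
    then show ?case by blast
  qed auto
  then show ?thesis using C(1,2) closed_in_iff_sclosed by blast
qed

text \<open>Closed sets are stable under intersection, so a finite closed superset of least
  cardinality is contained in all others. The intersection that defines \<open>cl\<close> is
  therefore attained.\<close>

lemma clo_props:
  assumes A: "finite A"
  shows finite_clo: "finite (clo A)" and subset_clo: "A \<subseteq> clo A" and sclosed_clo: "sclosed (clo A)"
    and clo_least: "\<And>B. finite B \<Longrightarrow> A \<subseteq> B \<Longrightarrow> sclosed B \<Longrightarrow> clo A \<subseteq> B"
proof -
  let ?P = "\<lambda>B. finite B \<and> A \<subseteq> B \<and> sclosed B"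
  obtain B1 where "?P B1" using ex_sclosed[OF A] by blast
  from ex_has_least_nat[of ?P, OF this, of card]
  obtain B0 where B0: "?P B0" "\<And>B. ?P B \<Longrightarrow> card B0 \<le> card B" by blast
  have least: "B0 \<subseteq> B" if "?P B" for B
  proof -
    have "?P (B0 \<inter> B)" using B0(1) that sclosed_Int by auto
    then have "card B0 \<le> card (B0 \<inter> B)" by (rule B0(2))
    then have "B0 \<inter> B = B0" using B0(1) by (intro card_seteq) auto
    then show ?thesis by blast
  qed
  have eq: "clo A = B0"
  proof
    show "clo A \<subseteq> B0" unfolding cl_def using B0(1) closed_in_iff_sclosed by blast
    show "B0 \<subseteq> clo A" unfolding cl_def using least closed_in_iff_sclosed by blast
  qed
  show "finite (clo A)" "A \<subseteq> clo A" "sclosed (clo A)" unfolding eq using B0(1) by auto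
  show "clo A \<subseteq> B" if "finite B" "A \<subseteq> B" "sclosed B" for B unfolding eq using least that by blast
qed

text \<open>A finite superset of least predimension is closed and so contains \<open>clo A\<close>;
  it exists because predimensions are nonnegative. Hence the dimension is the minimum of the
  predimension over all finite supersets.\<close>

lemma d_le: assumes "finite B" "A \<subseteq> B" shows "d A \<le> \<delta> B"
proof -
  have A: "finite A" using assms by (rule rev_finite_subset)
  let ?P = "\<lambda>B. finite B \<and> A \<subseteq> B"
  obtain B0 where B0: "?P B0" "\<And>B. ?P B \<Longrightarrow> nat (\<delta> B0) \<le> nat (\<delta> B)"
    using ex_has_least_nat[of ?P B "\<lambda>B. nat (\<delta> B)"] assms by blast
  have le: "\<delta> B0 \<le> \<delta> B" if "?P B" for B
    using B0(2)[OF that] that delta_nonneg[of B] by (simp add: nat_le_eq_zle)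
  then have "sclosed B0" using B0(1) by (intro sclosedI) auto
  then have "clo A \<subseteq> B0" using clo_least[OF A] B0(1) by blast
  then have "d A \<le> \<delta> B0" unfolding dd_def using B0(1) sclosed_clo[OF A] sclosed_subset by blast
  then show ?thesis using le assms by fastforce
qed

lemma d_mono: "finite B \<Longrightarrow> A \<subseteq> B \<Longrightarrow> d A \<le> d B"
  unfolding dd_def[of m E B] using subset_clo[of B] finite_clo[of B] by (intro d_le) auto

lemma d_sclosed: "finite A \<Longrightarrow> sclosed A \<Longrightarrow> d A = \<delta> A"
  using clo_least[of A A] subset_clo[of A] by (simp add: dd_def subset_antisym)

lemma sclosed_if_d: "finite A \<Longrightarrow> \<delta> A \<le> d A \<Longrightarrow> sclosed A"
  by (intro sclosedI) (auto intro: order_trans d_le)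

lemma d_submodular:
  assumes "finite A" "finite B" shows "d (A \<union> B) + d (A \<inter> B) \<le> d A + d B"
proof -
  have "d (A \<union> B) \<le> \<delta> (clo A \<union> clo B)" "d (A \<inter> B) \<le> \<delta> (clo A \<inter> clo B)"
    using clo_props(1,2)[OF assms(1)] clo_props(1,2)[OF assms(2)] by (auto intro!: d_le)
  then show ?thesis
    using delta_submodular[OF finite_clo finite_clo, OF assms, of m E] unfolding dd_def by linarith
qed

section \<open>The geometric closure of a finite set\<close>

lemma gcl_step:
  assumes "finite B" "A \<subseteq> B" "d (insert x A) = d A"
  shows "d (insert x B) = d B"
proof (cases "x \<in> B")
  case False
  have A: "finite A" using assms by (blast intro: finite_subset)
  have "B \<union> insert x A = insert x B" "B \<inter> insert x A = A" using assms(2) False by auto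
  then have "d (insert x B) + d A \<le> d B + d (insert x A)"
    using d_submodular[of B "insert x A"] assms(1) A by simp
  moreover have "d B \<le> d (insert x B)" using assms(1) by (intro d_mono) auto
  ultimately show ?thesis using assms(3) by linarith
qed (simp add: insert_absorb)

lemma gcl_iff:
  assumes "finite A" shows "x \<in> gc A \<longleftrightarrow> d (insert x A) = d A"
proof
  assume "x \<in> gc A"
  then obtain B where B: "B \<subseteq> A" "d (insert x B) = d B" by (auto simp: gcl_def dd_rel_def)
  show "d (insert x A) = d A" by (rule gcl_step[OF assms B])
next
  assume "d (insert x A) = d A"
  then show "x \<in> gc A" using assms by (auto simp: gcl_def dd_rel_def)
qed

lemma subset_gcl: "finite A \<Longrightarrow> A \<subseteq> gc A"
  by (auto simp: gcl_iff insert_absorb)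

lemma d_gcl:
  assumes "finite A" "finite F" "F \<subseteq> gc A" shows "d (A \<union> F) = d A"
  using assms(2,3)
proof (induction rule: finite_induct)
  case (insert x F)
  have "d (insert x A) = d A" using insert.prems gcl_iff[OF assms(1)] by simp
  then have "d (insert x (A \<union> F)) = d (A \<union> F)" 
    by (rule gcl_step[rotated 2]) (use assms(1) insert.hyps in auto)
  then show ?case using insert by simp
qed simp

lemma gclI: "finite A \<Longrightarrow> finite B \<Longrightarrow> A \<subseteq> B \<Longrightarrow> \<delta> B \<le> d A \<Longrightarrow> B \<subseteq> gc A"
proof
  fix x assume "finite A" "finite B" "A \<subseteq> B" "\<delta> B \<le> d A" "x \<in> B"
  then have "d (insert x A) \<le> d A" using d_le[of B "insert x A"] by auto
  moreover have "d A \<le> d (insert x A)" using \<open>finite A\<close> by (intro d_mono) auto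
  ultimately show "x \<in> gc A" using \<open>finite A\<close> by (simp add: gcl_iff)
qed

lemma clo_gcl: "finite A \<Longrightarrow> finite F \<Longrightarrow> F \<subseteq> gc A \<Longrightarrow> clo (A \<union> F) \<subseteq> gc A"
  using clo_props(1,2)[of "A \<union> F"] d_gcl[of A F] by (intro gclI) (auto simp: dd_def)

lemma d_clo_gcl: "finite A \<Longrightarrow> finite F \<Longrightarrow> F \<subseteq> gc A \<Longrightarrow> \<delta> (clo (A \<union> F)) = d A"
  using d_gcl[of A F] by (simp add: dd_def)

text \<open>The overlap of \<open>C\<close> with \<open>gc A\<close> is enlarged to a finite closed
  \<open>F\<close> inside \<open>gc A\<close> that contains \<open>A\<close>. Adding
  \<open>C\<close> to \<open>F\<close> does not raise the predimension, so \<open>C\<close> is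
  absorbed.\<close>

lemma gcl_absorb:
  assumes A: "finite A" and C: "finite C" "\<delta> C \<le> \<delta> (C \<inter> gc A)"
  shows "C \<subseteq> gc A"
proof -
  define F where "F = clo (A \<union> C \<inter> gc A)"
  have F: "finite F" "A \<union> C \<inter> gc A \<subseteq> F" "F \<subseteq> gc A" "\<delta> F = d A"
    unfolding F_def using A C clo_props(1,2)[of "A \<union> C \<inter> gc A"] clo_gcl[of A "C \<inter> gc A"] d_clo_gcl[of A "C \<inter> gc A"]
    by auto
  have "C \<inter> F = C \<inter> gc A" using F by blast
  then have "\<delta> (C \<union> F) \<le> d A" using delta_submodular[OF C(1) F(1), of m E] C(2) F(4) by simp
  then have "C \<union> F \<subseteq> gc A" using A C(1) F by (intro gclI) auto
  then show ?thesis by blast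
qed

text \<open>A finite set violating closedness would be absorbed into \<open>gc A\<close> by
  \<open>gcl_absorb\<close>, and a subset of \<open>gc A\<close> violates nothing.\<close>

lemma sclosed_gcl: assumes A: "finite A" shows "sclosed (gc A)"
  unfolding sclosed_def
proof (intro allI impI, rule ccontr)
  fix B :: "'a set" assume B: "finite B" and "\<not> \<delta> (B \<inter> gc A) \<le> \<delta> B"
  then have lt: "\<delta> B < \<delta> (B \<inter> gc A)" by simp
  then have "B \<subseteq> gc A" using gcl_absorb[OF A B] by simp
  then show False using lt by (simp add: Int_absorb2)
qed

lemma gcl_subset:
  assumes A: "finite A" and B: "finite B" and sub: "A \<subseteq> gc B"
  shows "gc A \<subseteq> gc B"
proof
  fix x assume "x \<in> gc A"
  then have "d (insert x A) = d A" using A by (simp add: gcl_iff)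
  then have "d (insert x (A \<union> B)) = d (A \<union> B)" 
    by (rule gcl_step[rotated 2]) (use A B in auto)
  also have "\<dots> = d B" using d_gcl[OF B A sub] by (simp add: Un_commute)
  finally have "d (insert x B) \<le> d B" using d_mono[of "insert x (A \<union> B)" "insert x B"] A B by auto
  moreover have "d B \<le> d (insert x B)" using B by (intro d_mono) auto
  ultimately show "x \<in> gc B" using B by (simp add: gcl_iff)
qed

lemma gcl_mono: "finite B \<Longrightarrow> A \<subseteq> B \<Longrightarrow> gc A \<subseteq> gc B"
  by (intro gcl_subset) (auto dest: finite_subset subsetD[OF subset_gcl])

lemma d_gcl_mono: "finite A \<Longrightarrow> finite B \<Longrightarrow> A \<subseteq> gc B \<Longrightarrow> d A \<le> d B"
  using d_gcl[of B A] d_mono[of "B \<union> A" A] by auto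

lemma gcl_eqI:
  assumes "finite A" "finite B" "gc A \<subseteq> gc B" "d B \<le> d A"
  shows "gc A = gc B"
proof -
  have AB: "A \<subseteq> gc B" using assms subset_gcl by blast
  have "clo (A \<union> B) \<subseteq> gc A"
  proof (rule gclI)
    have "d (A \<union> B) = d B" using d_gcl[of B A] assms AB by (simp add: Un_commute)
    then show "\<delta> (clo (A \<union> B)) \<le> d A" using assms(4) by (simp add: dd_def)
  qed (use assms clo_props[of "A \<union> B"] in auto)
  then have "B \<subseteq> gc A" using subset_clo[of "A \<union> B"] assms(1,2) by blast
  then show ?thesis using assms gcl_subset by blast
qed

end

section \<open>Extending partial isomorphisms\<close>

definition iso_on :: "('a \<Rightarrow> 'a \<Rightarrow> bool) \<Rightarrow> ('a \<Rightarrow> 'a) \<Rightarrow> 'a set \<Rightarrow> bool" where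
  "iso_on E t D \<longleftrightarrow> inj_on t D \<and> (\<forall>x\<in>D. \<forall>y\<in>D. E x y \<longleftrightarrow> E (t x) (t y))"

lemma iso_on_subset: "iso_on E t D \<Longrightarrow> A \<subseteq> D \<Longrightarrow> iso_on E t A"
  unfolding iso_on_def by (auto intro: inj_on_subset)

lemma iso_on_cong:
  assumes "iso_on E t D" "eqon D t' t" shows "iso_on E t' D"
proof -
  have "inj_on t' D" using assms inj_on_cong[of D t' t] by (simp add: iso_on_def)
  then show ?thesis using assms by (simp add: iso_on_def)
qed

lemma iso_on_Un:
  assumes "iso_on E t Y" "iso_on E t B"
    and cross: "\<And>y b. y \<in> Y - B \<Longrightarrow> b \<in> B - Y \<Longrightarrow>
      \<not> E y b \<and> \<not> E b y \<and> \<not> E (t y) (t b) \<and> \<not> E (t b) (t y) \<and> t y \<noteq> t b"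
  shows "iso_on E t (Y \<union> B)"
proof -
  have "(E z z' \<longleftrightarrow> E (t z) (t z')) \<and> (t z = t z' \<longrightarrow> z = z')" if z: "z \<in> Y \<union> B" "z' \<in> Y \<union> B" for z z'
  proof -
    consider "z \<in> Y" "z' \<in> Y" | "z \<in> B" "z' \<in> B" | "z \<in> Y - B" "z' \<in> B - Y" | "z' \<in> Y - B" "z \<in> B - Y"
      using z by blast
    then show ?thesis
    proof cases
      case 1
      then show ?thesis using assms(1) by (simp add: iso_on_def inj_on_def)
    next
      case 2
      then show ?thesis using assms(2) by (simp add: iso_on_def inj_on_def)
    next
      case 3
      then show ?thesis using cross[OF 3] by simp
    next
      case 4
      then show ?thesis using cross[OF 4] by auto
    qed
  qed
  then show ?thesis unfolding iso_on_def inj_on_def by blast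
qed

lemma iso_on_inv_into:
  assumes "iso_on E t D"
  shows "iso_on E (inv_into D t) (t ` D)"
  using assms by (auto simp: iso_on_def inj_on_inv_into)

lemma Aut_iff: "g \<in> Aut E \<longleftrightarrow> bij g \<and> iso_on E g UNIV"
  by (auto simp: Aut_def iso_on_def bij_def)

lemma Aut_E: "g \<in> Aut E \<Longrightarrow> E (g x) (g y) \<longleftrightarrow> E x y"
  by (simp add: Aut_def)

lemma Aut_id: "id \<in> Aut E"
  by (simp add: Aut_def)

lemma Aut_comp: "g \<in> Aut E \<Longrightarrow> h \<in> Aut E \<Longrightarrow> g \<circ> h \<in> Aut E"
  by (simp add: Aut_def bij_comp)

lemma Aut_bij: "g \<in> Aut E \<Longrightarrow> bij g"
  by (simp add: Aut_def)

lemma Aut_inv_simps: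
  assumes "g \<in> Aut E"
  shows "inv g (g x) = x" "g (inv g x) = x" "g x = g y \<longleftrightarrow> x = y" "inv g ` g ` X = X" "g ` inv g ` X = X"
proof -
  show 1: "inv g (g x) = x" "g (inv g x) = x" "g x = g y \<longleftrightarrow> x = y" for x y
    using Aut_bij[OF assms] by (auto simp: bij_is_inj bij_is_surj surj_f_inv_f inj_eq)
  show "inv g ` g ` X = X" "g ` inv g ` X = X" using 1 by (auto simp: image_iff)
qed

lemma Aut_inv:
  assumes "g \<in> Aut E" shows "inv g \<in> Aut E"
proof -
  have "E x y \<longleftrightarrow> E (inv g x) (inv g y)" for x y
    using Aut_E[OF assms, of "inv g x" "inv g y"] Aut_inv_simps(2)[OF assms] by simp
  then show ?thesis using Aut_bij[OF assms] by (simp add: Aut_def bij_imp_bij_inv)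
qed

lemma Aut_closed:
  assumes "bij g" "\<And>F. finite F \<Longrightarrow> \<exists>h\<in>Aut E. eqon F g h"
  shows "g \<in> Aut E"
proof -
  have "E x y \<longleftrightarrow> E (g x) (g y)" for x y
  proof -
    obtain h where "h \<in> Aut E" "eqon {x, y} g h" using assms(2)[of "{x, y}"] by auto
    then show ?thesis using Aut_E[of h E x y] by simp
  qed
  then show ?thesis using assms(1) by (simp add: Aut_def)
qed

text \<open>The predicate \<open>P\<close> carries the admissibility of a partial map, so the
  argument also covers maps whose domain contains a fixed infinite set.\<close>

lemma back_and_forth:
  assumes countable: "countable (UNIV :: 'a set)"
    and start: "P t0 D0"
    and iso: "\<And>t D. P t D \<Longrightarrow> iso_on E t D"
    and forward: "\<And>t D x. P t D \<Longrightarrow> \<exists>t' D'. P t' D' \<and> D \<subseteq> D' \<and> (x::'a) \<in> D' \<and> eqon D t' t"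
    and backward: "\<And>t D x. P t D \<Longrightarrow> \<exists>t' D'. P t' D' \<and> D \<subseteq> D' \<and> x \<in> t' ` D' \<and> eqon D t' t"
  shows "\<exists>g\<in>Aut E. eqon D0 g t0"
proof -
  obtain e :: "nat \<Rightarrow> 'a" where e: "range e = UNIV"
    using countable by (metis UNIV_not_empty range_from_nat_into)
  define Q where "Q n s \<longleftrightarrow> P (fst s) (snd s) \<and> e n \<in> snd s \<and> e n \<in> fst s ` snd s \<and> D0 \<subseteq> snd s \<and> eqon D0 (fst s) t0"
    for n and s :: "('a \<Rightarrow> 'a) \<times> 'a set"
  define R where "R s s' \<longleftrightarrow> snd s \<subseteq> snd s' \<and> eqon (snd s) (fst s') (fst s)"
    for s s' :: "('a \<Rightarrow> 'a) \<times> 'a set"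
  have step: "\<exists>s'. Q n s' \<and> R (t, D) s'" if t: "P t D" "D0 \<subseteq> D" "eqon D0 t t0" for n t D
  proof -
    \<comment> \<open>Here \<open>has_invariant\<close> and \<open>has_realisation\<close> are local
      names for the domains after the forward and after the backward step; they have nothing to do
      with the sets of permutations called so above.\<close>
    obtain t1 has_invariant where 1: "P t1 has_invariant" "D \<subseteq> has_invariant" "e n \<in> has_invariant" "eqon D t1 t"
      using forward[OF t(1), of "e n"] by (elim exE conjE)
    obtain t2 has_realisation where 2: "P t2 has_realisation" "has_invariant \<subseteq> has_realisation" "e n \<in> t2 ` has_realisation" "eqon has_invariant t2 t1"
      using backward[OF 1(1), of "e n"] by (elim exE conjE)
    have "eqon D t2 t" using 1(2,4) 2(4) by (simp add: subset_iff)
    moreover from this have "eqon D0 t2 t0" using t(2,3) by (simp add: subset_iff)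
    ultimately have "Q n (t2, has_realisation)" "R (t, D) (t2, has_realisation)"
      using 1 2 t unfolding Q_def R_def by auto
    then show ?thesis by blast
  qed
  have "\<exists>f. \<forall>n. Q n (f n) \<and> R (f n) (f (Suc n))"
  proof (rule dependent_nat_choice)
    have "\<exists>s'. Q 0 s' \<and> R (t0, D0) s'" by (rule step) (use start in auto)
    then show "\<exists>s. Q 0 s" by blast
    show "\<exists>s'. Q (Suc n) s' \<and> R s s'" if "Q n s" for s n
    proof -
      have "\<exists>s'. Q (Suc n) s' \<and> R (fst s, snd s) s'" by (rule step) (use that in \<open>simp_all add: Q_def\<close>)
      then show ?thesis by simp
    qed
  qed
  then obtain f where f: "\<And>n. Q n (f n)" "\<And>n. R (f n) (f (Suc n))" by blast
  define t where "t n = fst (f n)" for n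
  define D where "D n = snd (f n)" for n
  have D_Suc: "D n \<subseteq> D (Suc n)" and t_Suc: "eqon (D n) (t (Suc n)) (t n)" for n
    using f(2)[of n] by (simp_all add: R_def t_def D_def)
  have D_mono: "D n \<subseteq> D k" if "n \<le> k" for n k using D_Suc that by (rule lift_Suc_mono_le)
  have t_iso: "iso_on E (t n) (D n)" for n using f(1)[of n] iso by (simp add: Q_def t_def D_def)
  obtain g where "\<forall>n. eqon (D n) g (t n)" using chain_limit[of D t, OF D_Suc t_Suc] by (elim exE)
  then have g: "g x = t n x" if "x \<in> D n" for n x using that by blast
  have cover: "\<exists>n. x \<in> D n" and cover': "\<exists>n. x \<in> t n ` D n" for x
  proof -
    obtain n where "x = e n" using e by (metis UNIV_I imageE)
    then show "\<exists>n. x \<in> D n" "\<exists>n. x \<in> t n ` D n" using f(1)[of n] by (auto simp: Q_def t_def D_def)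
  qed
  have cover2: "\<exists>n. x \<in> D n \<and> y \<in> D n" for x y
  proof -
    obtain n k where "x \<in> D n" "y \<in> D k" using cover by blast
    then show ?thesis using D_mono[of n "max n k"] D_mono[of k "max n k"] by auto
  qed
  have "iso_on E g UNIV"
    unfolding iso_on_def
  proof (intro conjI ballI inj_onI)
    fix x y
    obtain n where n: "x \<in> D n" "y \<in> D n" using cover2 by blast
    show "E x y \<longleftrightarrow> E (g x) (g y)" using t_iso[of n] n g by (simp add: iso_on_def)
    show "x = y" if "g x = g y"
      using t_iso[of n] n that g[of x n] g[of y n] by (simp add: iso_on_def inj_on_def)
  qed
  moreover have "surj g"
    unfolding surj_def
  proof
    fix y
    obtain n x where "x \<in> D n" "y = t n x" using cover'[of y] by blast
    then show "\<exists>x. y = g x" using g[of x n] by (intro exI[of _ x]) simp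
  qed
  ultimately have "g \<in> Aut E" by (auto simp: Aut_iff iso_on_def bij_def)
  moreover have "eqon D0 g t0"
    using f(1)[of 0] g[of _ 0] unfolding Q_def t_def D_def by (simp add: subset_iff)
  ultimately show ?thesis by blast
qed

context generic_graph
begin

lemma delta_iso_on: "iso_on E t A \<Longrightarrow> \<delta> (t ` A) = \<delta> A"
  by (rule delta_iso) (auto simp: iso_on_def)

lemma Aut_iso_on: "g \<in> Aut E \<Longrightarrow> iso_on E g A"
  using iso_on_subset[of E g UNIV A] by (simp add: Aut_iff)

lemma delta_Aut: "g \<in> Aut E \<Longrightarrow> \<delta> (g ` A) = \<delta> A"
  by (simp add: Aut_iso_on delta_iso_on)

lemma sclosed_Aut:
  assumes g: "g \<in> Aut E" and Y: "sclosed Y"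
  shows "sclosed (g ` Y)"
  unfolding sclosed_def
proof (intro allI impI)
  fix B :: "'a set" assume B: "finite B"
  have "inv g ` (B \<inter> g ` Y) = inv g ` B \<inter> inv g ` g ` Y"
    using bij_is_inj[OF Aut_bij[OF Aut_inv[OF g]]] by (rule image_Int)
  then have "inv g ` (B \<inter> g ` Y) = inv g ` B \<inter> Y" using Aut_inv_simps(4)[OF g] by simp
  then have "\<delta> (B \<inter> g ` Y) = \<delta> (inv g ` B \<inter> Y)" using delta_Aut[OF Aut_inv[OF g]] by metis
  also have "\<dots> \<le> \<delta> (inv g ` B)" using Y B by (simp add: sclosed_def)
  also have "\<dots> = \<delta> B" using delta_Aut[OF Aut_inv[OF g]] .
  finally show "\<delta> (B \<inter> g ` Y) \<le> \<delta> B" .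
qed

text \<open>Being closed, \<open>Y\<close> contains \<open>clo A\<close>, whose image under
  \<open>t\<close> is a superset of the image of \<open>A\<close> and has predimension
  \<open>d A\<close>.\<close>

lemma d_iso_le:
  assumes Y: "sclosed Y" and t: "iso_on E t Y" and A: "finite A" "A \<subseteq> Y"
  shows "d (t ` A) \<le> d A"
proof -
  have "clo A \<subseteq> clo A \<inter> Y"
    using clo_props[OF A(1)] Y A(2) by (intro clo_least[OF A(1)] sclosed_Int) auto
  then have "iso_on E t (clo A)" using t by (auto intro: iso_on_subset)
  then have "\<delta> (t ` clo A) = d A" by (simp add: delta_iso_on dd_def)
  moreover have "d (t ` A) \<le> \<delta> (t ` clo A)" using clo_props(1,2)[OF A(1)] by (intro d_le) auto
  ultimately show ?thesis by simp
qed

lemma d_iso: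
  assumes Y: "sclosed Y" and t: "iso_on E t Y" "t ` Y = Y" and A: "finite A" "A \<subseteq> Y"
  shows "d (t ` A) = d A"
proof (rule antisym)
  show "d (t ` A) \<le> d A" using Y t(1) A by (rule d_iso_le)
  have "iso_on E (inv_into Y t) Y" using iso_on_inv_into[OF t(1)] t(2) by simp
  then have "d (inv_into Y t ` t ` A) \<le> d (t ` A)" using Y A t(2) by (intro d_iso_le) auto
  moreover have "inv_into Y t ` t ` A = A" using t(1) A(2) by (simp add: inv_into_image_cancel iso_on_def)
  ultimately show "d A \<le> d (t ` A)" by simp
qed

lemma sclosed_UNIV: "sclosed UNIV"
  by (simp add: sclosed_def)

lemma d_Aut: "g \<in> Aut E \<Longrightarrow> finite A \<Longrightarrow> d (g ` A) = d A"
  by (rule d_iso[OF sclosed_UNIV]) (auto simp: Aut_iff bij_is_surj)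

lemma gcl_Aut_subset:
  assumes g: "g \<in> Aut E" and A: "finite A"
  shows "g ` gc A \<subseteq> gc (g ` A)"
proof
  fix y assume "y \<in> g ` gc A"
  then obtain x where x: "x \<in> gc A" "y = g x" by blast
  then have "d (insert x A) = d A" using A by (simp add: gcl_iff)
  then have "d (g ` insert x A) = d (g ` A)" using d_Aut[OF g, of A] d_Aut[OF g, of "insert x A"] A by simp
  then show "y \<in> gc (g ` A)" using A x by (simp add: gcl_iff)
qed

lemma gcl_Aut:
  assumes g: "g \<in> Aut E" and A: "finite A"
  shows "g ` gc A = gc (g ` A)"
proof
  show "g ` gc A \<subseteq> gc (g ` A)" using g A by (rule gcl_Aut_subset)
  have "inv g ` gc (g ` A) \<subseteq> gc (inv g ` g ` A)" using Aut_inv[OF g] A by (intro gcl_Aut_subset) auto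
  then have "g ` inv g ` gc (g ` A) \<subseteq> g ` gc A" using Aut_inv_simps(4)[OF g] by (metis image_mono)
  then show "gc (g ` A) \<subseteq> g ` gc A" using Aut_inv_simps(5)[OF g] by simp
qed

section \<open>Homogeneity over infinite closed sets\<close>

lemma homogeneous:
  assumes "finite A" "sclosed A" "sclosed (t ` A)" "iso_on E t A"
  shows "\<exists>g\<in>Aut E. eqon A g t"
proof -
  have hom: "\<forall>A B f. finite A \<and> finite B \<and> closed_in m E A UNIV \<and> closed_in m E B UNIV \<and>
        bij_betw f A B \<and> (\<forall>x\<in>A. \<forall>y\<in>A. E x y \<longleftrightarrow> E (f x) (f y)) \<longrightarrow> (\<exists>g\<in>Aut E. \<forall>x\<in>A. g x = f x)"
    using generic unfolding is_generic_def by (elim conjE)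
  show ?thesis
    by (rule hom[rule_format, of A "t ` A" t])
      (use assms in \<open>simp add: closed_in_iff_sclosed iso_on_def bij_betw_def\<close>)
qed

text \<open>\<open>Y\<close> is a closed, usually infinite set of finite dimension, and the finite
  subset \<open>F\<close> already has the full dimension. This covers closures \<open>gc A\<close>
  and also the union of two closures in free position, which need not be a closure.\<close>

definition gens :: "'a set \<Rightarrow> 'a set \<Rightarrow> bool" where
  "gens Y F \<longleftrightarrow> sclosed Y \<and> finite F \<and> F \<subseteq> Y \<and> (\<forall>F'. finite F' \<longrightarrow> F' \<subseteq> Y \<longrightarrow> d (F \<union> F') = d F)"

lemma gens_gcl: "finite A \<Longrightarrow> gens (gc A) A"
  by (simp add: gens_def sclosed_gcl subset_gcl d_gcl)

lemma gens_delta: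
  assumes "gens Y F0" "finite F" "sclosed F" "F0 \<subseteq> F" "F \<subseteq> Y"
  shows "\<delta> F = d F0"
  using assms d_sclosed[of F] unfolding gens_def by (metis sup.absorb2)

text \<open>\<open>F\<close> and \<open>B \<inter> F\<close> are closed sets between the generators
  and \<open>Y\<close>, so both have predimension \<open>d F0\<close>. Submodularity then leaves no
  increase from \<open>B\<close> to \<open>B \<union> F\<close>, and equality excludes
  edges.\<close>

lemma gens_union:
  assumes Y: "gens Y F0" and B: "finite B" "sclosed B" "F0 \<subseteq> B"
    and F: "finite F" "sclosed F" "B \<inter> Y \<subseteq> F" "F \<subseteq> Y"
  shows "\<delta> (B \<union> F) = \<delta> B" "sclosed (B \<union> F)" "\<And>x y. x \<in> B - F \<Longrightarrow> y \<in> F - B \<Longrightarrow> \<not> E x y"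
proof -
  have Y': "sclosed Y" "F0 \<subseteq> Y" using Y by (auto simp: gens_def)
  have BF: "B \<inter> F = B \<inter> Y" using F by blast
  have "\<delta> F = d F0" using Y F B Y'(2) by (intro gens_delta) auto
  moreover have "\<delta> (B \<inter> Y) = d F0" using Y B Y' by (intro gens_delta) (auto intro: sclosed_Int)
  ultimately have eq: "\<delta> F = \<delta> (B \<inter> F)" using BF by simp
  then have le: "\<delta> (B \<union> F) \<le> \<delta> B" using delta_submodular[OF B(1) F(1), of m E] by simp
  moreover have ge: "\<delta> B \<le> \<delta> (B \<union> F)" using B F by (intro sclosed_subset) auto
  ultimately show "\<delta> (B \<union> F) = \<delta> B" by simp
  show "sclosed (B \<union> F)" by (rule sclosed_Un[of B]) (use B F le in auto)
  show "\<not> E x y" if "x \<in> B - F" "y \<in> F - B" for x y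
    by (rule delta_modular_no_edge[OF B(1) F(1) _ that, where m = m]) (use ge eq in simp)
qed

text \<open>A single edge would already be visible in a finite closed part \<open>F\<close> of
  \<open>Y\<close> containing \<open>y\<close> and \<open>B \<inter> Y\<close>, where
  \<open>gens_union\<close> applies.\<close>

lemma gens_no_edge:
  assumes Y: "gens Y F0" and B: "finite B" "sclosed B" "F0 \<subseteq> B"
    and x: "x \<in> B - Y" and y: "y \<in> Y - B"
  shows "\<not> E x y" "\<not> E y x"
proof -
  define F where "F = clo (insert y (B \<inter> Y))"
  have fin: "finite (insert y (B \<inter> Y))" using B by simp
  have Y': "sclosed Y" using Y by (simp add: gens_def)
  have "F \<subseteq> F \<inter> Y" unfolding F_def using clo_props[OF fin] Y' y
    by (intro clo_least[OF fin] sclosed_Int) auto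
  then have F: "finite F" "sclosed F" "B \<inter> Y \<subseteq> F" "F \<subseteq> Y" "y \<in> F"
    unfolding F_def using clo_props[OF fin] by auto
  have "x \<in> B - F" "y \<in> F - B" using x y F by auto
  then show "\<not> E x y" using gens_union(3)[OF Y B F(1-4)] by blast
  then show "\<not> E y x" using E_sym by blast
qed

definition partial_iso :: "'a set \<Rightarrow> ('a \<Rightarrow> 'a) \<Rightarrow> 'a set \<Rightarrow> 'a set \<Rightarrow> ('a \<Rightarrow> 'a) \<Rightarrow> bool" where
  "partial_iso Y p F0 B t \<longleftrightarrow> finite B \<and> sclosed B \<and> F0 \<subseteq> B \<and> sclosed (t ` B) \<and> eqon Y t p \<and> iso_on E t (Y \<union> B)"

text \<open>Homogeneity yields automorphisms that agree with \<open>p\<close> on finitely many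
  points only. The last condition makes \<open>F0\<close> rich enough to force such an automorphism
  to preserve \<open>Y\<close>.\<close>

definition rigid :: "'a set \<Rightarrow> ('a \<Rightarrow> 'a) \<Rightarrow> 'a set \<Rightarrow> bool" where
  "rigid Y p F0 \<longleftrightarrow> gens Y F0 \<and> iso_on E p Y \<and> p ` Y = Y \<and> (\<forall>h\<in>Aut E. eqon F0 h p \<longrightarrow> h ` Y = Y)"

text \<open>Homogeneity extends a finite part of \<open>t\<close> to an automorphism
  \<open>g\<close>, which need not agree with \<open>p\<close> on all of \<open>Y\<close>. The new
  map is \<open>p\<close> on \<open>Y\<close> and \<open>g\<close> elsewhere; the two fit together
  because no edges run between \<open>Y - B1\<close> and \<open>B1 - Y\<close>, nor between their
  images.\<close>

lemma partial_iso_forth: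
  assumes R: "rigid Y p F0" and S: "partial_iso Y p F0 B t"
  shows "\<exists>t' B'. partial_iso Y p F0 B' t' \<and> B \<subseteq> B' \<and> x \<in> B' \<and> eqon (Y \<union> B) t' t"
proof -
  have Y: "gens Y F0" and p: "iso_on E p Y" "p ` Y = Y"
    and rig: "\<And>h. h \<in> Aut E \<Longrightarrow> eqon F0 h p \<Longrightarrow> h ` Y = Y" using R by (auto simp: rigid_def)
  have Y': "sclosed Y" "F0 \<subseteq> Y" using Y by (auto simp: gens_def)
  have B: "finite B" "sclosed B" "F0 \<subseteq> B" "sclosed (t ` B)" and tp: "eqon Y t p" and t: "iso_on E t (Y \<union> B)"
    using S by (auto simp: partial_iso_def)
  define B1 where "B1 = clo (insert x B)"
  have fin: "finite (insert x B)" using B by simp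
  have B1: "finite B1" "sclosed B1" "insert x B \<subseteq> B1" unfolding B1_def using clo_props[OF fin] by auto
  \<comment> \<open>All of \<open>B1 \<inter> Y\<close> is put into the domain before homogeneity is
    used, so that \<open>g\<close> and \<open>p\<close> agree there.\<close>
  define F where "F = B1 \<inter> Y"
  have F: "finite F" "sclosed F" "B \<inter> Y \<subseteq> F" "F \<subseteq> Y"
    unfolding F_def using B1 Y' by (auto intro: sclosed_Int)
  note BF = gens_union[OF Y B(1-3) F]
  have tBF: "iso_on E t (B \<union> F)" using t by (rule iso_on_subset) (use F in auto)
  have "\<delta> (t ` (B \<union> F)) = \<delta> (t ` B)"
    using delta_iso_on[OF tBF] delta_iso_on[OF iso_on_subset[OF t, of B]] BF(1) by simp
  then have "sclosed (t ` (B \<union> F))" by (intro sclosed_Un[OF B(4)]) (use B(1) F(1) in auto)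
  then obtain g where g: "g \<in> Aut E" "eqon (B \<union> F) g t"
    using homogeneous[OF _ BF(2) _ tBF] B(1) F(1) by auto
  have "eqon F0 g p" using g(2) B(3) tp Y'(2) by (simp add: subset_iff)
  with g(1) have gY: "g ` Y = Y" by (rule rig)
  define t' where "t' z = (if z \<in> Y then p z else g z)" for z
  have t'g: "t' z = g z" if "z \<in> B1" for z
    using that g(2) tp F unfolding t'_def F_def by auto
  have t'p: "t' z = p z" if "z \<in> Y" for z using that by (simp add: t'_def)
  have g_notin: "g z \<notin> Y" if "z \<notin> Y" for z
    using that gY Aut_inv_simps(3)[OF g(1)] by (metis imageE)
  have cross: "\<not> E z z' \<and> \<not> E (t' z) (t' z') \<and> t' z \<noteq> t' z'" if z: "z \<in> Y" "z \<notin> B1" "z' \<in> B1" "z' \<notin> Y" for z z'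
  proof -
    have F0B1: "F0 \<subseteq> B1" using B(3) B1(3) by auto
    \<comment> \<open>As \<open>g\<close> preserves \<open>Y\<close>, the point \<open>p z\<close>
      is the image under \<open>g\<close> of some \<open>w\<close> in \<open>Y\<close>; the missing
      edge at \<open>w\<close> is carried over by \<open>g\<close>.\<close>
    obtain w where w: "w \<in> Y" "p z = g w" using gY p(2) z(1) by (metis imageE imageI)
    have "w \<notin> B1"
    proof
      assume "w \<in> B1"
      then have "g w = p w" using t'g[of w] t'p[OF w(1)] by simp
      then have "w = z" using w p(1) z(1) by (simp add: iso_on_def inj_on_def)
      then show False using \<open>w \<in> B1\<close> z(2) by simp
    qed
    then have "\<not> E w z'" using gens_no_edge(2)[OF Y B1(1,2) F0B1, of z' w] z w by blast
    then have "\<not> E (t' z) (t' z')" using t'p[OF z(1)] t'g[OF z(3)] w(2) Aut_E[OF g(1)] by simp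
    moreover have "\<not> E z z'" using gens_no_edge(2)[OF Y B1(1,2) F0B1, of z' z] z by blast
    moreover have "p z \<in> Y" using p(2) z(1) by blast
    then have "t' z \<noteq> t' z'" using t'p[OF z(1)] t'g[OF z(3)] g_notin[OF z(4)] by auto
    ultimately show ?thesis by blast
  qed
  have "iso_on E t' (Y \<union> B1)"
  proof (rule iso_on_Un)
    show "iso_on E t' Y" using p(1) by (rule iso_on_cong) (use t'p in auto)
    show "iso_on E t' B1" by (rule iso_on_cong[OF Aut_iso_on[OF g(1)]]) (use t'g in auto)
    show "\<not> E y b \<and> \<not> E b y \<and> \<not> E (t' y) (t' b) \<and> \<not> E (t' b) (t' y) \<and> t' y \<noteq> t' b"
      if "y \<in> Y - B1" "b \<in> B1 - Y" for y b
      using cross[of y b] that E_sym by blast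
  qed
  moreover have "t' ` B1 = g ` B1" using t'g by (rule image_cong[OF refl])
  then have "sclosed (t' ` B1)" using sclosed_Aut[OF g(1) B1(2)] by simp
  moreover have "eqon Y t' p" using t'p by simp
  ultimately have "partial_iso Y p F0 B1 t'" using B1 B(3) by (auto simp: partial_iso_def)
  moreover have "eqon (Y \<union> B) t' t" using t'p tp t'g g(2) B1(3) by auto
  ultimately show ?thesis using B1(3) by (intro exI[of _ t'] exI[of _ B1]) auto
qed

text \<open>Together with \<open>partial_iso_inv\<close> this makes the backward step an instance of
  the forward step for the inverse maps. The image of \<open>F0\<close> still generates, since
  \<open>p\<close> preserves dimensions inside \<open>Y\<close>.\<close>

lemma rigid_inv:
  assumes R: "rigid Y p F0"
  shows "rigid Y (inv_into Y p) (p ` F0)"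
proof -
  have Y: "gens Y F0" and p: "iso_on E p Y" "p ` Y = Y"
    and rig: "\<And>h. h \<in> Aut E \<Longrightarrow> eqon F0 h p \<Longrightarrow> h ` Y = Y" using R by (auto simp: rigid_def)
  have Y': "sclosed Y" "F0 \<subseteq> Y" "finite F0" using Y by (auto simp: gens_def)
  have inj: "inj_on p Y" using p(1) by (simp add: iso_on_def)
  have "gens Y (p ` F0)"
    unfolding gens_def
  proof (intro conjI allI impI)
    fix F assume F: "finite F" "F \<subseteq> Y"
    have eq: "p ` inv_into Y p ` F = F" using p(2) F(2) by (simp add: image_inv_into_cancel)
    have sub: "inv_into Y p ` F \<subseteq> Y" 
    proof
      fix y assume "y \<in> inv_into Y p ` F"
      then obtain z where "z \<in> F" "y = inv_into Y p z" by blast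
      then show "y \<in> Y" using p(2) F(2) inv_into_into[of z p Y] by auto
    qed
    have "d (p ` F0 \<union> F) = d (p ` (F0 \<union> inv_into Y p ` F))" using eq by (simp add: image_Un)
    also have "\<dots> = d (F0 \<union> inv_into Y p ` F)" using Y' p F sub by (intro d_iso) auto
    also have "\<dots> = d F0" using Y F sub by (simp add: gens_def)
    also have "\<dots> = d (p ` F0)" using Y' p by (intro d_iso[symmetric]) auto
    finally show "d (p ` F0 \<union> F) = d (p ` F0)" .
  qed (use Y' p in auto)
  moreover have "iso_on E (inv_into Y p) Y" using iso_on_inv_into[OF p(1)] p(2) by simp
  moreover have "inv_into Y p ` Y = Y" using inv_into_image_cancel[OF inj, of Y] p(2) by simp
  moreover have "h ` Y = Y" if h: "h \<in> Aut E" "eqon (p ` F0) h (inv_into Y p)" for h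
  proof -
    have "inv h x = p x" if "x \<in> F0" for x
    proof -
      have "h (p x) = x" using h(2) that Y'(2) inj by (simp add: subset_iff)
      then show ?thesis using Aut_inv_simps(1)[OF h(1), of "p x"] by simp
    qed
    then have "inv h ` Y = Y" using rig[OF Aut_inv[OF h(1)]] by blast
    then show ?thesis using Aut_inv_simps(5)[OF h(1), of Y] by simp
  qed
  ultimately show ?thesis by (simp add: rigid_def)
qed

lemma partial_iso_inv:
  assumes R: "rigid Y p F0" and S: "partial_iso Y p F0 B t"
  shows "partial_iso Y (inv_into Y p) (p ` F0) (t ` B) (inv_into (Y \<union> B) t)"
proof -
  have Y: "F0 \<subseteq> Y" and p: "p ` Y = Y" "inj_on p Y" using R by (auto simp: rigid_def gens_def iso_on_def)
  have B: "finite B" "sclosed B" "F0 \<subseteq> B" "sclosed (t ` B)" and tp: "eqon Y t p" and t: "iso_on E t (Y \<union> B)"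
    using S by (auto simp: partial_iso_def)
  have inj: "inj_on t (Y \<union> B)" using t by (simp add: iso_on_def)
  have tY: "t ` Y = Y" using image_cong[OF refl, of Y t p] tp p(1) by simp
  have "eqon Y (inv_into (Y \<union> B) t) (inv_into Y p)"
  proof
    fix y assume "y \<in> Y"
    then obtain x where x: "x \<in> Y" "y = p x" using p(1) by blast
    then have "inv_into (Y \<union> B) t (t x) = x" using inj by simp
    then show "inv_into (Y \<union> B) t y = inv_into Y p y" using x tp p(2) by simp
  qed
  moreover have "iso_on E (inv_into (Y \<union> B) t) (Y \<union> t ` B)"
    using iso_on_inv_into[OF t] tY by (simp add: image_Un)
  moreover have "inv_into (Y \<union> B) t ` t ` B = B" using inj by (simp add: inv_into_image_cancel)
  moreover have "p ` F0 \<subseteq> t ` B"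
  proof
    fix y assume "y \<in> p ` F0"
    then obtain x where "x \<in> F0" "y = p x" by blast
    then show "y \<in> t ` B" using tp Y B(3) by (intro image_eqI[of _ _ x]) auto
  qed
  ultimately show ?thesis using B by (simp add: partial_iso_def)
qed

lemma partial_iso_back:
  assumes R: "rigid Y p F0" and S: "partial_iso Y p F0 B t"
  shows "\<exists>t' B'. partial_iso Y p F0 B' t' \<and> B \<subseteq> B' \<and> x \<in> t' ` B' \<and> eqon (Y \<union> B) t' t"
proof -
  have Y: "F0 \<subseteq> Y" and p: "p ` Y = Y" "inj_on p Y" using R by (auto simp: rigid_def gens_def iso_on_def)
  have tp: "eqon Y t p" and inj: "inj_on t (Y \<union> B)"
    using S by (auto simp: partial_iso_def iso_on_def)
  let ?q = "inv_into Y p" and ?s = "inv_into (Y \<union> B) t"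
  have tY: "t ` Y = Y" using image_cong[OF refl, of Y t p] tp p(1) by simp
  note R' = rigid_inv[OF R] and S' = partial_iso_inv[OF R S]
  obtain s C where s: "partial_iso Y ?q (p ` F0) C s" "t ` B \<subseteq> C" "x \<in> C" "eqon (Y \<union> t ` B) s ?s"
    using partial_iso_forth[OF R' S', of x] by (elim exE conjE)
  let ?t = "inv_into (Y \<union> C) s"
  have sinj: "inj_on s (Y \<union> C)" using s(1) by (simp add: partial_iso_def iso_on_def)
  have "partial_iso Y (inv_into Y ?q) (?q ` p ` F0) (s ` C) ?t"
    using partial_iso_inv[OF R' s(1)] .
  moreover have "?q ` p ` F0 = F0" using p(2) Y by (simp add: inv_into_image_cancel)
  moreover have "inv_into Y ?q y = p y" if "y \<in> Y" for y
  proof -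
    have "inj_on ?q Y" using inj_on_inv_into[of Y p Y] p by simp
    then have "inv_into Y ?q (?q (p y)) = p y" using that p(1) by (intro inv_into_f_f) auto
    then show ?thesis using that p(2) by simp
  qed
  ultimately have "partial_iso Y p F0 (s ` C) ?t" by (simp add: partial_iso_def)
  moreover have ts: "s (t z) = z" if "z \<in> Y \<union> B" for z
  proof -
    have "t z \<in> Y \<union> t ` B" using that tY by blast
    then have "s (t z) = ?s (t z)" using s(4) by blast
    then show ?thesis using inj that by simp
  qed
  have "B \<subseteq> s ` C"
  proof
    fix z assume z: "z \<in> B"
    then have "s (t z) = z" using ts by simp
    then show "z \<in> s ` C" using s(2) z by (intro image_eqI[of _ _ "t z"]) auto
  qed
  moreover have "x \<in> ?t ` s ` C"
  proof -
    have "?t ` s ` C = C" using sinj by (simp add: inv_into_image_cancel)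
    then show ?thesis using s(3) by simp
  qed
  moreover have "eqon (Y \<union> B) ?t t"
  proof
    fix z assume z: "z \<in> Y \<union> B"
    then have "t z \<in> Y \<union> C" using tY s(2) by auto
    then have "?t (s (t z)) = t z" using sinj by simp
    then show "?t z = t z" using ts[OF z] by simp
  qed
  ultimately show ?thesis by (intro exI[of _ ?t] exI[of _ "s ` C"] conjI)
qed

text \<open>Homogeneity over an infinite set: in the back and forth the map on \<open>Y\<close>
  stays fixed and only the finite closed part \<open>B\<close> grows.\<close>

theorem extend_partial_iso:
  assumes R: "rigid Y p F0" and S: "partial_iso Y p F0 B t"
  shows "\<exists>g\<in>Aut E. eqon (Y \<union> B) g t"
proof (rule back_and_forth[where P = "\<lambda>t D. \<exists>B. D = Y \<union> B \<and> partial_iso Y p F0 B t"])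
  show "countable (UNIV :: 'a set)" using generic by (simp add: is_generic_def)
  show "\<exists>C. Y \<union> B = Y \<union> C \<and> partial_iso Y p F0 C t" using S by blast
  show "iso_on E t D" if "\<exists>B. D = Y \<union> B \<and> partial_iso Y p F0 B t" for t D
    using that by (auto simp: partial_iso_def)
  show "\<exists>t' D'. (\<exists>B. D' = Y \<union> B \<and> partial_iso Y p F0 B t') \<and> D \<subseteq> D' \<and> x \<in> D' \<and> eqon D t' t"
    if D: "\<exists>B. D = Y \<union> B \<and> partial_iso Y p F0 B t" for t D x
  proof -
    obtain B where B: "D = Y \<union> B" "partial_iso Y p F0 B t" using D by (elim exE conjE)
    obtain t' B' where "partial_iso Y p F0 B' t'" "B \<subseteq> B'" "x \<in> B'" "eqon (Y \<union> B) t' t"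
      using partial_iso_forth[OF R B(2), of x] by (elim exE conjE)
    then show ?thesis unfolding B(1) by (intro exI[of _ t'] exI[of _ "Y \<union> B'"]) auto
  qed
  show "\<exists>t' D'. (\<exists>B. D' = Y \<union> B \<and> partial_iso Y p F0 B t') \<and> D \<subseteq> D' \<and> x \<in> t' ` D' \<and> eqon D t' t"
    if D: "\<exists>B. D = Y \<union> B \<and> partial_iso Y p F0 B t" for t D x
  proof -
    obtain B where B: "D = Y \<union> B" "partial_iso Y p F0 B t" using D by (elim exE conjE)
    obtain t' B' where "partial_iso Y p F0 B' t'" "B \<subseteq> B'" "x \<in> t' ` B'" "eqon (Y \<union> B) t' t"
      using partial_iso_back[OF R B(2), of x] by (elim exE conjE)
    then show ?thesis unfolding B(1) by (intro exI[of _ t'] exI[of _ "Y \<union> B'"]) auto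
  qed
qed

end

section \<open>Realising finite extensions\<close>

context generic_graph
begin

text \<open>Genericity speaks of graphs on natural numbers; a numbering of the finite set carries it
  over to arbitrary vertex types.\<close>

lemma embed_finite:
  fixes R :: "'b \<Rightarrow> 'b \<Rightarrow> bool"
  assumes R: "is_graph R" and S: "in_K0 m R S"
  shows "\<exists>\<phi>. inj_on \<phi> S \<and> (\<forall>x\<in>S. \<forall>y\<in>S. R x y \<longleftrightarrow> E (\<phi> x) (\<phi> y)) \<and> sclosed (\<phi> ` S)"
proof -
  have fin: "finite S" using S by (simp add: in_K0_def)
  obtain e :: "'b \<Rightarrow> nat" where e: "inj_on e S" using finite_imp_inj_to_nat_seg[OF fin] by blast
  define R' where "R' i j \<longleftrightarrow> (\<exists>x\<in>S. \<exists>y\<in>S. i = e x \<and> j = e y \<and> R x y)" for i j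
  have R'e: "R x y \<longleftrightarrow> R' (e x) (e y)" if "x \<in> S" "y \<in> S" for x y
    using that e unfolding R'_def inj_on_def by blast
  have "is_graph R'"
    unfolding is_graph_def
  proof (intro conjI allI impI notI)
    fix i assume "R' i i"
    then obtain x y where "x \<in> S" "y \<in> S" "i = e x" "i = e y" "R x y" by (auto simp: R'_def)
    moreover from this have "x = y" using e by (simp add: inj_on_def)
    ultimately show False using R by (simp add: is_graph_def)
  next
    fix i j assume "R' i j"
    then show "R' j i" using R unfolding R'_def is_graph_def by blast
  qed
  moreover have "in_K0 m R' (e ` S)"
    unfolding in_K0_def
  proof (intro conjI allI impI)
    fix T assume "T \<subseteq> e ` S"
    then obtain T' where T': "T' \<subseteq> S" "T = e ` T'" by (auto simp: subset_image_iff)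
    have "delta m R' (e ` T') = delta m R T'"
      using T'(1) by (intro delta_iso inj_on_subset[OF e] R'e) auto
    then show "0 \<le> delta m R' T" using S T' by (simp add: in_K0_def)
  qed (use fin in auto)
  moreover have "\<forall>(A :: nat set) (R :: nat \<Rightarrow> nat \<Rightarrow> bool). is_graph R \<and> in_K0 m R A \<longrightarrow>
        (\<exists>f. inj_on f A \<and> (\<forall>x\<in>A. \<forall>y\<in>A. R x y \<longleftrightarrow> E (f x) (f y)) \<and> closed_in m E (f ` A) UNIV)"
    using generic unfolding is_generic_def by (elim conjE)
  ultimately have "\<exists>f. inj_on f (e ` S) \<and> (\<forall>x\<in>e ` S. \<forall>y\<in>e ` S. R' x y \<longleftrightarrow> E (f x) (f y)) \<and>
      closed_in m E (f ` e ` S) UNIV" by blast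
  then obtain f where f: "inj_on f (e ` S)" "\<forall>x\<in>e ` S. \<forall>y\<in>e ` S. R' x y \<longleftrightarrow> E (f x) (f y)"
      "closed_in m E (f ` e ` S) UNIV" by (elim exE conjE)
  have "inj_on (f \<circ> e) S" using e f(1) by (rule comp_inj_on)
  moreover have "sclosed ((f \<circ> e) ` S)" using f(3) fin by (simp add: image_comp closed_in_iff_sclosed)
  moreover have "R x y \<longleftrightarrow> E ((f \<circ> e) x) ((f \<circ> e) y)" if "x \<in> S" "y \<in> S" for x y
    using R'e f(2) that by simp
  ultimately show ?thesis by (intro exI[of _ "f \<circ> e"]) simp
qed

text \<open>The condition \<open>le\<close> says that the old part \<open>C\<close> is closed in the
  abstract graph. This puts the graph into the class; the embedded copy of \<open>C\<close> is then
  closed, and homogeneity moves it back onto \<open>C\<close>, taking the new vertices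
  along.\<close>

lemma realise_extension:
  fixes R :: "'a + 'b \<Rightarrow> 'a + 'b \<Rightarrow> bool" and J :: "'b set"
  assumes R: "is_graph R" and C: "finite C" "sclosed C" and J: "finite J"
    and RC: "\<And>c c'. c \<in> C \<Longrightarrow> c' \<in> C \<Longrightarrow> R (Inl c) (Inl c') \<longleftrightarrow> E c c'"
    and le: "\<And>T. T \<subseteq> J \<Longrightarrow> \<delta> C \<le> delta m R (Inl ` C \<union> Inr ` T)"
  shows "\<exists>h. inj_on h J \<and> h ` J \<inter> C = {} \<and> sclosed (C \<union> h ` J) \<and>
    (\<forall>c\<in>C. \<forall>j\<in>J. E c (h j) \<longleftrightarrow> R (Inl c) (Inr j)) \<and>
    (\<forall>j\<in>J. \<forall>j'\<in>J. E (h j) (h j') \<longleftrightarrow> R (Inr j) (Inr j'))"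
proof -
  let ?S = "Inl ` C \<union> Inr ` J"
  have finS: "finite ?S" using C J by simp
  have deltaC: "delta m R (Inl ` A) = \<delta> A" if "A \<subseteq> C" for A
    by (rule delta_iso) (use that RC in \<open>auto simp: inj_on_def\<close>)
  have le': "\<delta> C \<le> delta m R T" if "Inl ` C \<subseteq> T" "T \<subseteq> ?S" for T
  proof -
    have "T = Inl ` C \<union> Inr ` (Inr -` T)" using that by auto
    moreover have "Inr -` T \<subseteq> J" using that by auto
    ultimately show ?thesis using le by metis
  qed
  have K0: "in_K0 m R ?S"
    unfolding in_K0_def
  proof (intro conjI allI impI)
    fix T assume T: "T \<subseteq> ?S"
    have finT: "finite T" using T finS by (rule finite_subset)
    have "T \<inter> Inl ` C = Inl ` (Inl -` T \<inter> C)" by auto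
    then have "delta m R (T \<inter> Inl ` C) = \<delta> (Inl -` T \<inter> C)" using deltaC by simp
    moreover have "0 \<le> \<delta> (Inl -` T \<inter> C)" using C(1) by (intro delta_nonneg) auto
    moreover have "delta m R (T \<union> Inl ` C) + delta m R (T \<inter> Inl ` C) \<le> delta m R T + delta m R (Inl ` C)"
      using finT C(1) by (intro delta_submodular) auto
    moreover have "\<delta> C \<le> delta m R (T \<union> Inl ` C)" using T by (intro le') auto
    ultimately show "0 \<le> delta m R T" using deltaC[of C] by simp
  qed (rule finS)
  obtain \<phi> where \<phi>: "inj_on \<phi> ?S" "\<forall>x\<in>?S. \<forall>y\<in>?S. R x y \<longleftrightarrow> E (\<phi> x) (\<phi> y)" "sclosed (\<phi> ` ?S)"
    using embed_finite[OF R K0] by (elim exE conjE)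
  have delta\<phi>: "\<delta> (\<phi> ` T) = delta m R T" if "T \<subseteq> ?S" for T
  proof (rule delta_iso)
    show "inj_on \<phi> T" using \<phi>(1) that by (rule inj_on_subset)
    show "R x y \<longleftrightarrow> E (\<phi> x) (\<phi> y)" if "x \<in> T" "y \<in> T" for x y
      using \<phi>(2) subsetD[OF \<open>T \<subseteq> ?S\<close>] that by simp
  qed
  let ?t = "\<lambda>c. \<phi> (Inl c)"
  have t_image: "?t ` C = \<phi> ` Inl ` C" by auto
  have "sclosed (?t ` C)"
  proof (rule sclosedI)
    show "finite (?t ` C)" using C by simp
    fix B assume B: "finite B" "?t ` C \<subseteq> B"
    have "B \<inter> \<phi> ` ?S = \<phi> ` (\<phi> -` B \<inter> ?S)" by auto
    then have "\<delta> (B \<inter> \<phi> ` ?S) = delta m R (\<phi> -` B \<inter> ?S)" using delta\<phi> by simp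
    moreover have "\<delta> C \<le> delta m R (\<phi> -` B \<inter> ?S)" using B(2) by (intro le') auto
    moreover have "\<delta> (B \<inter> \<phi> ` ?S) \<le> \<delta> B" using \<phi>(3) B(1) by (simp add: sclosed_def)
    moreover have "\<delta> (?t ` C) = \<delta> C" unfolding t_image using delta\<phi>[of "Inl ` C"] deltaC[of C] by simp
    ultimately show "\<delta> (?t ` C) \<le> \<delta> B" by simp
  qed
  moreover have "iso_on E ?t C"
    unfolding iso_on_def
  proof (intro conjI ballI inj_onI)
    show "E c c' \<longleftrightarrow> E (?t c) (?t c')" if "c \<in> C" "c' \<in> C" for c c'
      using \<phi>(2) RC that by simp
    show "c = c'" if "c \<in> C" "c' \<in> C" "?t c = ?t c'" for c c'
      using inj_on_eq_iff[OF \<phi>(1), of "Inl c" "Inl c'"] that by simp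
  qed
  ultimately have "\<exists>g\<in>Aut E. eqon C g ?t" by (rule homogeneous[OF C])
  then obtain g where g: "g \<in> Aut E" "eqon C g ?t" by (elim bexE)
  define h where "h j = inv g (\<phi> (Inr j))" for j
  have gh: "g (h j) = \<phi> (Inr j)" for j using Aut_inv_simps(2)[OF g(1)] by (simp add: h_def)
  have "inj_on h J"
  proof (rule inj_onI)
    fix j j' assume "j \<in> J" "j' \<in> J" "h j = h j'"
    then have "\<phi> (Inr j) = \<phi> (Inr j')" using gh by metis
    then have "(Inr j :: 'a + 'b) = Inr j'" 
      using inj_on_eq_iff[OF \<phi>(1), of "Inr j" "Inr j'"] \<open>j \<in> J\<close> \<open>j' \<in> J\<close> by simp
    then show "j = j'" by simp
  qed
  moreover have "h ` J \<inter> C = {}"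
  proof (rule ccontr)
    assume "h ` J \<inter> C \<noteq> {}"
    then obtain j where j: "j \<in> J" "h j \<in> C" by blast
    then have "\<phi> (Inr j) = \<phi> (Inl (h j))" using gh[of j] g(2) by metis
    then have "(Inr j :: 'a + 'b) = Inl (h j)" 
      using inj_on_eq_iff[OF \<phi>(1), of "Inr j" "Inl (h j)"] j by simp
    then show False by simp
  qed
  moreover have "sclosed (C \<union> h ` J)"
  proof -
    have "g ` (C \<union> h ` J) = \<phi> ` ?S" using g(2) gh by (simp add: image_Un image_image)
    then have "C \<union> h ` J = inv g ` \<phi> ` ?S" using Aut_inv_simps(4)[OF g(1), of "C \<union> h ` J"] by simp
    then show ?thesis using sclosed_Aut[OF Aut_inv[OF g(1)] \<phi>(3)] by simp
  qed
  moreover have "E c (h j) \<longleftrightarrow> R (Inl c) (Inr j)" if "c \<in> C" "j \<in> J" for c j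
  proof -
    have "E c (h j) \<longleftrightarrow> E (g c) (g (h j))" using Aut_E[OF g(1)] by simp
    then show ?thesis using gh g(2) \<phi>(2) that by simp
  qed
  moreover have "E (h j) (h j') \<longleftrightarrow> R (Inr j) (Inr j')" if "j \<in> J" "j' \<in> J" for j j'
  proof -
    have "E (h j) (h j') \<longleftrightarrow> E (g (h j)) (g (h j'))" using Aut_E[OF g(1)] by simp
    then show ?thesis using gh \<phi>(2) that by simp
  qed
  ultimately show ?thesis by (intro exI[of _ h]) simp
qed

text \<open>\<open>C\<close> is enlarged by a copy of \<open>B - K\<close> attached along
  \<open>K\<close> only. By modularity the increase over \<open>C\<close> equals the increase over
  \<open>K\<close>, which is nonnegative as \<open>K\<close> is closed. A computation of the same
  kind shows that the copy of \<open>B\<close> is closed, so homogeneity moves \<open>B\<close> onto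
  it.\<close>

lemma free_amalgam:
  assumes K: "finite K" "sclosed K" and B: "finite B" "sclosed B" "K \<subseteq> B" and C: "finite C" "sclosed C" "K \<subseteq> C"
  shows "\<exists>g\<in>Aut E. eqon K g id \<and> sclosed (g ` B \<union> C) \<and> \<delta> (g ` B \<union> C) = \<delta> B + \<delta> C - \<delta> K"
proof -
  define R where "R u v = (case u of Inl c \<Rightarrow> (case v of Inl c' \<Rightarrow> E c c' | Inr b \<Rightarrow> c \<in> K \<and> E c b)
     | Inr b \<Rightarrow> (case v of Inl c \<Rightarrow> c \<in> K \<and> E c b | Inr b' \<Rightarrow> E b b'))" for u v :: "'a + 'a"
  have R_simps: "R (Inl c) (Inl c') = E c c'" "R (Inl c) (Inr b) = (c \<in> K \<and> E c b)"
    "R (Inr b) (Inl c) = (c \<in> K \<and> E c b)" "R (Inr b) (Inr b') = E b b'" for b b' c c'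
    by (simp_all add: R_def)
  have R: "is_graph R"
    using graph unfolding is_graph_def by (auto simp: R_def split: sum.splits)
  have le: "\<delta> C \<le> delta m R (Inl ` C \<union> Inr ` T)" if T: "T \<subseteq> B - K" for T
  proof -
    let ?A = "Inl ` K \<union> Inr ` T :: ('a + 'a) set"
    have finT: "finite T" using T B(1) by (auto dest: finite_subset)
    have "delta m R (Inl ` C \<union> ?A) + delta m R (Inl ` C \<inter> ?A) = delta m R (Inl ` C) + delta m R ?A"
      by (rule delta_modular) (use C K finT in \<open>auto simp: R_simps\<close>)
    moreover have "Inl ` C \<union> ?A = Inl ` C \<union> Inr ` T" "Inl ` C \<inter> ?A = Inl ` K" using C(3) by auto
    moreover have "delta m R (Inl ` C) = \<delta> C" "delta m R (Inl ` K) = \<delta> K"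
      by (rule delta_iso; simp add: R_simps inj_on_def)+
    moreover have "delta m R ?A = \<delta> (K \<union> T)"
    proof -
      have "delta m E (case_sum id id ` ?A) = delta m R ?A"
        by (rule delta_iso) (use T E_sym in \<open>auto simp: R_simps inj_on_def\<close>)
      moreover have "case_sum id id ` ?A = K \<union> T" by (simp add: image_Un image_image)
      ultimately show ?thesis by simp
    qed
    moreover have "\<delta> K \<le> \<delta> (K \<union> T)" using K finT by (intro sclosed_subset) auto
    ultimately show ?thesis by simp
  qed
  have "\<exists>h. inj_on h (B - K) \<and> h ` (B - K) \<inter> C = {} \<and> sclosed (C \<union> h ` (B - K)) \<and>
    (\<forall>c\<in>C. \<forall>j\<in>B - K. E c (h j) \<longleftrightarrow> R (Inl c) (Inr j)) \<and>
    (\<forall>j\<in>B - K. \<forall>j'\<in>B - K. E (h j) (h j') \<longleftrightarrow> R (Inr j) (Inr j'))"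
    by (rule realise_extension[OF R C(1,2)]) (use B(1) le in \<open>simp_all add: R_simps\<close>)
  then obtain h where h: "inj_on h (B - K)" "h ` (B - K) \<inter> C = {}" "sclosed (C \<union> h ` (B - K))"
    "\<forall>c\<in>C. \<forall>j\<in>B - K. E c (h j) \<longleftrightarrow> R (Inl c) (Inr j)"
    "\<forall>j\<in>B - K. \<forall>j'\<in>B - K. E (h j) (h j') \<longleftrightarrow> R (Inr j) (Inr j')" by (elim exE conjE)
  define t where "t z = (if z \<in> K then z else h z)" for z
  have tK: "t z = z" if "z \<in> K" for z using that by (simp add: t_def)
  have th: "t z = h z" if "z \<in> B - K" for z using that by (simp add: t_def)
  have h_notin: "h z \<notin> C" if "z \<in> B - K" for z using h(2) that by blast
  have t: "iso_on E t B"
  proof -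
    have hK: "E c (h b) \<longleftrightarrow> E c b" "E (h b) c \<longleftrightarrow> E c b" if "c \<in> K" "b \<in> B - K" for b c
      using h(4) that C(3) E_sym[of "h b" c] by (auto simp: R_simps)
    have "E z z' \<longleftrightarrow> E (t z) (t z')" if z: "z \<in> B" "z' \<in> B" for z z'
      using z h(5) hK[of z z'] hK[of z' z] E_sym[of z z']
      by (cases "z \<in> K"; cases "z' \<in> K") (simp_all add: t_def R_simps)
    moreover have "inj_on t B"
    proof (rule inj_onI)
      show "z = z'" if "z \<in> B" "z' \<in> B" "t z = t z'" for z z'
        using that h_notin[of z] h_notin[of z'] C(3) inj_onD[OF h(1), of z z']
        by (cases "z \<in> K"; cases "z' \<in> K") (auto simp: t_def)
    qed
    ultimately show ?thesis by (simp add: iso_on_def)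
  qed
  have tB: "t ` B = K \<union> h ` (B - K)" using B(3) tK th by (auto simp: image_iff t_def)
  have inter: "t ` B \<inter> C = K" unfolding tB using h(2) C(3) by blast
  have union: "t ` B \<union> C = C \<union> h ` (B - K)" unfolding tB using C(3) by blast
  have modular: "\<delta> (t ` B \<union> C') + \<delta> K = \<delta> (t ` B) + \<delta> C'" if C': "K \<subseteq> C'" "C' \<subseteq> C" for C'
  proof -
    have eq: "t ` B \<inter> C' = K" using inter C' tB by blast
    have no: "\<not> E x y \<and> \<not> E y x" if "x \<in> t ` B - C'" "y \<in> C' - t ` B" for x y
    proof -
      have "x \<in> h ` (B - K)" using that(1) C'(1) unfolding tB by blast
      then obtain b where b: "b \<in> B - K" "x = h b" by blast
      have "y \<in> C" "y \<notin> K" using that(2) C' tB by auto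
      then have "\<not> E y x" using h(4) b by (simp add: R_simps)
      then show ?thesis using E_sym by blast
    qed
    have fin: "finite (t ` B)" "finite C'" using B(1) C(1) C'(2) by (auto dest: finite_subset)
    show ?thesis using delta_modular[OF fin no, where m = m] eq by simp
  qed
  have "sclosed (t ` B)"
  proof (rule sclosedI)
    show "finite (t ` B)" using B by simp
    fix D assume D: "finite D" "t ` B \<subseteq> D"
    have "D \<inter> (t ` B \<union> C) = t ` B \<union> (D \<inter> C)" using D by blast
    moreover have "\<delta> (D \<inter> (t ` B \<union> C)) \<le> \<delta> D" using h(3) D(1) unfolding union sclosed_def by blast
    moreover have "K \<subseteq> D \<inter> C" using D(2) inter by blast
    moreover from this have "\<delta> K \<le> \<delta> (D \<inter> C)" using K C(1) by (intro sclosed_subset) auto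
    ultimately show "\<delta> (t ` B) \<le> \<delta> D" using modular[of "D \<inter> C"] by simp
  qed
  then obtain g where g: "g \<in> Aut E" "eqon B g t" using homogeneous[OF B(1,2) _ t] by blast
  have gB: "g ` B = t ` B" using g(2) by (rule image_eqon)
  have "eqon K g id" using g(2) B(3) tK by auto
  moreover have "sclosed (g ` B \<union> C)" unfolding gB union by (rule h(3))
  moreover have "\<delta> (g ` B \<union> C) = \<delta> B + \<delta> C - \<delta> K"
    using modular[of C] C(3) delta_iso_on[OF t] unfolding gB by simp
  ultimately show ?thesis using g(1) by blast
qed

section \<open>Linking vertices and extensions that preserve a closure\<close>

lemma gcl_eq: "finite A \<Longrightarrow> finite B \<Longrightarrow> A \<subseteq> B \<Longrightarrow> B \<subseteq> gc A \<Longrightarrow> gc B = gc A"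
  by (intro subset_antisym gcl_subset) (auto dest: subsetD[OF subset_gcl])

lemma gcl_Aut_subset_eq:
  assumes g: "g \<in> Aut E" and A: "finite A" and sub: "g ` A \<subseteq> gc A"
  shows "g ` gc A = gc A"
proof -
  have "gc (g ` A) = gc A"
    using A sub d_Aut[OF g A] by (intro gcl_eqI gcl_subset) auto
  then show ?thesis using gcl_Aut[OF g A] by simp
qed

lemma rigid_gcl_id:
  assumes "finite A" shows "rigid (gc A) id A"
proof -
  have "h ` gc A = gc A" if "h \<in> Aut E" "eqon A h id" for h
  proof -
    have "h ` A = A" using image_eqon[OF that(2)] by simp
    then show ?thesis using gcl_Aut[OF that(1) assms] by simp
  qed
  then show ?thesis using gens_gcl[OF assms] by (simp add: rigid_def iso_on_def)
qed

text \<open>The vertex \<open>e\<close> is joined to \<open>W\<close> only. A second new vertex, joined to \<open>e\<close>, \<open>y\<close> and \<open>W\<close>, costs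
  \<open>m + 1\<close> edges and thereby pulls \<open>e\<close> into the closure of \<open>A\<close> and \<open>y\<close>.\<close>

lemma ex_linking_vertex:
  assumes A: "finite A" and W: "finite W" "W \<subseteq> gc A" "Suc (card W) = m" and y: "y \<notin> gc A"
  shows "\<exists>e F. finite F \<and> sclosed F \<and> A \<subseteq> F \<and> F \<subseteq> gc A \<and> e \<notin> gc A \<and> sclosed (insert e F) \<and>
    (\<forall>x\<in>gc A. E e x \<longleftrightarrow> x \<in> W) \<and> e \<in> gc (insert y A) \<and> d (insert e A) = d A + 1"
proof -
  define C where "C = clo (insert y (A \<union> W))"
  have fin: "finite (insert y (A \<union> W))" using A W by simp
  have C: "finite C" "sclosed C" "insert y (A \<union> W) \<subseteq> C" unfolding C_def using clo_props[OF fin] by auto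
  have yW: "y \<notin> W" using y W(2) by blast
  have mW: "int m = int (card W) + 1" using W(3) by linarith
  have card_Inl: "card (Inl ` Q :: ('a + bool) set) = card Q" for Q
    by (rule card_image) (simp add: inj_on_def)
  have ni: "Inr b \<notin> Inl ` C" for b :: bool by auto
  \<comment> \<open>\<open>Inr False\<close> is the future \<open>e\<close>; \<open>Inr True\<close>
    is the auxiliary vertex \<open>v\<close>. Over \<open>C\<close> the first changes the
    predimension by one, the second by zero, and both together by zero.\<close>
  define R where "R u v = (case u of Inl c \<Rightarrow> (case v of Inl c' \<Rightarrow> E c c' | Inr b \<Rightarrow> c \<in> W \<or> b \<and> c = y)
     | Inr b \<Rightarrow> (case v of Inl c \<Rightarrow> c \<in> W \<or> b \<and> c = y | Inr b' \<Rightarrow> b \<noteq> b'))" for u v :: "'a + bool"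
  have R_simps: "R (Inl c) (Inl c') = E c c'" "R (Inl c) (Inr b) = (c \<in> W \<or> b \<and> c = y)"
    "R (Inr b) (Inl c) = (c \<in> W \<or> b \<and> c = y)" "R (Inr b) (Inr b') = (b \<noteq> b')" for b b' c c'
    by (simp_all add: R_def)
  have R: "is_graph R"
    using graph unfolding is_graph_def by (auto simp: R_def split: sum.splits)
  have R0: "delta m R (Inl ` C) = \<delta> C" by (rule delta_iso; simp add: R_simps inj_on_def)
  have R1: "delta m R (insert (Inr False) (Inl ` C)) = \<delta> C + 1"
  proof -
    have "{a \<in> Inl ` C. R (Inr False) a} = Inl ` W" using C(3) by (auto simp: R_simps)
    then have "card {a \<in> Inl ` C. R (Inr False) a} = card W" by (simp add: card_image)
    then show ?thesis using delta_insert[OF R _ ni, of m False] C(1) R0 mW by simp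
  qed
  have R2: "delta m R (insert (Inr True) (Inl ` C)) = \<delta> C"
  proof -
    have "{a \<in> Inl ` C. R (Inr True) a} = Inl ` insert y W" using C(3) by (auto simp: R_simps)
    then have "card {a \<in> Inl ` C. R (Inr True) a} = card (insert y W)" 
      using card_Inl[of "insert y W"] by simp
    then show ?thesis using delta_insert[OF R _ ni, of m True] C(1) R0 W(1) mW yW by simp
  qed
  have R3: "delta m R (insert (Inr True) (insert (Inr False) (Inl ` C))) = \<delta> C"
  proof -
    have "{a \<in> insert (Inr False) (Inl ` C). R (Inr True) a} = insert (Inr False) (Inl ` insert y W)"
      using C(3) by (auto simp: R_simps)
    moreover have "card (insert (Inr False) (Inl ` insert y W)) = Suc (card (insert y W))"
      using W(1) card_Inl[of "insert y W"] by (subst card_insert_disjoint) auto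
    ultimately have "card {a \<in> insert (Inr False) (Inl ` C). R (Inr True) a} = Suc m"
      using W(1) W(3)[symmetric] yW by simp
    moreover have "Inr True \<notin> insert (Inr False) (Inl ` C)" by auto
    ultimately show ?thesis
      using delta_insert[OF R, of "insert (Inr False) (Inl ` C)" "Inr True" m] C(1) R1 by simp
  qed
  have le: "\<delta> C \<le> delta m R (Inl ` C \<union> Inr ` T)" for T :: "bool set"
  proof -
    have "T \<subseteq> {False, True}" by auto
    then consider "T = {}" | "T = {False}" | "T = {True}" | "T = {False, True}" by blast
    then show ?thesis
    proof cases
      case 4
      then have "Inl ` C \<union> Inr ` T = insert (Inr True) (insert (Inr False) (Inl ` C))" by auto
      then show ?thesis using R3 by simp
    qed (use R0 R1 R2 in simp_all)
  qed
  have "\<exists>h. inj_on h UNIV \<and> h ` UNIV \<inter> C = {} \<and> sclosed (C \<union> h ` UNIV) \<and>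
    (\<forall>c\<in>C. \<forall>j\<in>UNIV. E c (h j) \<longleftrightarrow> R (Inl c) (Inr j)) \<and>
    (\<forall>j\<in>UNIV. \<forall>j'\<in>UNIV. E (h j) (h j') \<longleftrightarrow> R (Inr j) (Inr j'))"
    by (rule realise_extension[OF R C(1,2)]) (use le in \<open>simp_all add: R_simps\<close>)
  then obtain h where h: "inj_on h UNIV" "h ` UNIV \<inter> C = {}" "sclosed (C \<union> h ` UNIV)"
    "\<forall>c\<in>C. \<forall>j\<in>UNIV. E c (h j) \<longleftrightarrow> R (Inl c) (Inr j)"
    "\<forall>j\<in>UNIV. \<forall>j'\<in>UNIV. E (h j) (h j') \<longleftrightarrow> R (Inr j) (Inr j')" by (elim exE conjE)
  define e where "e = h False"
  define v where "v = h True"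
  have range_h: "h ` UNIV = {e, v}" unfolding e_def v_def UNIV_bool by auto
  have ev: "e \<noteq> v" "e \<notin> C" "v \<notin> C" using h(1,2) by (auto simp: e_def v_def inj_on_def)
  have Ee: "E e c \<longleftrightarrow> c \<in> W" if "c \<in> C" for c
    using h(4) that E_sym[of e c] by (simp add: e_def R_simps)
  have Ev: "E v c \<longleftrightarrow> c \<in> W \<or> c = y" if "c \<in> C" for c
    using h(4) that E_sym[of v c] by (simp add: v_def R_simps)
  have Eve: "E v e" using h(5) by (simp add: e_def v_def R_simps)
  have de: "\<delta> (insert e T) = \<delta> T + 1" if T: "W \<subseteq> T" "T \<subseteq> C" for T
  proof -
    have finT: "finite T" using T(2) C(1) by (rule finite_subset)
    have "{a \<in> T. E e a} = W" using T Ee by blast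
    moreover have "e \<notin> T" using T(2) ev(2) by blast
    ultimately show ?thesis using delta_insert[OF graph finT, of e m] mW by simp
  qed
  \<comment> \<open>In \<open>insert e T\<close> the vertex \<open>v\<close> has
    \<open>m + 1\<close> neighbours if \<open>y\<close> lies in \<open>T\<close>, and
    \<open>m\<close> otherwise.\<close>
  have dv: "\<delta> (insert v (insert e T)) = \<delta> T + (if y \<in> T then 0 else 1)" if T: "W \<subseteq> T" "T \<subseteq> C" for T
  proof -
    have finT: "finite T" using T(2) C(1) by (rule finite_subset)
    have eq: "{a \<in> insert e T. E v a} = insert e (W \<union> T \<inter> {y})" using T Ev Eve by blast
    have "e \<notin> W \<union> T \<inter> {y}" using ev(2) T by blast
    then have "card {a \<in> insert e T. E v a} = Suc (card (W \<union> T \<inter> {y}))" using W(1) eq by simp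
    also have "card (W \<union> T \<inter> {y}) = card W + (if y \<in> T then 1 else 0)" using W(1) yW by simp
    finally have "int (card {a \<in> insert e T. E v a}) = int m + (if y \<in> T then 1 else 0)"
      using mW by simp
    moreover have "v \<notin> insert e T" using T(2) ev(1,3) by blast
    ultimately show ?thesis
      using delta_insert[OF graph, of "insert e T" v m] finT de[OF T] by simp
  qed
  define F where "F = C \<inter> gc A"
  have F: "finite F" "sclosed F" "A \<subseteq> F" "F \<subseteq> gc A" "W \<subseteq> F" "F \<subseteq> C"
    unfolding F_def using C W(2) sclosed_gcl[OF A] subset_gcl[OF A] by (auto intro: sclosed_Int)
  have dF: "\<delta> F = d A" using gens_gcl[OF A] F by (intro gens_delta) auto
  have dFe: "\<delta> (insert e F) = d A + 1" using de[of F] F(5,6) dF by simp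
  have eF: "sclosed (insert e F)"
  proof (rule sclosedI)
    show "finite (insert e F)" using F by simp
    fix D assume D: "finite D" "insert e F \<subseteq> D"
    define T where "T = D \<inter> C"
    have T: "W \<subseteq> T" "T \<subseteq> C" "F \<subseteq> T" "finite T" using D F by (auto simp: T_def)
    have FT: "\<delta> F \<le> \<delta> T" using F(2) T(3,4) by (intro sclosed_subset)
    \<comment> \<open>As \<open>y\<close> is outside \<open>gc A\<close>, a set \<open>T\<close>
      containing it exceeds \<open>F\<close> by at least one; this makes up for the edge from
      \<open>v\<close> to \<open>y\<close>.\<close>
    have yT: "\<delta> F + 1 \<le> \<delta> T" if "y \<in> T"
    proof -
      have "d (insert y A) \<le> \<delta> T" using T(3,4) F(3) that by (intro d_le) auto
      moreover have "d A \<le> d (insert y A)" using A by (intro d_mono) auto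
      moreover have "d (insert y A) \<noteq> d A" using y A by (simp add: gcl_iff)
      ultimately show ?thesis using dF by simp
    qed
    have "\<delta> (D \<inter> (C \<union> h ` UNIV)) \<le> \<delta> D" using h(3) D(1) unfolding sclosed_def by blast
    moreover have "\<delta> F + 1 \<le> \<delta> (D \<inter> (C \<union> h ` UNIV))"
    proof (cases "v \<in> D")
      case True
      then have "D \<inter> (C \<union> h ` UNIV) = insert v (insert e T)" using D(2) by (auto simp: range_h T_def)
      then show ?thesis using dv[OF T(1,2)] FT yT by auto
    next
      case False
      then have "D \<inter> (C \<union> h ` UNIV) = insert e T" using D(2) by (auto simp: range_h T_def)
      then show ?thesis using de[OF T(1,2)] FT by auto
    qed
    ultimately show "\<delta> (insert e F) \<le> \<delta> D" using dFe dF by simp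
  qed
  have e_notin: "e \<notin> gc A"
  proof
    assume "e \<in> gc A"
    then have "\<delta> (insert e F) = d A" using gens_gcl[OF A] F eF by (intro gens_delta) auto
    then show False using dFe by simp
  qed
  have nbrs: "E e x \<longleftrightarrow> x \<in> W" if x: "x \<in> gc A" for x
  proof (cases "x \<in> C")
    case True
    then show ?thesis by (rule Ee)
  next
    case False
    then have "x \<in> gc A - insert e F" using x e_notin F(6) by auto
    then have "\<not> E e x"
      using gens_no_edge(1)[OF gens_gcl[OF A] _ eF, of e x] F(1,3) e_notin by auto
    then show ?thesis using False F(5,6) by blast
  qed
  have fiA: "finite (insert y A)" using A by simp
  \<comment> \<open>Together the two new vertices cost nothing over \<open>C\<close>, so they lie in
    the closure of \<open>y\<close> and \<open>A\<close>.\<close>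
  have "C \<union> h ` UNIV \<subseteq> gc (insert y A)"
  proof (rule gclI)
    have "C \<union> h ` UNIV = insert v (insert e C)" by (auto simp: range_h)
    then have "\<delta> (C \<union> h ` UNIV) = \<delta> C" using dv[of C] C(3) by simp
    also have "\<dots> = d (insert y A \<union> W)" unfolding C_def by (simp add: dd_def)
    also have "\<dots> = d (insert y A)"
      using W(1,2) gcl_mono[OF fiA, of A] by (intro d_gcl fiA) auto
    finally show "\<delta> (C \<union> h ` UNIV) \<le> d (insert y A)" by simp
  qed (use A C range_h in auto)
  then have "e \<in> gc (insert y A)" by (auto simp: range_h)
  moreover have "d (insert e A) = d A + 1"
  proof -
    have "d (insert e A) \<le> d A + 1" using d_le[of "insert e F" "insert e A"] F(1,3) dFe by auto
    moreover have "d A \<le> d (insert e A)" using A by (intro d_mono) auto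
    moreover have "d (insert e A) \<noteq> d A" using e_notin A by (simp add: gcl_iff)
    ultimately show ?thesis by simp
  qed
  ultimately show ?thesis using F(1-4) e_notin eF nbrs
    by (intro exI[of _ e] exI[of _ F]) simp
qed

text \<open>Moving \<open>e\<close> to \<open>e'\<close> while fixing \<open>gc A\<close> respects
  edges, since both vertices have the same neighbours in \<open>gc A\<close>. Enlarging
  \<open>F\<close> and \<open>F'\<close> to a common closed \<open>H\<close> turns this map into a
  partial isomorphism with a finite closed part, and it extends.\<close>

lemma linking_vertices_conjugate:
  assumes A: "finite A"
    and F: "finite F" "sclosed F" "A \<subseteq> F" "F \<subseteq> gc A" and e: "e \<notin> gc A" "sclosed (insert e F)"
    and F': "finite F'" "sclosed F'" "A \<subseteq> F'" "F' \<subseteq> gc A" and e': "e' \<notin> gc A" "sclosed (insert e' F')"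
    and nbrs: "\<And>x. x \<in> gc A \<Longrightarrow> E e x \<longleftrightarrow> E e' x"
  shows "\<exists>g\<in>Aut E. eqon (gc A) g id \<and> g e = e'"
proof -
  define H where "H = clo (A \<union> (F \<union> F'))"
  have H: "finite H" "sclosed H" "F \<union> F' \<subseteq> H" "H \<subseteq> gc A"
    unfolding H_def using clo_props[of "A \<union> (F \<union> F')"] clo_gcl[of A "F \<union> F'"] A F F' by auto
  have closed: "sclosed (insert x H)" if "finite K" "sclosed (insert x K)" "A \<subseteq> K" "K \<subseteq> H" "x \<notin> gc A" for x K
  proof -
    have "sclosed (insert x K \<union> H)"
      using that H by (intro gens_union(2)[OF gens_gcl[OF A]]) auto
    moreover have "insert x K \<union> H = insert x H" using that(4) by auto
    ultimately show ?thesis by simp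
  qed
  have eH: "sclosed (insert e H)" "sclosed (insert e' H)"
    using closed[OF F(1) e(2) F(3) _ e(1)] closed[OF F'(1) e'(2) F'(3) _ e'(1)] H(3) by auto
  define t where "t = id(e := e')"
  have t_id: "t x = x" if "x \<in> gc A" for x using that e(1) by (auto simp: t_def)
  have te: "t e = e'" by (simp add: t_def)
  have tH: "t ` insert e H = insert e' H"
  proof -
    have "eqon H t id" using t_id H(4) by auto
    from image_eqon[OF this] have "t ` H = H" by simp
    then show ?thesis using te by simp
  qed
  have irrefl: "\<not> E x x" for x using graph by (simp add: is_graph_def)
  have "iso_on E t (gc A \<union> insert e H)"
  proof -
    have "(E z z' \<longleftrightarrow> E (t z) (t z')) \<and> (t z = t z' \<longrightarrow> z = z')"
      if z: "z \<in> insert e (gc A)" "z' \<in> insert e (gc A)" for z z'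
    proof (cases "z = e"; cases "z' = e")
      assume "z = e" "z' = e"
      then show ?thesis using irrefl te by simp
    next
      assume "z = e" "z' \<noteq> e"
      moreover from this have "z' \<in> gc A" using z by simp
      ultimately show ?thesis using te t_id nbrs e'(1) by auto
    next
      assume "z \<noteq> e" "z' = e"
      moreover from this have "z \<in> gc A" using z by simp
      ultimately show ?thesis using te t_id nbrs[of z] e'(1) E_sym[of z] by auto
    next
      assume "z \<noteq> e" "z' \<noteq> e"
      then show ?thesis using z t_id by simp
    qed
    then have "iso_on E t (insert e (gc A))" unfolding iso_on_def inj_on_def by blast
    moreover have "gc A \<union> insert e H = insert e (gc A)" using H(4) by auto
    ultimately show ?thesis by simp
  qed
  then have "partial_iso (gc A) id A (insert e H) t"
    unfolding partial_iso_def tH using H F(3) eH t_id by auto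
  from extend_partial_iso[OF rigid_gcl_id[OF A] this]
  obtain g where g: "g \<in> Aut E" "eqon (gc A \<union> insert e H) g t" by (elim bexE)
  have "eqon (gc A) g id" "g e = e'" using g(2) t_id te by auto
  then show ?thesis using g(1) by blast
qed

text \<open>Induction on the dimension still missing to that of \<open>gc D\<close>. As long as
  \<open>gc A\<close> is a proper part, so is its image, because dimensions agree. Linking vertices
  with corresponding neighbours are then chosen on both sides and matched by correcting
  \<open>g\<close> outside \<open>gc A\<close>, which raises the dimension by one.\<close>

lemma extend_to_gcl:
  assumes "finite A" "m \<le> card A" "0 < m" "finite D" "g \<in> Aut E" "gc A \<subseteq> gc D" "g ` gc A \<subseteq> gc D"
  shows "\<exists>f\<in>Aut E. eqon (gc A) f g \<and> f ` gc D = gc D"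
  using assms
proof (induction "nat (d D - d A)" arbitrary: A g rule: less_induct)
  case less
  note A = less.prems(1) and D = less.prems(4) and g = less.prems(5)
  have AD: "A \<subseteq> gc D" using less.prems(6) subset_gcl[OF A] by blast
  have gA: "finite (g ` A)" "gc (g ` A) = g ` gc A" using A gcl_Aut[OF g A] by auto
  have dgA: "d (g ` A) = d A" using d_Aut[OF g A] .
  show ?case
  proof (cases "gc A = gc D")
    case True
    then have "d D \<le> d A" using subset_gcl[OF D] by (intro d_gcl_mono A D) auto
    then have "gc (g ` A) = gc D" using gA less.prems(7) dgA D by (intro gcl_eqI) auto
    then show ?thesis using True g gA by (intro bexI[of _ g]) auto
  next
    case False
    have gAD: "gc (g ` A) \<noteq> gc D"
    proof
      assume "gc (g ` A) = gc D"
      then have "d D \<le> d (g ` A)" using subset_gcl[OF D] by (intro d_gcl_mono gA D) auto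
      then show False using False gcl_eqI[OF A D less.prems(6)] dgA by simp
    qed
    obtain y where y: "y \<in> gc D" "y \<notin> gc A" using False less.prems(6) by blast
    obtain y' where y': "y' \<in> gc D" "y' \<notin> gc (g ` A)" using gAD less.prems(7) gA(2) by blast
    have "m - 1 \<le> card A" using less.prems(2) by simp
    then obtain W where W: "W \<subseteq> A" "card W = m - 1" "finite W" by (rule obtain_subset_with_card_n)
    have W1: "W \<subseteq> gc A" "Suc (card W) = m" using W subset_gcl[OF A] less.prems(3) by auto
    have "inj_on g W" using bij_is_inj[OF Aut_bij[OF g]] by (rule inj_on_subset) simp
    then have W2: "finite (g ` W)" "g ` W \<subseteq> gc (g ` A)" "Suc (card (g ` W)) = m"
      using W(3) W1 gA(2) card_image[of g W] by auto
    obtain e F where e: "finite F" "sclosed F" "A \<subseteq> F" "F \<subseteq> gc A" "e \<notin> gc A" "sclosed (insert e F)"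
      "\<forall>x\<in>gc A. E e x \<longleftrightarrow> x \<in> W" "e \<in> gc (insert y A)" "d (insert e A) = d A + 1"
      using ex_linking_vertex[OF A W(3) W1 y(2)] by (elim exE conjE)
    obtain e' F' where e': "finite F'" "sclosed F'" "g ` A \<subseteq> F'" "F' \<subseteq> gc (g ` A)" "e' \<notin> gc (g ` A)"
      "sclosed (insert e' F')" "\<forall>x\<in>gc (g ` A). E e' x \<longleftrightarrow> x \<in> g ` W" "e' \<in> gc (insert y' (g ` A))"
      "d (insert e' (g ` A)) = d (g ` A) + 1"
      using ex_linking_vertex[OF gA(1) W2 y'(2)] by (elim exE conjE)
    let ?i = "inv g"
    note ig = Aut_inv[OF g] and isimps = Aut_inv_simps[OF g]
    \<comment> \<open>Pulled back along \<open>g\<close>, the vertex \<open>e'\<close> is another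
      linking vertex over \<open>gc A\<close> with neighbours \<open>W\<close>. Hence some
      \<open>h\<close> fixing \<open>gc A\<close> moves \<open>e\<close> there, and
      \<open>g \<circ> h\<close> takes \<open>e\<close> to \<open>e'\<close>.\<close>
    have "\<exists>h\<in>Aut E. eqon (gc A) h id \<and> h e = ?i e'"
    proof (rule linking_vertices_conjugate[OF A e(1-6)])
      show "finite (?i ` F')" using e'(1) by simp
      show "sclosed (?i ` F')" using sclosed_Aut[OF ig e'(2)] .
      show "A \<subseteq> ?i ` F'" using image_mono[OF e'(3), of ?i] isimps(4) by simp
      show "?i ` F' \<subseteq> gc A" using image_mono[OF e'(4), of ?i] isimps(4) gA(2) by simp
      show "?i e' \<notin> gc A"
      proof
        assume "?i e' \<in> gc A"
        then have "g (?i e') \<in> g ` gc A" by blast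
        then show False using e'(5) gA(2) isimps(2) by simp
      qed
      show "sclosed (insert (?i e') (?i ` F'))" using sclosed_Aut[OF ig e'(6)] by simp
      fix x assume x: "x \<in> gc A"
      have "E (?i e') x \<longleftrightarrow> E (g (?i e')) (g x)" using Aut_E[OF g] by simp
      also have "\<dots> \<longleftrightarrow> g x \<in> g ` W" using e'(7) gA(2) x isimps(2) by simp
      also have "\<dots> \<longleftrightarrow> x \<in> W" using isimps(3) by (auto simp: image_iff)
      finally show "E e x \<longleftrightarrow> E (?i e') x" using e(7) x by simp
    qed
    then obtain h where h: "h \<in> Aut E" "eqon (gc A) h id" "h e = ?i e'" by (elim bexE conjE)
    define g1 where "g1 = g \<circ> h"
    have g1: "g1 \<in> Aut E" "eqon (gc A) g1 g" "g1 e = e'"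
      unfolding g1_def using Aut_comp[OF g h(1)] h isimps(2) by auto
    let ?A = "insert e A"
    have fi: "finite ?A" using A by simp
    have g1A: "g1 ` ?A = insert e' (g ` A)"
    proof -
      have "g1 ` A = g ` A" using g1(2) subset_gcl[OF A] by (intro image_eqon) blast
      then show ?thesis using g1(3) by simp
    qed
    have eD: "e \<in> gc D" using e(8) gcl_subset[of "insert y A" D] A D AD y(1) by auto
    have gAD': "g ` A \<subseteq> gc D" using less.prems(7) subset_gcl[OF A] by blast
    have e'D: "e' \<in> gc D" using e'(8) gcl_subset[of "insert y' (g ` A)" D] A D gAD' y'(1) by auto
    have sub: "gc ?A \<subseteq> gc D" using fi D eD AD by (intro gcl_subset) auto
    have sub': "g1 ` gc ?A \<subseteq> gc D"
      unfolding gcl_Aut[OF g1(1) fi] g1A using A D e'D gAD' by (intro gcl_subset) auto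
    have "d ?A \<le> d D" using fi D eD AD by (intro d_gcl_mono) auto
    then have "nat (d D - d ?A) < nat (d D - d A)" using e(9) by simp
    moreover have "m \<le> card ?A" using less.prems(2) A by (simp add: card_insert_if)
    ultimately obtain f where f: "f \<in> Aut E" "eqon (gc ?A) f g1" "f ` gc D = gc D"
      using less.hyps[OF _ fi _ less.prems(3) D g1(1) sub sub'] by blast
    have "gc A \<subseteq> gc ?A" using fi by (intro gcl_mono) auto
    then have "eqon (gc A) f g" using f(2) g1(2) by (simp add: subset_iff)
    then show ?thesis using f(1,3) by blast
  qed
qed

end

section \<open>Free amalgamation of closures\<close>

context generic_graph
begin

text \<open>\<open>free_amalgam\<close> controls its automorphism \<open>g\<close> only on the
  finite set \<open>K\<close>. The identity on \<open>gc A\<close> and \<open>g\<close> on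
  \<open>B\<close> together form a partial isomorphism, whose extension fixes all of
  \<open>gc A\<close> and still moves \<open>B\<close> into the free position.\<close>

lemma free_translate:
  assumes A: "finite A" and A1: "finite A1" and A2: "finite A2"
    and sub: "gc A \<subseteq> gc A1" "gc A \<subseteq> gc A2"
  shows "\<exists>g\<in>Aut E. \<exists>B C K. eqon (gc A) g id \<and> finite B \<and> finite C \<and> finite K \<and> sclosed B \<and> sclosed C \<and> sclosed K \<and>
    sclosed (B \<union> C) \<and> \<delta> (B \<union> C) = \<delta> B + \<delta> C - \<delta> K \<and> A \<subseteq> K \<and> K \<subseteq> B \<and> K \<subseteq> C \<and>
    gc B = g ` gc A1 \<and> gc C = gc A2 \<and> gc K = gc A"
proof -
  define B where "B = clo (A1 \<union> A)"
  have AA: "A \<subseteq> gc A1" "A \<subseteq> gc A2" using sub subset_gcl[OF A] by auto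
  have B: "finite B" "sclosed B" "A1 \<union> A \<subseteq> B" "B \<subseteq> gc A1"
    unfolding B_def using clo_props[of "A1 \<union> A"] clo_gcl[of A1 A] A A1 AA by auto
  have gB: "gc B = gc A1" using B A1 by (intro gcl_eq) auto
  \<comment> \<open>\<open>K\<close> is all of \<open>B \<inter> gc A\<close>, so that the identity
    and \<open>g\<close> agree on their common domain; \<open>C\<close> is chosen afterwards to
    contain \<open>K\<close>.\<close>
  define K where "K = B \<inter> gc A"
  have K: "finite K" "sclosed K" "A \<subseteq> K" "K \<subseteq> gc A" "K \<subseteq> B"
    unfolding K_def using B sclosed_gcl[OF A] subset_gcl[OF A] by (auto intro: sclosed_Int)
  have gK: "gc K = gc A" using K A by (intro gcl_eq) auto
  define C where "C = clo (A2 \<union> K)"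
  have KA2: "K \<subseteq> gc A2" using K(4) sub(2) by blast
  have C: "finite C" "sclosed C" "A2 \<union> K \<subseteq> C" "C \<subseteq> gc A2"
    unfolding C_def using clo_props[of "A2 \<union> K"] clo_gcl[of A2 K] K A2 KA2 by auto
  have gC: "gc C = gc A2" using C A2 by (intro gcl_eq) auto
  have KC: "K \<subseteq> C" using C(3) by blast
  from free_amalgam[OF K(1,2) B(1,2) K(5) C(1,2) KC]
  obtain g where g: "g \<in> Aut E" "eqon K g id" "sclosed (g ` B \<union> C)" "\<delta> (g ` B \<union> C) = \<delta> B + \<delta> C - \<delta> K"
    by (elim bexE conjE)
  have gA: "g ` A = A"
  proof -
    have "eqon A g id" using g(2) K(3) by blast
    from image_eqon[OF this] show ?thesis by simp
  qed
  have gX: "g ` gc A = gc A" using gcl_Aut[OF g(1) A] gA by simp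
  have KgB: "K \<subseteq> g ` B"
  proof
    fix x assume "x \<in> K"
    then show "x \<in> g ` B" using g(2) K(5) by (intro image_eqI[of _ _ x]) auto
  qed
  have gB_Int: "g ` B \<inter> gc A = K"
  proof -
    have "g ` B \<inter> g ` gc A = g ` (B \<inter> gc A)"
      using bij_is_inj[OF Aut_bij[OF g(1)]] by (rule image_Int[symmetric])
    also have "\<dots> = K" using image_eqon[OF g(2)] by (simp add: K_def)
    finally show ?thesis using gX by simp
  qed
  define t where "t z = (if z \<in> gc A then z else g z)" for z
  have t_id: "t z = z" if "z \<in> gc A" for z using that by (simp add: t_def)
  have tg: "t z = g z" if "z \<in> B" for z using that g(2) unfolding t_def K_def by auto
  have tB: "t ` B = g ` B" using tg by (rule image_cong[OF refl])
  have "iso_on E t (gc A \<union> B)"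
  proof (rule iso_on_Un)
    show "iso_on E t (gc A)" using t_id by (simp add: iso_on_def inj_on_def)
    show "iso_on E t B" by (rule iso_on_cong[OF Aut_iso_on[OF g(1)]]) (use tg in auto)
    fix y b assume y: "y \<in> gc A - B" and b: "b \<in> B - gc A"
    have "\<not> E b y" "\<not> E y b" using gens_no_edge[OF gens_gcl[OF A] B(1,2) _ b y] B(3) by auto
    moreover have gb: "g b \<in> g ` B - gc A"
    proof -
      have "g b \<notin> K"
      proof
        assume "g b \<in> K"
        then have "g (g b) = g b" using g(2) by simp
        then have "g b = b" using Aut_inv_simps(3)[OF g(1)] by simp
        then show False using \<open>g b \<in> K\<close> K(4) b by auto
      qed
      then show ?thesis using b gB_Int by blast
    qed
    moreover have yg: "y \<in> gc A - g ` B" using y gB_Int K(5) by blast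
    moreover have AgB: "A \<subseteq> g ` B" using KgB K(3) by blast
    have "\<not> E (g b) y" "\<not> E y (g b)"
      using gens_no_edge[OF gens_gcl[OF A] _ sclosed_Aut[OF g(1) B(2)] AgB gb yg] B(1) by auto
    ultimately show "\<not> E y b \<and> \<not> E b y \<and> \<not> E (t y) (t b) \<and> \<not> E (t b) (t y) \<and> t y \<noteq> t b"
      using tg[of b] t_id[of y] y b by auto
  qed
  then have "partial_iso (gc A) id A B t"
    unfolding partial_iso_def tB using B sclosed_Aut[OF g(1) B(2)] t_id by auto
  from extend_partial_iso[OF rigid_gcl_id[OF A] this]
  obtain h where h: "h \<in> Aut E" "eqon (gc A \<union> B) h t" by (elim bexE)
  have hX: "eqon (gc A) h id" using h(2) t_id by auto
  have hB: "h ` B = g ` B"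
  proof -
    have "eqon B h g" using h(2) tg by auto
    then show ?thesis by (rule image_eqon)
  qed
  have "gc (g ` B) = h ` gc A1" using gcl_Aut[OF h(1) B(1)] hB gB by simp
  moreover have "finite (g ` B)" "sclosed (g ` B)" "\<delta> (g ` B) = \<delta> B"
    using B sclosed_Aut[OF g(1)] delta_Aut[OF g(1)] by auto
  ultimately show ?thesis
    using h(1) hX C(1,2) K(1-3) g(3,4) KgB KC gC gK
    by (intro bexI[of _ h] exI[of _ "g ` B"] exI[of _ C] exI[of _ K]) simp_all
qed

text \<open>Free position persists under finite closed enlargements inside the two closures:
  predimensions do not change, so submodularity is an equality for every such pair
  \<open>C1\<close>, \<open>C2\<close>. The statements about the infinite sets are read off from
  these pairs.\<close>

lemma free_union:
  assumes B: "finite B" "sclosed B" and C: "finite C" "sclosed C" and K: "finite K" "sclosed K" "K \<subseteq> B" "K \<subseteq> C"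
    and free: "sclosed (B \<union> C)" "\<delta> (B \<union> C) = \<delta> B + \<delta> C - \<delta> K"
  shows "gc B \<inter> gc C = gc K" "gens (gc B \<union> gc C) (B \<union> C)"
    "\<And>x y. x \<in> gc B - gc K \<Longrightarrow> y \<in> gc C - gc K \<Longrightarrow> \<not> E x y \<and> \<not> E y x"
proof -
  have BC: "finite (B \<union> C)" using B C by simp
  have sub: "gc B \<union> gc C \<subseteq> gc (B \<union> C)" using gcl_mono[OF BC] by auto
  have pair: "C1 \<inter> C2 \<subseteq> gc K \<and> sclosed (C1 \<union> C2) \<and> (\<forall>x y. x \<in> C1 - C2 \<longrightarrow> y \<in> C2 - C1 \<longrightarrow> \<not> E x y)"
    if C1: "finite C1" "sclosed C1" "B \<subseteq> C1" "C1 \<subseteq> gc B" and C2: "finite C2" "sclosed C2" "C \<subseteq> C2" "C2 \<subseteq> gc C"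
    for C1 C2
  proof -
    have "\<delta> C1 = d B" using gens_gcl[OF B(1)] C1 by (intro gens_delta)
    then have d1: "\<delta> C1 = \<delta> B" using d_sclosed[OF B] by simp
    have "\<delta> C2 = d C" using gens_gcl[OF C(1)] C2 by (intro gens_delta)
    then have d2: "\<delta> C2 = \<delta> C" using d_sclosed[OF C] by simp
    have "d ((B \<union> C) \<union> (C1 \<union> C2)) = d (B \<union> C)" using C1 C2 sub by (intro d_gcl BC) auto
    moreover have "(B \<union> C) \<union> (C1 \<union> C2) = C1 \<union> C2" using C1(3) C2(3) by blast
    ultimately have d12: "d (C1 \<union> C2) = \<delta> B + \<delta> C - \<delta> K" using d_sclosed[OF BC free(1)] free(2) by simp
    have le: "d (C1 \<union> C2) \<le> \<delta> (C1 \<union> C2)" using C1 C2 by (intro d_le) auto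
    have sm: "\<delta> (C1 \<union> C2) + \<delta> (C1 \<inter> C2) \<le> \<delta> C1 + \<delta> C2" using C1(1) C2(1) by (rule delta_submodular)
    have KC: "K \<subseteq> C1 \<inter> C2" using K C1 C2 by auto
    have ge: "\<delta> K \<le> \<delta> (C1 \<inter> C2)" using K(2) KC C1(1) by (intro sclosed_subset) auto
    have leK: "\<delta> (C1 \<inter> C2) \<le> \<delta> K" using le sm d12 d1 d2 by simp
    have "C1 \<inter> C2 \<subseteq> gc K" using K(1) C1(1) KC leK d_sclosed[OF K(1,2)] by (intro gclI) auto
    moreover have "sclosed (C1 \<union> C2)"
      using C1(1) C2(1) sm ge d12 d1 d2 by (intro sclosed_if_d) auto
    moreover have "\<not> E x y" if "x \<in> C1 - C2" "y \<in> C2 - C1" for x y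
      by (rule delta_modular_no_edge[OF C1(1) C2(1) _ that, where m = m]) (use le ge d12 d1 d2 in linarith)
    ultimately show ?thesis by blast
  qed
  have hull: "finite (clo (A \<union> T))" "sclosed (clo (A \<union> T))" "A \<subseteq> clo (A \<union> T)" "T \<subseteq> clo (A \<union> T)" "clo (A \<union> T) \<subseteq> gc A"
    if "finite A" "finite T" "T \<subseteq> gc A" for A T
    using clo_props[of "A \<union> T"] clo_gcl[of A T] that by auto
  have subK: "gc K \<subseteq> gc B" "gc K \<subseteq> gc C" using gcl_mono B(1) C(1) K(3,4) by auto
  show inter: "gc B \<inter> gc C = gc K"
  proof
    show "gc B \<inter> gc C \<subseteq> gc K"
    proof
      fix x assume x: "x \<in> gc B \<inter> gc C"
      have 1: "clo (B \<union> {x}) \<inter> clo (C \<union> {x}) \<subseteq> gc K"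
        using pair[OF hull(1,2,3,5)[of B "{x}"] hull(1,2,3,5)[of C "{x}"]] B(1) C(1) x by auto
      have "x \<in> clo (B \<union> {x})" "x \<in> clo (C \<union> {x})"
        using hull(4)[of B "{x}"] hull(4)[of C "{x}"] B(1) C(1) x by auto
      then show "x \<in> gc K" using 1 by blast
    qed
  qed (use subK in blast)
  show "\<not> E x y \<and> \<not> E y x" if x: "x \<in> gc B - gc K" and y: "y \<in> gc C - gc K" for x y
  proof -
    let ?C1 = "clo (B \<union> {x})" and ?C2 = "clo (C \<union> {y})"
    have h1: "finite ?C1" "sclosed ?C1" "B \<subseteq> ?C1" "{x} \<subseteq> ?C1" "?C1 \<subseteq> gc B" using hull[of B "{x}"] B(1) x by auto
    have h2: "finite ?C2" "sclosed ?C2" "C \<subseteq> ?C2" "{y} \<subseteq> ?C2" "?C2 \<subseteq> gc C" using hull[of C "{y}"] C(1) y by auto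
    have "x \<in> ?C1 - ?C2" "y \<in> ?C2 - ?C1" using h1(4,5) h2(4,5) x y inter by auto
    then have "\<not> E x y" using pair[OF h1(1-3,5) h2(1-3,5)] by blast
    then show ?thesis using E_sym by blast
  qed
  show "gens (gc B \<union> gc C) (B \<union> C)"
    unfolding gens_def
  proof (intro conjI allI impI)
    show "sclosed (gc B \<union> gc C)"
      unfolding sclosed_def
    proof (intro allI impI)
      fix T :: "'a set" assume T: "finite T"
      let ?C1 = "clo (B \<union> (T \<inter> gc B))" and ?C2 = "clo (C \<union> (T \<inter> gc C))"
      have h1: "finite ?C1" "sclosed ?C1" "B \<subseteq> ?C1" "T \<inter> gc B \<subseteq> ?C1" "?C1 \<subseteq> gc B"
        using hull[of B "T \<inter> gc B"] B(1) T by auto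
      have h2: "finite ?C2" "sclosed ?C2" "C \<subseteq> ?C2" "T \<inter> gc C \<subseteq> ?C2" "?C2 \<subseteq> gc C"
        using hull[of C "T \<inter> gc C"] C(1) T by auto
      have "T \<inter> (gc B \<union> gc C) = T \<inter> (?C1 \<union> ?C2)" using h1(4,5) h2(4,5) by blast
      moreover have "sclosed (?C1 \<union> ?C2)" using pair[OF h1(1-3,5) h2(1-3,5)] by blast
      ultimately show "\<delta> (T \<inter> (gc B \<union> gc C)) \<le> \<delta> T" using T by (simp add: sclosed_def)
    qed
    show "B \<union> C \<subseteq> gc B \<union> gc C" using subset_gcl B(1) C(1) by blast
    show "d (B \<union> C \<union> F) = d (B \<union> C)" if "finite F" "F \<subseteq> gc B \<union> gc C" for F
      using that sub by (intro d_gcl BC) auto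
  qed (rule BC)
qed

text \<open>\<open>f1\<close> on \<open>gc B\<close> and \<open>f2\<close> on \<open>gc C\<close>
  combine to a map \<open>p\<close> of the union, as no edges join the two sides outside
  \<open>gc K\<close>. An automorphism agreeing with \<open>p\<close> on \<open>B \<union> C\<close>
  preserves both closures, so \<open>p\<close> is rigid and extends.\<close>

lemma glue_automorphisms:
  assumes B: "finite B" "sclosed B" and C: "finite C" "sclosed C" and K: "finite K" "sclosed K" "K \<subseteq> B" "K \<subseteq> C"
    and free: "sclosed (B \<union> C)" "\<delta> (B \<union> C) = \<delta> B + \<delta> C - \<delta> K"
    and f: "f1 \<in> Aut E" "f2 \<in> Aut E" "eqon (gc K) f1 f2" "f1 ` gc B = gc B" "f2 ` gc C = gc C"
  shows "\<exists>f\<in>Aut E. eqon (gc B) f f1 \<and> eqon (gc C) f f2 \<and> f ` gc (B \<union> C) = gc (B \<union> C)"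
proof -
  note fu = free_union[OF B C K free]
  have BC: "finite (B \<union> C)" using B C by simp
  let ?Y = "gc B \<union> gc C"
  have subK: "gc K \<subseteq> gc B" "gc K \<subseteq> gc C" using gcl_mono B(1) C(1) K(3,4) by auto
  have KX: "K \<subseteq> gc K" by (rule subset_gcl[OF K(1)])
  have f1f2: "f1 ` gc K = f2 ` gc K" using f(3) by (rule image_eqon)
  \<comment> \<open>On \<open>gc K\<close> the map \<open>f1\<close> preserves \<open>gc B\<close>
    and, agreeing with \<open>f2\<close>, also \<open>gc C\<close>; the intersection of the two is
    \<open>gc K\<close>. Consequently the points outside \<open>gc K\<close> stay outside, which the
    missing edges between images rest on.\<close>
  have f1X: "f1 ` gc K \<subseteq> gc K"
  proof -
    have "f1 ` gc K \<subseteq> f1 ` gc B" "f2 ` gc K \<subseteq> f2 ` gc C" using subK by auto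
    then have "f1 ` gc K \<subseteq> gc B \<inter> gc C" using f(4,5) f1f2 by auto
    then show ?thesis unfolding fu(1) .
  qed
  have f1K: "f1 ` gc K = gc K" using f(1) K(1) by (rule gcl_Aut_subset_eq) (use f1X KX in blast)
  then have f2K: "f2 ` gc K = gc K" using f1f2 by simp
  define p where "p z = (if z \<in> gc B then f1 z else f2 z)" for z
  have p1: "p z = f1 z" if "z \<in> gc B" for z using that by (simp add: p_def)
  have p2: "p z = f2 z" if "z \<in> gc C" for z
  proof (cases "z \<in> gc B")
    case True
    then have "z \<in> gc K" using that fu(1) by blast
    then show ?thesis using True f(3) by (simp add: p_def)
  qed (simp add: p_def)
  have pB: "p ` gc B = gc B" using image_cong[OF refl p1, of "gc B"] f(4) by simp
  have pC: "p ` gc C = gc C" using image_cong[OF refl p2, of "gc C"] f(5) by simp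
  have pY: "p ` ?Y = ?Y" using pB pC by (simp add: image_Un)
  have notin: "h z \<notin> gc K" if "h \<in> Aut E" "h ` gc K = gc K" "z \<notin> gc K" for h z
    using that Aut_inv_simps(3)[OF that(1)] by (metis imageE)
  have isoY: "iso_on E p ?Y"
  proof (rule iso_on_Un)
    show "iso_on E p (gc B)" by (rule iso_on_cong[OF Aut_iso_on[OF f(1)]]) (use p1 in auto)
    show "iso_on E p (gc C)" by (rule iso_on_cong[OF Aut_iso_on[OF f(2)]]) (use p2 in auto)
    fix y b assume y: "y \<in> gc B - gc C" and b: "b \<in> gc C - gc B"
    have y1: "y \<in> gc B - gc K" and b1: "b \<in> gc C - gc K" using y b subK by auto
    have py: "p y \<in> gc B - gc K"
    proof -
      have "p y \<in> gc B" using pB y by blast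
      moreover have "p y \<notin> gc K" using p1[of y] notin[OF f(1) f1K, of y] y1 by simp
      ultimately show ?thesis by blast
    qed
    have pb: "p b \<in> gc C - gc K"
    proof -
      have "p b \<in> gc C" using pC b by blast
      moreover have "p b \<notin> gc K" using p2[of b] notin[OF f(2) f2K, of b] b1 by simp
      ultimately show ?thesis by blast
    qed
    have "p y \<noteq> p b"
    proof
      assume "p y = p b"
      then have "p y \<in> gc B \<inter> gc C" using py pb by simp
      then show False using py unfolding fu(1) by simp
    qed
    then show "\<not> E y b \<and> \<not> E b y \<and> \<not> E (p y) (p b) \<and> \<not> E (p b) (p y) \<and> p y \<noteq> p b"
      using fu(3)[OF y1 b1] fu(3)[OF py pb] by blast
  qed
  have sY: "sclosed ?Y" and BCY: "B \<union> C \<subseteq> ?Y" using fu(2) by (auto simp: gens_def)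
  have "rigid ?Y p (B \<union> C)"
    unfolding rigid_def
  proof (intro conjI ballI impI)
    fix h assume h: "h \<in> Aut E" "eqon (B \<union> C) h p"
    have "eqon B h f1" using h(2) p1 subset_gcl[OF B(1)] by auto
    from image_eqon[OF this] have "h ` gc B = gc B"
      using gcl_Aut[OF h(1) B(1)] gcl_Aut[OF f(1) B(1)] f(4) by simp
    moreover have "eqon C h f2" using h(2) p2 subset_gcl[OF C(1)] by auto
    from image_eqon[OF this] have "h ` gc C = gc C"
      using gcl_Aut[OF h(1) C(1)] gcl_Aut[OF f(2) C(1)] f(5) by simp
    ultimately show "h ` ?Y = ?Y" by (simp add: image_Un)
  qed (use fu(2) isoY pY in auto)
  moreover have "partial_iso ?Y p (B \<union> C) (B \<union> C) p"
  proof -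
    have eq: "\<delta> (p ` (B \<union> C)) = \<delta> (B \<union> C)" using delta_iso_on[OF iso_on_subset[OF isoY BCY]] .
    \<comment> \<open>\<open>p\<close> is not yet known to come from an automorphism, so closedness
      of the image is obtained from the preservation of dimension by maps of the closed set
      \<open>?Y\<close>.\<close>
    have "d (p ` (B \<union> C)) = \<delta> (B \<union> C)"
      using d_iso[OF sY isoY pY BC BCY] d_sclosed[OF BC free(1)] by simp
    then have "sclosed (p ` (B \<union> C))" using BC eq by (intro sclosed_if_d) auto
    moreover have "?Y \<union> (B \<union> C) = ?Y" using BCY by blast
    ultimately show ?thesis using BC free(1) isoY by (simp add: partial_iso_def)
  qed
  ultimately have "\<exists>g\<in>Aut E. eqon (?Y \<union> (B \<union> C)) g p" by (rule extend_partial_iso)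
  then obtain g where g: "g \<in> Aut E" "eqon (?Y \<union> (B \<union> C)) g p" by (elim bexE)
  have "g ` (B \<union> C) \<subseteq> gc (B \<union> C)"
  proof -
    have "eqon (B \<union> C) g p" using g(2) by blast
    from image_eqon[OF this] have "g ` (B \<union> C) \<subseteq> p ` ?Y" using image_mono[OF BCY, of p] by simp
    also have "\<dots> \<subseteq> gc (B \<union> C)" unfolding pY using gcl_mono[OF BC] by auto
    finally show ?thesis .
  qed
  then have "g ` gc (B \<union> C) = gc (B \<union> C)" using g(1) BC by (intro gcl_Aut_subset_eq)
  moreover have "eqon (gc B) g f1" "eqon (gc C) g f2" using g(2) p1 p2 by auto
  ultimately show ?thesis using g(1) by blast
qed

section \<open>Closures of finite sets as an amalgamation family\<close>

definition closures :: "'a set set" where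
  "closures = gc ` {A. finite A \<and> m \<le> card A}"

text \<open>The edgeless graph on \<open>m\<close> vertices belongs to the class and embeds, so the
  graph has \<open>m\<close> different vertices, to which \<open>x\<close> can be added.\<close>

lemma ex_large_finite: "\<exists>A. finite (A :: 'a set) \<and> m \<le> card A \<and> x \<in> A"
proof -
  let ?R = "\<lambda>i j::nat. False"
  have "edges ?R T = {}" for T by (simp add: edges_def)
  then have "in_K0 m ?R {..<m}" by (simp add: in_K0_def delta_def)
  moreover have "is_graph ?R" by (simp add: is_graph_def)
  ultimately obtain f :: "nat \<Rightarrow> 'a" where "inj_on f {..<m}" using embed_finite[of ?R "{..<m}"] by blast
  then have "card (f ` {..<m}) = m" by (simp add: card_image)
  then show ?thesis
    by (intro exI[of _ "insert x (f ` {..<m})"]) (auto simp: card_insert_if)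
qed

lemma amalgamation_family_Aut:
  assumes m: "0 < m"
  shows "amalgamation_family (Aut E) closures"
proof unfold_locales
  have cnt: "countable (UNIV :: 'a set)" using generic by (simp add: is_generic_def)
  show "bij g" if "g \<in> Aut E" for g using that by (rule Aut_bij)
  show "id \<in> Aut E" by (rule Aut_id)
  show "g \<circ> h \<in> Aut E" if "g \<in> Aut E" "h \<in> Aut E" for g h using that by (rule Aut_comp)
  show "inv g \<in> Aut E" if "g \<in> Aut E" for g using that by (rule Aut_inv)
  show "g \<in> Aut E" if "bij g" "\<And>F. finite F \<Longrightarrow> \<exists>h\<in>Aut E. eqon F g h" for g
    using that by (rule Aut_closed)
  have "countable {A :: 'a set. finite A}" using countable_Collect_finite_subset[OF cnt] by simp
  then show "countable closures" unfolding closures_def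
    by (intro countable_image) (rule countable_subset[of _ "{A. finite A}"], auto)
  show "\<exists>X\<in>closures. x \<in> X" for x
    using ex_large_finite[of x] subset_gcl unfolding closures_def by blast
  show "\<exists>Z\<in>closures. X \<union> Y \<subseteq> Z" if "X \<in> closures" "Y \<in> closures" for X Y
  proof -
    obtain A B where AB: "finite A" "m \<le> card A" "X = gc A" "finite B" "Y = gc B"
      using \<open>X \<in> closures\<close> \<open>Y \<in> closures\<close> by (auto simp: closures_def)
    have fin: "finite (A \<union> B)" using AB by simp
    have "m \<le> card (A \<union> B)" using AB(2) card_mono[OF fin, of A] by auto
    then show ?thesis using fin AB gcl_mono[OF fin, of A] gcl_mono[OF fin, of B]
      by (intro bexI[of _ "gc (A \<union> B)"]) (auto simp: closures_def)
  qed
  show "g ` X \<in> closures" if g: "g \<in> Aut E" and X: "X \<in> closures" for g X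
  proof -
    obtain A where A: "finite A" "m \<le> card A" "X = gc A" using X by (auto simp: closures_def)
    have "inj_on g A" using bij_is_inj[OF Aut_bij[OF g]] by (rule inj_on_subset) simp
    then show ?thesis using A gcl_Aut[OF g A(1)] by (auto simp: closures_def card_image)
  qed
  show "\<exists>f\<in>Aut E. eqon X f g \<and> f ` Z = Z"
    if g: "g \<in> Aut E" and X: "X \<in> closures" and Z: "Z \<in> closures" and sub: "X \<subseteq> Z" "g ` X \<subseteq> Z" for g X Z
  proof -
    obtain A where A: "finite A" "m \<le> card A" "X = gc A" using X by (auto simp: closures_def)
    obtain D where D: "finite D" "Z = gc D" using Z by (auto simp: closures_def)
    \<comment> \<open>The size condition in \<open>closures\<close> leaves room for the
      \<open>m - 1\<close> prescribed neighbours of linking vertices.\<close>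
    show ?thesis using extend_to_gcl[OF A(1,2) m D(1) g] sub unfolding A(3) D(2) by blast
  qed
  show "\<exists>g\<in>Aut E. \<exists>Z\<in>closures. amalgamates (Aut E) X Y1 Y2 g Z"
    if X: "X \<in> closures" and Y1: "Y1 \<in> closures" and Y2: "Y2 \<in> closures" and sub: "X \<subseteq> Y1" "X \<subseteq> Y2" for X Y1 Y2
  proof -
    obtain A where A: "finite A" "m \<le> card A" "X = gc A" using X by (auto simp: closures_def)
    obtain A1 where A1: "finite A1" "Y1 = gc A1" using Y1 by (auto simp: closures_def)
    obtain A2 where A2: "finite A2" "Y2 = gc A2" using Y2 by (auto simp: closures_def)
    from free_translate[OF A(1) A1(1) A2(1) sub[unfolded A(3) A1(2) A2(2)]]
    obtain g B C K where g: "g \<in> Aut E" "eqon (gc A) g id" and fin: "finite B" "finite C" "finite K"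
      and cl: "sclosed B" "sclosed C" "sclosed K"
      and free: "sclosed (B \<union> C)" "\<delta> (B \<union> C) = \<delta> B + \<delta> C - \<delta> K"
      and K: "A \<subseteq> K" "K \<subseteq> B" "K \<subseteq> C" and gcs: "gc B = g ` gc A1" "gc C = gc A2" "gc K = gc A"
      by (elim bexE exE conjE)
    have BC: "finite (B \<union> C)" using fin by simp
    have "card A \<le> card (B \<union> C)" using K by (intro card_mono BC) auto
    then have Z: "gc (B \<union> C) \<in> closures" using A(2) BC by (auto simp: closures_def)
    have Z1: "g ` Y1 \<subseteq> gc (B \<union> C)" "Y2 \<subseteq> gc (B \<union> C)"
      unfolding A1(2) A2(2) gcs(1)[symmetric] gcs(2)[symmetric] using gcl_mono[OF BC] by auto
    have glue: "\<exists>f\<in>Aut E. eqon (g ` Y1) f f1 \<and> eqon Y2 f f2 \<and> f ` gc (B \<union> C) = gc (B \<union> C)"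
      if f: "f1 \<in> Aut E" "f2 \<in> Aut E" "eqon X f1 f2" "f1 ` g ` Y1 = g ` Y1" "f2 ` Y2 = Y2" for f1 f2
      unfolding A1(2) A2(2) gcs(1)[symmetric] gcs(2)[symmetric]
    proof (rule glue_automorphisms[OF fin(1) cl(1) fin(2) cl(2) fin(3) cl(3) K(2,3) free f(1,2)])
      show "eqon (gc K) f1 f2" using f(3) unfolding A(3) gcs(3) .
      show "f1 ` gc B = gc B" using f(4) unfolding A1(2) gcs(1) .
      show "f2 ` gc C = gc C" using f(5) unfolding A2(2) gcs(2) .
    qed
    have "amalgamates (Aut E) X Y1 Y2 g (gc (B \<union> C))"
      unfolding amalgamates_def
    proof (intro conjI ballI impI)
      show "g x = id x" if "x \<in> X" for x using g(2) that unfolding A(3) by blast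
    qed (use Z1 glue in auto)
    then show ?thesis using g(1) Z by (intro bexI)
  qed
qed

end

section \<open>From the number of cosets to a stabiliser inside the subgroup\<close>

theorem theorem1:
  fixes m :: nat and E :: "'a \<Rightarrow> 'a \<Rightarrow> bool" and H :: "('a \<Rightarrow> 'a) set"
  assumes "m \<ge> 2"
    and "is_generic m E"
    and "is_subgroup E H"
    and "left_cosets E H \<prec> (UNIV :: real set)"
  shows "\<exists>A. finite A \<and> fix_stab E (gcl m E A) \<subseteq> H"
proof -
  interpret generic_graph m E by unfold_locales (rule assms(2))
  interpret amalgamation_family "Aut E" closures
    by (rule amalgamation_family_Aut) (use assms(1) in simp)
  have H: "H \<subseteq> Aut E" "id \<in> H" "\<And>g h. g \<in> H \<Longrightarrow> h \<in> H \<Longrightarrow> g \<circ> h \<in> H" "\<And>g. g \<in> H \<Longrightarrow> inv g \<in> H"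
    using assms(3) by (auto simp: is_subgroup_def)
  have few: "\<exists>a b. a \<noteq> b \<and> inv (y a) \<circ> y b \<in> H" if y: "\<And>r. y r \<in> Aut E" for y :: "nat set \<Rightarrow> 'a \<Rightarrow> 'a"
  proof (rule ccontr)
    assume neg: "\<not> ?thesis"
    \<comment> \<open>Without two such indices the elements \<open>y r\<close> represent different
      cosets for all sets \<open>r\<close> of natural numbers, and these cosets are at least as many
      as the reals.\<close>
    let ?c = "\<lambda>r. (\<lambda>h. y r \<circ> h) ` H"
    have "inj ?c"
    proof (rule injI, rule ccontr)
      fix a b assume eq: "?c a = ?c b" and ab: "a \<noteq> b"
      have "y b \<circ> id \<in> ?c a" unfolding eq using H(2) by blast
      then obtain h where h: "h \<in> H" "y b = y a \<circ> h" by auto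
      have "inv (y a) \<circ> y b = h" using h(2) y[of a] by (simp add: fun_eq_iff)
      then show False using neg ab h(1) by blast
    qed
    moreover have "range ?c \<subseteq> left_cosets E H" using y by (auto simp: left_cosets_def)
    ultimately have "(UNIV :: nat set set) \<lesssim> left_cosets E H" unfolding lepoll_def by blast
    then have "(UNIV :: real set) \<lesssim> left_cosets E H" using real_lepoll_nat_sets lepoll_trans by blast
    then show False using assms(4) by (metis lesspoll_def lepoll_antisym)
  qed
  have "\<exists>X\<in>closures. \<forall>g\<in>Aut E. eqon X g id \<longrightarrow> g \<in> H"
    by (rule small_index_stabiliser) (rule H few | assumption)+
  then obtain A where "finite A" "\<forall>g\<in>Aut E. eqon (gc A) g id \<longrightarrow> g \<in> H"
    by (auto simp: closures_def)
  then show ?thesis by (intro exI[of _ A]) (auto simp: fix_stab_def)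
qed

end
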